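(* Let $\Gamma$ be a connected tropical curve of genus $g\ge2$ and let $\flat,\flat'\in\Gamma$ be two points. Then $$\mathbf v_\flat(\Gamma)-\mathbf v_{\flat'}(\Gamma)=-2\,\mathrm{AJ}(\flat-\flat')\wedge\omega\qquad\text{in }\ \mathrm{JH}_{2,1}(\mathrm{Jac}(\Gamma)).$$
   Context: $\Gamma$ is a connected tropical curve (compact metric graph) of genus (first Betti number) $g\ge2$ with model $(G,\ell)$: $G=(V,E)$ a finite connected graph, $\ell\colon E\to\mathbb R_{>0}$. Edges are oriented; $s_e$, $t_e$ are source and target of $e$. One assumes $G$ has no separating edges (the maps from $\Gamma$ to its Jacobian contract them). **Jacobian.** $H_{\mathbb Z}=\mathrm H_1(\Gamma,\mathbb Z)$. $\Omega_{\mathbb Z}$ is the group of integral harmonic $1$-forms: functions $\omega\colon E\to\mathbb Z$ with $\sum_{s_e=v}\omega(e)=\sum_{t_e=v}\omega(e)$ for all $v\in V$; $\Omega=\Omega_{\mathbb Z}\otimes\mathbb R$. For a path or $1$-chain $\gamma$ in $\Gamma$, $\mathbf I_\gamma\in\Omega^\vee$ is $\omega\mapsto\int_\gamma\omega$, so $\mathbf I_e(\omega)=\ell(e)\omega(e)$. Via $\gamma\mapsto\mathbf I_\gamma$, $H_{\mathbb Z}$ is a full-rank lattice in $\Omega^\vee$, and $\mathrm{Jac}(\Gamma)=\Omega^\vee/H_{\mathbb Z}$, a tropical variety with tangent spaces $\Omega^\vee$ and integral affine structure given by the lattice $\Omega_{\mathbb Z}^\vee\subset\Omega^\vee$. **Homology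 of the Jacobian.** $\mathrm C_{p,q}(\mathrm{Jac}(\Gamma),\mathbb R)$, resp. $\mathrm C_{p,q}(\mathrm{Jac}(\Gamma),\mathbb Z)$, are (polyhedral) $q$-chains on $\mathrm{Jac}(\Gamma)$ with coefficients in $\bigwedge^p\Omega^\vee$, resp. $\bigwedge^p\Omega^\vee_{\mathbb Z}$, written as sums of $[P,v]$. Homology: $\mathrm H_{p,q}(\mathrm{Jac}(\Gamma),\mathbb R)=\bigwedge^qH\otimes\bigwedge^p\Omega^\vee$ with $H=H_{\mathbb Z}\otimes\mathbb R$, and similarly over $\mathbb Z$ with $H_{\mathbb Z}$, $\Omega_{\mathbb Z}^\vee$. The monodromy operator is $\mathrm N([P,v])=\sum_Q\mathrm{sgn}(P,Q)[Q,(o_P-o_Q)\wedge v]$ over facets $Q$ of $P$, where $\mathrm{sgn}(P,Q)$ is the sign of $Q$ in $\partial P$, $o_P\in P$ are chosen points of the cells, and $o_P-o_Q\in\Omega^\vee$ is computed in a lift to the universal cover. It commutes with $\partial$. For $p\ge0$ set $\mathrm L_{p+1,p}=\mathrm N(\mathrm H_{p,p+1}(\mathrm{Jac}(\Gamma),\mathbb Z))$ and $\mathrm{JH}_{p+1,p}(\mathrm{Jac}(\Gamma))=\mathrm H_{p+1,p}(\mathrm{Jac}(\Gamma),\mathbb R)/\mathrm L_{p+1,p}$. For a null-homologous tropical $p$-cycle $\alpha$ on $\mathrm{Jac}(\Gamma)$, $\mathrm{AJ}(\alpha)$ is the class in $\mathrm{JH}_{p+1,p}(\mathrm{Jac}(\Gamma))$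 of $\mathrm N(\xi)$ for any $\xi\in\mathrm C_{p,p+1}(\mathrm{Jac}(\Gamma),\mathbb Z)$ with $\partial\xi$ the fundamental chain of $\alpha$ (independent of choices). The fundamental chain of a $1$-cycle is the sum of weight times $[P,\mathfrak v_P]$, $P$ running over its oriented edges and $\mathfrak v_P$ the primitive integral tangent vector in the direction of $P$. **Ceresa class.** $\Gamma_\flat$ and $\Gamma_\flat^-$ are the images of $\Gamma$ in $\mathrm{Jac}(\Gamma)$ under $x\mapsto\mathbf I_{\gamma_x}$ and $x\mapsto-\mathbf I_{\gamma_x}$, $\gamma_x$ a path from $\flat$ to $x$; they are tropical $1$-cycles (weights $1$). The Ceresa cycle is $\nu_\flat(\Gamma)=[\Gamma_\flat]-[\Gamma^-_\flat]$, which is null-homologous, and the Ceresa class is $\mathbf v_\flat(\Gamma)=\mathrm{AJ}(\nu_\flat(\Gamma))\in\mathrm{JH}_{2,1}(\mathrm{Jac}(\Gamma))$. **The right-hand side.** $\mathrm{AJ}(\flat-\flat')\in\mathrm{JH}_{1,0}(\mathrm{Jac}(\Gamma))=\Omega^\vee/H_{\mathbb Z}$ is the Abel--Jacobi image of the $0$-cycle $[\flat]-[\flat']$, with $\Gamma$ embedded in $\mathrm{Jac}(\Gamma)$ by $x\mapsto\mathbf I_{\gamma_x}$; that is, it is the class in $\mathrm{JH}_{1,0}(\mathrm{Jac}(\Gamma))$ of $\mathrm N(\xi)$ for any $\xi\in\mathrm C_{0,1}(\mathrm{Jac}(\Gamma),\mathbb Z)$ with $\partial\xi=[\flat]-[\flat']$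 (equivalently, the Abel--Jacobi image of $\flat-\flat'$ in $\mathrm{JH}_{1,0}(\Gamma)$ with $\mathrm H_{1,0}(\Gamma,\mathbb R)=\Omega^\vee$). Choose a basis $\mathsf a_1,\dots,\mathsf a_g$ of $H_{\mathbb Z}$, and let $\mathsf b_1,\dots,\mathsf b_g\in\Omega_{\mathbb Z}^\vee$ be the dual basis with respect to the pairing $H_{\mathbb Z}\times\Omega_{\mathbb Z}^\vee\to\mathbb Z$, $(a,b)\mapsto b(\omega_a)$, where $\omega_a\in\Omega_{\mathbb Z}$ has $\omega_a(e)$ equal to the coefficient of $e$ in the cycle $a$. Then $\omega=\sum_i\mathsf a_i\otimes\mathsf b_i\in\mathrm H_{1,1}(\mathrm{Jac}(\Gamma))$ (independent of the basis). For $v\in\Omega^\vee$, $v\wedge\omega=\sum_i\mathsf a_i\otimes(v\wedge\mathsf b_i)\in\mathrm H_{2,1}(\mathrm{Jac}(\Gamma),\mathbb R)$; this gives a well-defined map $\Omega^\vee/H_{\mathbb Z}\to\mathrm{JH}_{2,1}(\mathrm{Jac}(\Gamma))$. *)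

theory Defs
  imports
    "HOL-Analysis.Convex"
    "HOL-Library.Function_Algebras"
    "HOL-Library.Poly_Mapping"
    "HOL-Computational_Algebra.Group_Closure"
    "HOL-Algebra.Coset"
    "Graph_Theory.Digraph_Component"
begin

text \<open>Pointwise scalar multiplication, so that \<^const>\<open>span\<close>, \<^const>\<open>dim\<close> and
  convex hulls apply to the function spaces \<open>\<Omega>\<close>, its dual, and the exterior powers of the dual.\<close>

instantiation "fun" :: (type, real_vector) real_vector
begin
definition scaleR_fun_def: "c *\<^sub>R f = (\<lambda>x. c *\<^sub>R f x)"
instance
  by standard (simp_all add: scaleR_fun_def fun_eq_iff scaleR_add_right scaleR_add_left)
end

type_synonym 'b form = "'b \<Rightarrow> real"
type_synonym 'b covector = "'b form \<Rightarrow> real"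
type_synonym 'b multivector = "'b form list \<Rightarrow> real"
type_synonym 'b cell = "'b covector list set"
type_synonym 'b chain = "'b cell \<Rightarrow>\<^sub>0 'b multivector"

definition drop_at :: "nat \<Rightarrow> 'c list \<Rightarrow> 'c list" where
  "drop_at i xs = take i xs @ drop (Suc i) xs"


subsection \<open>Exterior products of covectors\<close>

text \<open>The exterior algebra of \<open>\<Omega>\<^sup>\<or>\<close> is realised by alternating forms on the finite-dimensional
  space \<open>\<Omega>\<close>, where \<open>v\<^sub>1 \<and> \<dots> \<and> v\<^sub>p\<close> is \<open>(\<omega>\<^sub>1, \<dots>, \<omega>\<^sub>p) \<mapsto> det (v\<^sub>i (\<omega>\<^sub>j))\<close>. Left
  multiplication by a covector is therefore expansion along the first row.\<close>

definition wedge :: "'b covector \<Rightarrow> 'b multivector \<Rightarrow> 'b multivector" where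
  "wedge v \<eta> = (\<lambda>\<omega>s. \<Sum>i<length \<omega>s. (-1) ^ i * v (\<omega>s ! i) * \<eta> (drop_at i \<omega>s))"

definition wedge_one :: "'b multivector" where
  "wedge_one = (\<lambda>\<omega>s. if \<omega>s = [] then 1 else 0)"

definition wedges :: "'b covector list \<Rightarrow> 'b multivector" where
  "wedges vs = foldr wedge vs wedge_one"


subsection \<open>Tropical curves\<close>

text \<open>The arcs of the digraph are the oriented edges of the model; connectivity in the sense of
  \<^const>\<open>connected\<close> ignores the orientation. Loops and parallel edges are allowed.\<close>

locale tropical_curve = fin_digraph G for G :: "('a, 'b) pre_digraph" (structure) +
  fixes len :: "'b \<Rightarrow> real"
  assumes connected_G: "connected G"
    and len_pos: "e \<in> arcs G \<Longrightarrow> 0 < len e"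
    and no_separating_edge: "e \<in> arcs G \<Longrightarrow> connected (del_arc e)"

datatype ('a, 'b) curve_point = Vertex 'a | Inner 'b real

definition rep :: "'c list set \<Rightarrow> 'c list" where
  "rep P = (SOME xs. xs \<in> P)"

context tropical_curve
begin

definition points :: "('a, 'b) curve_point set" where
  "points = Vertex ` verts G \<union> {Inner e t | e t. e \<in> arcs G \<and> 0 < t \<and> t < len e}"

text \<open>The point of the edge \<open>e\<close> at distance \<open>t\<close> from its source.\<close>

definition edge_point :: "'b \<Rightarrow> real \<Rightarrow> ('a, 'b) curve_point" where
  "edge_point e t =
     (if t = 0 then Vertex (tail G e) else if t = len e then Vertex (head G e) else Inner e t)"

text \<open>Paths are piecewise linear: a step \<open>(e, s, t)\<close> runs along \<open>e\<close> from parameter \<open>s\<close> to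
  parameter \<open>t\<close>, backwards if \<open>t < s\<close>.\<close>

fun is_path :: "('a, 'b) curve_point \<Rightarrow> ('b \<times> real \<times> real) list \<Rightarrow> ('a, 'b) curve_point \<Rightarrow> bool" where
  "is_path x [] y \<longleftrightarrow> x \<in> points \<and> x = y"
| "is_path x ((e, s, t) # \<gamma>) y \<longleftrightarrow>
     e \<in> arcs G \<and> s \<in> {0..len e} \<and> t \<in> {0..len e} \<and> x = edge_point e s \<and>
     is_path (edge_point e t) \<gamma> y"


subsection \<open>Homology, harmonic forms and the Jacobian\<close>

text \<open>\<open>H\<^sub>1(\<Gamma>, \<int>)\<close> as the kernel of the boundary map on the cellular 1-chains of the model.\<close>

definition H1Z :: "('b \<Rightarrow> int) set" where
  "H1Z = {a. (\<forall>e. e \<notin> arcs G \<longrightarrow> a e = 0) \<and>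
     (\<forall>v\<in>verts G. (\<Sum>e\<in>in_arcs G v. a e) - (\<Sum>e\<in>out_arcs G v. a e) = 0)}"

definition OmegaZ :: "'b form set" where
  "OmegaZ = {\<omega>. (\<forall>e. e \<notin> arcs G \<longrightarrow> \<omega> e = 0) \<and> (\<forall>e. \<omega> e \<in> \<int>) \<and>
     (\<forall>v\<in>verts G. (\<Sum>e\<in>out_arcs G v. \<omega> e) = (\<Sum>e\<in>in_arcs G v. \<omega> e))}"

definition Omega :: "'b form set" where
  "Omega = span OmegaZ"

definition cycle_form :: "('b \<Rightarrow> int) \<Rightarrow> 'b form" where
  "cycle_form a = (\<lambda>e. of_int (a e))"

text \<open>The first Betti number, computed after extending scalars to \<open>\<real>\<close>.\<close>

definition genus :: nat where
  "genus = dim (cycle_form ` H1Z)"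

text \<open>Elements of \<open>\<Omega>\<^sup>\<or>\<close> are linear functionals on \<open>\<Omega>\<close>, extended by \<open>0\<close> outside \<open>\<Omega>\<close> to make
  equality of functions the right notion of equality.\<close>

definition dual :: "'b covector set" where
  "dual = {\<phi>. (\<forall>\<omega>. \<omega> \<notin> Omega \<longrightarrow> \<phi> \<omega> = 0) \<and>
     (\<forall>\<omega>\<in>Omega. \<forall>\<eta>\<in>Omega. \<phi> (\<omega> + \<eta>) = \<phi> \<omega> + \<phi> \<eta>) \<and>
     (\<forall>c. \<forall>\<omega>\<in>Omega. \<phi> (c *\<^sub>R \<omega>) = c * \<phi> \<omega>)}"

definition dualZ :: "'b covector set" where
  "dualZ = {\<phi> \<in> dual. \<forall>\<omega>\<in>OmegaZ. \<phi> \<omega> \<in> \<int>}"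

definition path_integral :: "('b \<times> real \<times> real) list \<Rightarrow> 'b covector" where
  "path_integral \<gamma> =
     (\<lambda>\<omega>. if \<omega> \<in> Omega then \<Sum>(e, s, t)\<leftarrow>\<gamma>. (t - s) * \<omega> e else 0)"

definition cycle_integral :: "('b \<Rightarrow> int) \<Rightarrow> 'b covector" where
  "cycle_integral a =
     (\<lambda>\<omega>. if \<omega> \<in> Omega then \<Sum>e\<in>arcs G. of_int (a e) * (len e * \<omega> e) else 0)"

definition periods :: "'b covector set" where
  "periods = cycle_integral ` H1Z"


subsection \<open>Chains on the Jacobian\<close>

text \<open>Polyhedral chains are realised by affine simplices. An affine \<open>q\<close>-simplex in
  \<open>Jac(\<Gamma>) = \<Omega>\<^sup>\<or> / H\<^sub>\<int>\<close> is determined by the ordered vertices of a lift to the universal cover, up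
  to simultaneous translation by periods; it is encoded as the set of the vertex lists of all its
  lifts. Degenerate simplices are allowed. In particular the points of the Jacobian are the
  0-simplices.\<close>

definition simplex :: "'b covector list \<Rightarrow> 'b cell" where
  "simplex xs = {map (\<lambda>x. x + h) xs | h. h \<in> periods}"

definition cells :: "nat \<Rightarrow> 'b cell set" where
  "cells q = {simplex xs | xs. length xs = Suc q \<and> set xs \<subseteq> dual}"

definition Ext :: "nat \<Rightarrow> 'b multivector set" where
  "Ext p = span {wedges vs | vs. length vs = p \<and> set vs \<subseteq> dual}"

definition ExtZ :: "nat \<Rightarrow> 'b multivector set" where
  "ExtZ p = group_closure {wedges vs | vs. length vs = p \<and> set vs \<subseteq> dualZ}"

definition chains :: "nat \<Rightarrow> nat \<Rightarrow> 'b chain set" where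
  "chains p q = {c. Poly_Mapping.keys c \<subseteq> cells q \<and> (\<forall>P. Poly_Mapping.lookup c P \<in> Ext p)}"

definition chainsZ :: "nat \<Rightarrow> nat \<Rightarrow> 'b chain set" where
  "chainsZ p q = {c. Poly_Mapping.keys c \<subseteq> cells q \<and> (\<forall>P. Poly_Mapping.lookup c P \<in> ExtZ p)}"

text \<open>The facets of a simplex are obtained by omitting one vertex \<open>i\<close> and have sign \<open>(-1)\<^sup>i\<close>.
  0-simplices have no facets.\<close>

definition bdry :: "'b chain \<Rightarrow> 'b chain" where
  "bdry c = (\<Sum>P\<in>Poly_Mapping.keys c. let xs = rep P in
     if length xs \<le> 1 then 0 else
       (\<Sum>i<length xs. Poly_Mapping.single (simplex (drop_at i xs))
          ((-1) ^ i *\<^sub>R Poly_Mapping.lookup c P)))"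

text \<open>The points \<open>o\<^sub>P \<in> P\<close> are chosen on the lifts of the cells, compatibly with the action of the
  periods, so that \<open>o\<^sub>P - o\<^sub>Q\<close> can be computed in any lift of \<open>P\<close>.\<close>

definition cell_points :: "('b covector list \<Rightarrow> 'b covector) \<Rightarrow> bool" where
  "cell_points pt \<longleftrightarrow> (\<forall>xs. xs \<noteq> [] \<and> set xs \<subseteq> dual \<longrightarrow>
     pt xs \<in> convex hull (set xs) \<and>
     (\<forall>h\<in>periods. pt (map (\<lambda>x. x + h) xs) = pt xs + h))"

definition monodromy :: "('b covector list \<Rightarrow> 'b covector) \<Rightarrow> 'b chain \<Rightarrow> 'b chain" where
  "monodromy pt c = (\<Sum>P\<in>Poly_Mapping.keys c. let xs = rep P in
     if length xs \<le> 1 then 0 else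
       (\<Sum>i<length xs. Poly_Mapping.single (simplex (drop_at i xs))
          ((-1) ^ i *\<^sub>R wedge (pt xs - pt (drop_at i xs)) (Poly_Mapping.lookup c P))))"


subsection \<open>Tropical homology and intermediate Jacobians\<close>

definition cycles :: "nat \<Rightarrow> nat \<Rightarrow> 'b chain set" where
  "cycles p q = {c \<in> chains p q. bdry c = 0}"

definition cyclesZ :: "nat \<Rightarrow> nat \<Rightarrow> 'b chain set" where
  "cyclesZ p q = {c \<in> chainsZ p q. bdry c = 0}"

definition boundaries :: "nat \<Rightarrow> nat \<Rightarrow> 'b chain set" where
  "boundaries p q = bdry ` chains p (Suc q)"

definition cycle_group :: "nat \<Rightarrow> nat \<Rightarrow> 'b chain monoid" where
  "cycle_group p q = \<lparr>carrier = cycles p q, monoid.mult = (+), one = 0\<rparr>"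

definition HR :: "nat \<Rightarrow> nat \<Rightarrow> 'b chain set monoid" where
  "HR p q = cycle_group p q Mod boundaries p q"

definition HR_class :: "nat \<Rightarrow> nat \<Rightarrow> 'b chain \<Rightarrow> 'b chain set" where
  "HR_class p q c = boundaries p q #>\<^bsub>cycle_group p q\<^esub> c"

text \<open>\<open>L\<^sub>p\<^sub>+\<^sub>1\<^sub>,\<^sub>p\<close>, the image of the integral homology \<open>H\<^sub>p\<^sub>,\<^sub>p\<^sub>+\<^sub>1\<close> under the monodromy operator.\<close>

definition Lat :: "('b covector list \<Rightarrow> 'b covector) \<Rightarrow> nat \<Rightarrow> 'b chain set set" where
  "Lat pt p = {HR_class (Suc p) p (monodromy pt \<zeta>) | \<zeta>. \<zeta> \<in> cyclesZ p (Suc p)}"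

text \<open>\<open>JH pt p\<close> is \<open>JH\<^sub>p\<^sub>+\<^sub>1\<^sub>,\<^sub>p(Jac(\<Gamma>))\<close>.\<close>

definition JH :: "('b covector list \<Rightarrow> 'b covector) \<Rightarrow> nat \<Rightarrow> 'b chain set set monoid" where
  "JH pt p = HR (Suc p) p Mod Lat pt p"

definition JH_class :: "('b covector list \<Rightarrow> 'b covector) \<Rightarrow> nat \<Rightarrow> 'b chain \<Rightarrow> 'b chain set set" where
  "JH_class pt p c = Lat pt p #>\<^bsub>HR (Suc p) p\<^esub> HR_class (Suc p) p c"


subsection \<open>Tropical cycles and the Abel--Jacobi map\<close>

definition primitive :: "'b covector \<Rightarrow> bool" where
  "primitive v \<longleftrightarrow> v \<in> dualZ \<and> v \<noteq> 0 \<and>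
     (\<forall>w\<in>dualZ. \<forall>k :: int. v = of_int k *\<^sub>R w \<longrightarrow> \<bar>k\<bar> = 1)"

definition primitive_direction :: "'b covector \<Rightarrow> 'b covector" where
  "primitive_direction u = (THE v. primitive v \<and> (\<exists>c>0. u = c *\<^sub>R v))"

text \<open>Tropical cycles of dimension at most 1 are given by integer weights on oriented cells. The
  coefficient of a cell in the fundamental chain is its weight times the primitive tangent vector
  (for an edge) or times \<open>1 \<in> \<And>\<^sup>0 \<Omega>\<^sup>\<or>\<^sub>\<int>\<close> (for a point).\<close>

definition tangent :: "'b cell \<Rightarrow> 'b multivector" where
  "tangent P = (let xs = rep P in
     if length xs = 2 then wedges [primitive_direction (xs ! 1 - xs ! 0)] else wedges [])"

definition fundamental_chain :: "('b cell \<Rightarrow>\<^sub>0 int) \<Rightarrow> 'b chain" where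
  "fundamental_chain \<alpha> = (\<Sum>P\<in>Poly_Mapping.keys \<alpha>.
     Poly_Mapping.single P (of_int (Poly_Mapping.lookup \<alpha> P) *\<^sub>R tangent P))"

definition AJ ::
    "('b covector list \<Rightarrow> 'b covector) \<Rightarrow> nat \<Rightarrow> ('b cell \<Rightarrow>\<^sub>0 int) \<Rightarrow> 'b chain set set" where
  "AJ pt p \<alpha> = (THE X. \<exists>\<xi>\<in>chainsZ p (Suc p).
     bdry \<xi> = fundamental_chain \<alpha> \<and> X = JH_class pt p (monodromy pt \<xi>))"


subsection \<open>The Ceresa class\<close>

text \<open>A lift to \<open>\<Omega>\<^sup>\<or>\<close> of the image of \<open>x\<close> under the Abel--Jacobi embedding based at \<open>b\<close>; the choice
  of the path matters only up to periods.\<close>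

definition AJ_lift :: "('a, 'b) curve_point \<Rightarrow> ('a, 'b) curve_point \<Rightarrow> 'b covector" where
  "AJ_lift b x = path_integral (SOME \<gamma>. is_path b \<gamma> x)"

definition AJ_edge :: "('a, 'b) curve_point \<Rightarrow> 'b \<Rightarrow> 'b covector list" where
  "AJ_edge b e = (let u = AJ_lift b (Vertex (tail G e)) in
     [u, u + path_integral [(e, 0, len e)]])"

definition curve_cycle :: "('a, 'b) curve_point \<Rightarrow> 'b cell \<Rightarrow>\<^sub>0 int" where
  "curve_cycle b = (\<Sum>e\<in>arcs G. Poly_Mapping.single (simplex (AJ_edge b e)) 1)"

definition curve_cycle_neg :: "('a, 'b) curve_point \<Rightarrow> 'b cell \<Rightarrow>\<^sub>0 int" where
  "curve_cycle_neg b = (\<Sum>e\<in>arcs G. Poly_Mapping.single (simplex (map uminus (AJ_edge b e))) 1)"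

definition ceresa_cycle :: "('a, 'b) curve_point \<Rightarrow> 'b cell \<Rightarrow>\<^sub>0 int" where
  "ceresa_cycle b = curve_cycle b - curve_cycle_neg b"

definition ceresa_class ::
    "('b covector list \<Rightarrow> 'b covector) \<Rightarrow> ('a, 'b) curve_point \<Rightarrow> 'b chain set set" where
  "ceresa_class pt b = AJ pt 1 (ceresa_cycle b)"


subsection \<open>Wedging with the polarisation class\<close>

text \<open>The 0-cycle \<open>[b] - [b']\<close> in the Jacobian, for the embedding based at \<open>b\<close>.\<close>

definition point_difference ::
    "('a, 'b) curve_point \<Rightarrow> ('a, 'b) curve_point \<Rightarrow> 'b cell \<Rightarrow>\<^sub>0 int" where
  "point_difference b b' =
     Poly_Mapping.single (simplex [AJ_lift b b]) 1 - Poly_Mapping.single (simplex [AJ_lift b b']) 1"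

definition is_basis :: "(nat \<Rightarrow> 'b \<Rightarrow> int) \<Rightarrow> bool" where
  "is_basis as \<longleftrightarrow> (\<forall>i<genus. as i \<in> H1Z) \<and>
     (\<forall>h\<in>H1Z. \<exists>!c :: nat \<Rightarrow> int. (\<forall>i\<ge>genus. c i = 0) \<and> h = (\<lambda>e. \<Sum>i<genus. c i * as i e))"

definition is_dual_basis :: "(nat \<Rightarrow> 'b \<Rightarrow> int) \<Rightarrow> (nat \<Rightarrow> 'b covector) \<Rightarrow> bool" where
  "is_dual_basis as bs \<longleftrightarrow> (\<forall>i<genus. bs i \<in> dualZ) \<and>
     (\<forall>i<genus. \<forall>j<genus. bs i (cycle_form (as j)) = (if i = j then 1 else 0))"

text \<open>A chain representing \<open>a \<otimes> \<eta> \<in> H\<^sub>1 \<otimes> \<And>\<^sup>p \<Omega>\<^sup>\<or> = H\<^sub>p\<^sub>,\<^sub>1(Jac(\<Gamma>))\<close>: the closed geodesic through the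
  origin whose class is \<open>a\<close>, with constant coefficient \<open>\<eta>\<close>.\<close>

definition tensor :: "('b \<Rightarrow> int) \<Rightarrow> 'b multivector \<Rightarrow> 'b chain" where
  "tensor a \<eta> = Poly_Mapping.single (simplex [0, cycle_integral a]) \<eta>"

definition wedge_omega_chain ::
    "(nat \<Rightarrow> 'b \<Rightarrow> int) \<Rightarrow> (nat \<Rightarrow> 'b covector) \<Rightarrow> 'b covector \<Rightarrow> 'b chain" where
  "wedge_omega_chain as bs v = (\<Sum>i<genus. tensor (as i) (wedges [v, bs i]))"

text \<open>The map \<open>JH\<^sub>1\<^sub>,\<^sub>0 \<rightarrow> JH\<^sub>2\<^sub>,\<^sub>1\<close> induced by \<open>v \<mapsto> v \<and> \<omega>\<close>. The identification
  \<open>\<Omega>\<^sup>\<or> = H\<^sub>1\<^sub>,\<^sub>0(Jac(\<Gamma>))\<close> sends \<open>v\<close> to the class of the origin with coefficient \<open>v\<close>.\<close>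

definition wedge_omega ::
    "('b covector list \<Rightarrow> 'b covector) \<Rightarrow> (nat \<Rightarrow> 'b \<Rightarrow> int) \<Rightarrow> (nat \<Rightarrow> 'b covector) \<Rightarrow>
      'b chain set set \<Rightarrow> 'b chain set set" where
  "wedge_omega pt as bs X = (THE Y. \<exists>v\<in>dual.
     X = JH_class pt 0 (Poly_Mapping.single (simplex [0]) (wedges [v])) \<and>
     Y = JH_class pt 1 (wedge_omega_chain as bs v))"

end

end

theory Submission
  imports Defs
begin

text \<open>
  Write \<open>[x, y, \<dots>]\<eta>\<close> for a simplex with coefficient \<open>\<eta>\<close>. The monodromy operators of two choices of points
  in the cells are chain homotopic (\<open>monodromy_change_points\<close>), and the homotopy vanishes on the
  fundamental chains that occur, because there the coefficient of an edge is tangent to it. So intermediate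
  Jacobians and Abel--Jacobi images may be computed with the first vertex of each simplex as the chosen
  point, which is \<^const>\<open>hd\<close> on vertex lists. With this choice only one facet contributes:
  \<open>N([x\<^sub>0, x\<^sub>1, \<dots>, x\<^sub>q]\<eta>) = [x\<^sub>1, \<dots>, x\<^sub>q]((x\<^sub>0 - x\<^sub>1) \<and> \<eta>)\<close>.

  Let \<open>w\<close> be the integral along a path from \<open>b\<close> to \<open>b'\<close>. A segment from \<open>w\<close> to \<open>0\<close> bounds \<open>[b] - [b']\<close>, so the
  Abel--Jacobi image of this 0-cycle is the class of \<open>w\<close>. The curve based at \<open>b\<close> is the translate by \<open>w\<close> of
  the curve based at \<open>b'\<close>, and the negative of the former is the translate by \<open>-w\<close> of the negative of the
  latter. A chain that bounds the difference of
  the two Ceresa cycles is therefore the prism swept out by the curve minus the prism swept out by its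
  negative. The side walls of a prism cancel because the tangent vectors are balanced at every vertex
  (\<open>bdry_prism\<close>), and the triangles that begin with an edge of the curve contribute nothing to the
  monodromy; what remains of the first prism is \<open>-w \<and> \<Gamma>\<close>, where \<open>w\<close> is multiplied into the coefficients
  (\<open>monodromy_prism\<close>). On the negative both \<open>w\<close> and the tangent vectors change sign, so its prism, which is
  subtracted, gives \<open>\<Gamma>\<^sup>-\<close> with coefficients \<open>w \<and> \<tau>\<close>, where \<open>\<tau>\<close> denotes the tangent vectors of \<open>\<Gamma>\<close>.

  It remains to identify these cycles in homology. Coning a balanced image of the curve to the origin
  replaces each edge \<open>e\<close> by the closed geodesic of a cycle \<open>k e\<close>, the edge closed up by chosen paths from the
  base point (\<open>edge_chain_homologous\<close>). Since \<open>\<Sum>\<^sub>e a e \<cdot> k e = a\<close> for every cycle \<open>a\<close>, the element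
  \<open>\<Sum>\<^sub>e k e \<otimes> \<tau> e\<close> is \<open>\<omega> = \<Sum>\<^sub>i a\<^sub>i \<otimes> b\<^sub>i\<close> (\<open>dual_basis_coefficients\<close>). On the negative of the curve
  \<open>k e\<close> changes sign. Hence the curve contributes \<open>-w \<and> \<omega>\<close> and its negative contributes it once more
  (\<open>ceresa_difference\<close>). The same computation over the integers, where the tangent vectors of the negative
  change sign as well, shows that the Ceresa cycle is null-homologous, so that its Abel--Jacobi image is
  defined (\<open>ceresa_null_homologous\<close>).

  Finally \<open>v \<mapsto> v \<and> \<omega>\<close> is well defined modulo periods. If \<open>v\<close> and \<open>v'\<close> have the same class, an augmentation
  argument shows that \<open>v - v'\<close> is a period \<open>h\<close> (\<open>JH_class_point_eqD\<close>). The integral 2-cycle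
  \<open>\<Sum>\<^sub>i (a\<^sub>i \<times> h)b\<^sub>i\<close>, a sum of tori, has monodromy \<open>h \<and> \<omega>\<close> minus the closed geodesic of \<open>h\<close> with coefficient
  \<open>\<Sum>\<^sub>i a\<^sub>i \<and> b\<^sub>i\<close>, and this coefficient vanishes by the symmetry of the polarisation
  (\<open>sum_basis_wedge_dual_basis\<close>).
\<close>

section \<open>Additive maps on finitely supported functions\<close>

definition linear_ext ::
    "('k \<Rightarrow> 'v::ab_group_add \<Rightarrow> 'w::ab_group_add) \<Rightarrow> ('k \<Rightarrow>\<^sub>0 'v) \<Rightarrow> 'w" where
  "linear_ext g c = (\<Sum>P\<in>Poly_Mapping.keys c. g P (Poly_Mapping.lookup c P))"

lemma additive_linear_ext:
  assumes "\<And>P. additive (g P)"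
  shows "additive (linear_ext g)"
proof
  fix c d
  show "linear_ext g (c + d) = linear_ext g c + linear_ext g d"
    unfolding linear_ext_def
    by (rule setsum_keys_plus_distrib) (use assms in \<open>auto simp: additive.zero additive.add\<close>)
qed

lemma linear_ext_single:
  assumes "additive (g P)"
  shows "linear_ext g (Poly_Mapping.single P x) = g P x"
  using additive.zero[OF assms] by (cases "x = 0") (auto simp: linear_ext_def)

lemma sum_singles: "(\<Sum>P\<in>Poly_Mapping.keys c. Poly_Mapping.single P (Poly_Mapping.lookup c P)) = c"
  by (rule poly_mapping_eqI)
    (auto simp: lookup_sum lookup_single when_def in_keys_iff)

lemma additive_eq_on_singles:
  assumes "additive f" "additive f'"
    and "\<And>P. P \<in> Poly_Mapping.keys c \<Longrightarrow>
      f (Poly_Mapping.single P (Poly_Mapping.lookup c P)) = f' (Poly_Mapping.single P (Poly_Mapping.lookup c P))"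
  shows "f c = f' c"
proof -
  have "f (\<Sum>P\<in>Poly_Mapping.keys c. Poly_Mapping.single P (Poly_Mapping.lookup c P))
      = f' (\<Sum>P\<in>Poly_Mapping.keys c. Poly_Mapping.single P (Poly_Mapping.lookup c P))"
    unfolding additive.sum[OF assms(1)] additive.sum[OF assms(2)] by (intro sum.cong refl assms(3))
  then show ?thesis
    by (simp only: sum_singles)
qed

definition add_subgroup :: "'m::ab_group_add set \<Rightarrow> bool" where
  "add_subgroup B \<longleftrightarrow> 0 \<in> B \<and> (\<forall>x\<in>B. \<forall>y\<in>B. x - y \<in> B)"

lemma add_subgroup_zero: "add_subgroup B \<Longrightarrow> 0 \<in> B"
  by (simp add: add_subgroup_def)

lemma add_subgroup_diff: "add_subgroup B \<Longrightarrow> x \<in> B \<Longrightarrow> y \<in> B \<Longrightarrow> x - y \<in> B"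
  by (simp add: add_subgroup_def)

lemma add_subgroup_uminus: "add_subgroup B \<Longrightarrow> x \<in> B \<Longrightarrow> - x \<in> B"
  using add_subgroup_diff[of B 0 x] add_subgroup_zero[of B] by simp

lemma add_subgroup_add: "add_subgroup B \<Longrightarrow> x \<in> B \<Longrightarrow> y \<in> B \<Longrightarrow> x + y \<in> B"
  using add_subgroup_diff[of B x "- y"] add_subgroup_uminus[of B y] by simp

lemma add_subgroup_sum: "add_subgroup B \<Longrightarrow> (\<And>i. i \<in> I \<Longrightarrow> f i \<in> B) \<Longrightarrow> sum f I \<in> B"
  by (induction I rule: infinite_finite_induct) (auto intro: add_subgroup_zero add_subgroup_add)

lemma add_subgroup_of_int:
  fixes x :: "'m::real_vector"
  assumes "add_subgroup B" "x \<in> B"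
  shows "of_int n *\<^sub>R x \<in> B"
proof (induction n rule: int_induct[where k = 0])
  case base then show ?case using assms by (simp add: add_subgroup_zero)
next
  case (step1 i) then show ?case using assms by (simp add: add_subgroup_add scaleR_left_distrib)
next
  case (step2 i) then show ?case using assms by (simp add: add_subgroup_diff scaleR_left_diff_distrib)
qed

lemma add_subgroup_image:
  assumes "additive f" "add_subgroup B"
  shows "add_subgroup (f ` B)"
proof -
  have "f 0 \<in> f ` B"
    using assms(2) by (intro imageI add_subgroup_zero)
  moreover have "f x - f y \<in> f ` B" if "x \<in> B" "y \<in> B" for x y
    using add_subgroup_diff[OF assms(2) that] additive.diff[OF assms(1), of x y] by (metis imageI)
  ultimately show ?thesis
    by (auto simp: add_subgroup_def additive.zero[OF assms(1)])
qed

lemma add_subgroup_group_closure: "add_subgroup (group_closure S)"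
  by (auto simp: add_subgroup_def intro: group_closure.intros)

lemma add_subgroup_subspace: "subspace B \<Longrightarrow> add_subgroup B"
  by (auto simp: add_subgroup_def subspace_0 subspace_diff)

lemma add_subgroup_subset_group_closure:
  assumes "add_subgroup B" "S \<subseteq> B"
  shows "group_closure S \<subseteq> B"
proof
  fix x assume "x \<in> group_closure S"
  then show "x \<in> B"
    by induction (use assms in \<open>auto intro: add_subgroup_zero add_subgroup_diff\<close>)
qed

lemma additive_mem_on_singles:
  assumes "additive f" "add_subgroup B"
    and "\<And>P. P \<in> Poly_Mapping.keys c \<Longrightarrow> f (Poly_Mapping.single P (Poly_Mapping.lookup c P)) \<in> B"
  shows "f c \<in> B"
proof -
  have "f (\<Sum>P\<in>Poly_Mapping.keys c. Poly_Mapping.single P (Poly_Mapping.lookup c P)) \<in> B"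
    unfolding additive.sum[OF assms(1)] by (intro add_subgroup_sum assms)
  then show ?thesis
    by (simp only: sum_singles)
qed

lemma additive_single: "additive (Poly_Mapping.single P)"
  by standard (simp add: single_add)

lemma sum_single:
  fixes f :: "'i \<Rightarrow> 'v::ab_group_add"
  shows "(\<Sum>i\<in>I. Poly_Mapping.single P (f i)) = Poly_Mapping.single P (\<Sum>i\<in>I. f i)"
  by (rule additive.sum[OF additive_single, symmetric])

text \<open>The intended \<open>F x \<eta>\<close> is the closed geodesic of the period \<open>x\<close> with coefficient \<open>\<eta>\<close>, which is
  additive in \<open>x\<close> only up to the subgroup \<open>B\<close> of boundaries. Both sides then depend additively on \<open>n\<close>
  modulo \<open>B\<close> and agree for \<open>n = 1\<close>.\<close>

lemma biadditive_modulo_of_int: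
  fixes F :: "'x::real_vector \<Rightarrow> 'm::real_vector \<Rightarrow> 'c::ab_group_add"
  assumes B: "add_subgroup B" and H: "add_subgroup H" "x \<in> H"
    and left: "\<And>x y. x \<in> H \<Longrightarrow> y \<in> H \<Longrightarrow> F (x + y) \<eta> - F x \<eta> - F y \<eta> \<in> B"
    and right: "additive (F x)"
  shows "F (of_int n *\<^sub>R x) \<eta> - F x (of_int n *\<^sub>R \<eta>) \<in> B"
proof -
  have zero: "F 0 \<eta> \<in> B"
    using left[of 0 0] add_subgroup_zero[OF H(1)] add_subgroup_uminus[OF B] by fastforce
  show ?thesis
  proof (induction n rule: int_induct[where k = 0])
    case base
    then show ?case using zero by (simp add: additive.zero[OF right])
  next
    case (step1 i)
    have "F (of_int i *\<^sub>R x + x) \<eta> - F (of_int i *\<^sub>R x) \<eta> - F x \<eta> \<in> B"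
      by (intro left add_subgroup_of_int H)
    from add_subgroup_add[OF B this step1(2)] show ?case
      by (simp add: scaleR_left_distrib additive.add[OF right] algebra_simps)
  next
    case (step2 i)
    have "F (of_int (i - 1) *\<^sub>R x + x) \<eta> - F (of_int (i - 1) *\<^sub>R x) \<eta> - F x \<eta> \<in> B"
      by (intro left add_subgroup_of_int H)
    from add_subgroup_diff[OF B step2(2) this] show ?case
      by (simp add: scaleR_left_diff_distrib additive.diff[OF right] algebra_simps)
  qed
qed

lemma additive_modulo_sum:
  fixes f :: "'x::ab_group_add \<Rightarrow> 'c::ab_group_add"
  assumes B: "add_subgroup B" and H: "add_subgroup H" "\<And>i. i \<in> I \<Longrightarrow> x i \<in> H"
    and left: "\<And>x y. x \<in> H \<Longrightarrow> y \<in> H \<Longrightarrow> f (x + y) - f x - f y \<in> B"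
  shows "f (\<Sum>i\<in>I. x i) - (\<Sum>i\<in>I. f (x i)) \<in> B"
proof -
  have zero: "f 0 \<in> B"
    using left[of 0 0] add_subgroup_zero[OF H(1)] add_subgroup_uminus[OF B] by fastforce
  show ?thesis using H(2)
  proof (induction I rule: infinite_finite_induct)
    case (insert i I)
    then have "f (x i + sum x I) - f (x i) - f (sum x I) \<in> B"
      by (intro left add_subgroup_sum H(1)) auto
    moreover have "f (sum x I) - (\<Sum>i\<in>I. f (x i)) \<in> B"
      using insert by auto
    ultimately show ?case
      using add_subgroup_add[OF B] insert by (fastforce simp: algebra_simps)
  qed (use zero in auto)
qed


section \<open>Faces of faces\<close>

lemma length_drop_at [simp]: "i < length xs \<Longrightarrow> length (drop_at i xs) = length xs - 1"
  by (simp add: drop_at_def)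

lemma set_drop_at: "set (drop_at i xs) \<subseteq> set xs"
  by (auto simp: drop_at_def dest: in_set_takeD in_set_dropD)

lemma map_drop_at: "map f (drop_at i xs) = drop_at i (map f xs)"
  by (simp add: drop_at_def take_map drop_map)

lemma drop_at_simps [simp]:
  "drop_at 0 (x # xs) = xs" "drop_at (Suc i) (x # xs) = x # drop_at i xs" "drop_at i [] = []"
  by (simp_all add: drop_at_def)

lemma drop_at_drop_at:
  "j < i \<Longrightarrow> drop_at j (drop_at i xs) = drop_at (i - 1) (drop_at j xs)"
proof (induction xs arbitrary: i j)
  case (Cons x xs)
  then obtain i' where i: "i = Suc i'" by (cases i) auto
  show ?case
  proof (cases j)
    case (Suc j')
    moreover obtain i'' where "i' = Suc i''" using Cons.prems i Suc by (cases i') auto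
    ultimately show ?thesis using Cons i by simp
  qed (simp add: i)
qed simp

text \<open>Removing two entries in either order gives the same list with opposite signs; this is the
  cancellation behind \<open>\<partial>\<^sup>2 = 0\<close>.\<close>

lemma alternating_double_sum:
  fixes S :: "nat \<Rightarrow> 'c list \<Rightarrow> 'm::ab_group_add"
  assumes sign: "\<And>k ys. S (Suc k) ys = - S k ys"
  shows "(\<Sum>i<length xs. \<Sum>j<length xs - 1. S (i + j) (drop_at j (drop_at i xs))) = 0"
proof -
  define n where "n = length xs"
  define T where "T = (\<lambda>(i, j). S (i + j) (drop_at j (drop_at i xs)))"
  let ?lo = "{(i, j). i < n \<and> j < i}" and ?hi = "{(i, j). j < n - 1 \<and> i \<le> j}"
  have fin: "finite ?lo" "finite ?hi"
    by (rule finite_subset[of _ "{..<n} \<times> {..<n}"]; auto)+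
  have split: "{..<n} \<times> {..<n - 1} = ?lo \<union> ?hi"
    by auto
  have "(\<Sum>i<n. \<Sum>j<n - 1. S (i + j) (drop_at j (drop_at i xs))) = sum T (?lo \<union> ?hi)"
    unfolding split[symmetric] T_def by (simp add: sum.cartesian_product)
  also have "\<dots> = sum T ?lo + sum T ?hi"
    by (rule sum.union_disjoint[OF fin]) auto
  (* removing entry i and then j < i equals removing j and then i - 1, which is in the other half *)
  also have "sum T ?lo = (\<Sum>p\<in>?hi. - T p)"
  proof (rule sum.reindex_bij_witness[where i = "\<lambda>(i, j). (Suc j, i)" and j = "\<lambda>(i, j). (j, i - 1)"])
    fix p assume "p \<in> ?lo"
    then obtain i j where p: "p = (i, j)" "i < n" "j < i" by auto
    have "S (i + j) ys = - S (j + (i - 1)) ys" for ys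
      using sign[of "j + (i - 1)" ys] p by (simp add: add.commute)
    then show "- T (case p of (i, j) \<Rightarrow> (j, i - 1)) = T p"
      using p by (simp add: T_def drop_at_drop_at)
  qed auto
  finally show ?thesis
    by (simp add: n_def sum_negf)
qed


section \<open>Exterior products\<close>

lemma scaleR_fun_apply [simp]: "(c *\<^sub>R f) x = c *\<^sub>R f x"
  by (simp add: scaleR_fun_def)

lemma linear_wedge: "linear (wedge v)"
  by (rule linearI)
    (auto simp: wedge_def fun_eq_iff algebra_simps sum.distrib sum_distrib_left)

lemma wedge_add_left: "wedge (u + v) \<eta> = wedge u \<eta> + wedge v \<eta>"
  by (auto simp: wedge_def fun_eq_iff algebra_simps sum.distrib)

lemma wedge_scaleR_left: "wedge (c *\<^sub>R u) \<eta> = c *\<^sub>R wedge u \<eta>"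
  by (auto simp: wedge_def fun_eq_iff algebra_simps sum_distrib_left)

lemma additive_wedge_left: "additive (\<lambda>u. wedge u \<eta>)"
  by standard (rule wedge_add_left)

lemma additive_wedge: "additive (wedge v)"
  by standard (simp add: linear_add[OF linear_wedge])

lemmas wedge_minus_left = additive.minus[OF additive_wedge_left]
lemmas wedge_diff_left = additive.diff[OF additive_wedge_left]
lemmas wedge_zero_left [simp] = additive.zero[OF additive_wedge_left]

lemma wedges_Cons: "wedges (v # vs) = wedge v (wedges vs)"
  by (simp add: wedges_def)

lemma wedges_single: "wedges [v] = (\<lambda>\<omega>s. if length \<omega>s = 1 then v (\<omega>s ! 0) else 0)"
proof
  fix \<omega>s :: "'a form list"
  show "wedges [v] \<omega>s = (if length \<omega>s = 1 then v (\<omega>s ! 0) else 0)"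
  proof (cases \<omega>s)
    case (Cons x xs)
    have "drop_at i \<omega>s \<noteq> []" if "length \<omega>s > 1" "i < length \<omega>s" for i
      using that length_drop_at[OF that(2)] by fastforce
    then show ?thesis
      by (auto simp: wedges_def wedge_def wedge_one_def Cons)
  qed (simp add: wedges_def wedge_def)
qed

lemma wedges_pair:
  "wedges [u, v] = (\<lambda>\<omega>s. if length \<omega>s = 2
     then u (\<omega>s ! 0) * v (\<omega>s ! 1) - u (\<omega>s ! 1) * v (\<omega>s ! 0) else 0)"
proof
  fix \<omega>s :: "'a form list"
  have "wedges [u, v] \<omega>s = 0" if "length \<omega>s \<noteq> 2"
    unfolding wedges_Cons[of u] wedge_def wedges_single
    by (rule sum.neutral) (use that in auto)
  moreover have "wedges [u, v] \<omega>s = u (\<omega>s ! 0) * v (\<omega>s ! 1) - u (\<omega>s ! 1) * v (\<omega>s ! 0)"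
    if len: "length \<omega>s = 2"
  proof -
    obtain x y where "\<omega>s = [x, y]"
      using len by (cases \<omega>s; cases "tl \<omega>s") auto
    then show ?thesis
      unfolding wedges_Cons[of u] wedge_def wedges_single by (simp add: lessThan_Suc)
  qed
  ultimately show "wedges [u, v] \<omega>s = (if length \<omega>s = 2
     then u (\<omega>s ! 0) * v (\<omega>s ! 1) - u (\<omega>s ! 1) * v (\<omega>s ! 0) else 0)" by simp
qed

lemma additive_wedges_single: "additive (\<lambda>v. wedges [v])"
  by standard (auto simp: wedges_single fun_eq_iff)

lemma inj_wedges_single: "wedges [u] = wedges [v] \<longleftrightarrow> u = v"
proof
  assume *: "wedges [u] = wedges [v]"
  have "u x = v x" for x
    using fun_cong[OF *, of "[x]"] by (simp add: wedges_single)
  then show "u = v" by auto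
qed simp

lemma sum_apply: "(\<Sum>i\<in>I. f i) x = (\<Sum>i\<in>I. f i x)"
  for f :: "'i \<Rightarrow> 'x \<Rightarrow> 'y::comm_monoid_add"
  by (induction I rule: infinite_finite_induct) auto

lemma wedges_single_scaleR: "wedges [c *\<^sub>R v] = c *\<^sub>R wedges [v]"
  by (auto simp: wedges_single fun_eq_iff)

lemma wedge_self: "wedge (c *\<^sub>R v) (wedges [v]) = 0"
  unfolding wedge_scaleR_left wedges_Cons[symmetric] by (auto simp: wedges_pair fun_eq_iff)


context tropical_curve
begin

section \<open>Periods, dual covectors and simplices\<close>

lemma add_subgroup_H1Z: "add_subgroup H1Z"
  by (auto simp: add_subgroup_def H1Z_def sum_subtractf algebra_simps)

lemma subspace_Omega: "subspace Omega"
  by (simp add: Omega_def subspace_span)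

lemma dual_outside: "\<phi> \<in> dual \<Longrightarrow> \<omega> \<notin> Omega \<Longrightarrow> \<phi> \<omega> = 0"
  by (simp add: dual_def)

lemma dual_add: "\<phi> \<in> dual \<Longrightarrow> \<omega> \<in> Omega \<Longrightarrow> \<eta> \<in> Omega \<Longrightarrow> \<phi> (\<omega> + \<eta>) = \<phi> \<omega> + \<phi> \<eta>"
  by (simp add: dual_def)

lemma dual_scaleR: "\<phi> \<in> dual \<Longrightarrow> \<omega> \<in> Omega \<Longrightarrow> \<phi> (c *\<^sub>R \<omega>) = c * \<phi> \<omega>"
  by (simp add: dual_def)

lemma subspace_dual: "subspace dual"
  by (rule subspaceI) (auto simp: dual_def algebra_simps)

lemma dual_sum:
  assumes "\<phi> \<in> dual" "\<And>i. i \<in> I \<Longrightarrow> f i \<in> Omega"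
  shows "\<phi> (\<Sum>i\<in>I. f i) = (\<Sum>i\<in>I. \<phi> (f i))"
  using assms(2)
proof (induction I rule: infinite_finite_induct)
  case (insert i I)
  then have "\<phi> (f i + sum f I) = \<phi> (f i) + \<phi> (sum f I)"
    by (intro dual_add[OF assms(1)] subspace_sum[OF subspace_Omega]) auto
  moreover have "sum f (insert i I) = f i + sum f I"
    using insert by simp
  ultimately show ?case
    using insert by (simp del: plus_fun_apply)
qed (use dual_scaleR[OF assms(1) subspace_0[OF subspace_Omega], of 0] in auto)

text \<open>Integral harmonic forms span \<^const>\<open>Omega\<close>, and elements of \<^const>\<open>dual\<close> vanish off it.\<close>

lemma dual_eqI:
  assumes "\<phi> \<in> dual" "\<psi> \<in> dual" "\<And>\<omega>. \<omega> \<in> OmegaZ \<Longrightarrow> \<phi> \<omega> = \<psi> \<omega>"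
  shows "\<phi> = \<psi>"
proof
  fix \<omega>
  show "\<phi> \<omega> = \<psi> \<omega>"
  proof (cases "\<omega> \<in> Omega")
    case True
    have sub: "subspace {\<omega> \<in> Omega. \<phi> \<omega> = \<psi> \<omega>}"
    proof (rule subspaceI)
      have "0 \<in> Omega" by (rule subspace_0[OF subspace_Omega])
      then show "0 \<in> {\<omega> \<in> Omega. \<phi> \<omega> = \<psi> \<omega>}"
        using dual_scaleR[OF assms(1), of 0 0] dual_scaleR[OF assms(2), of 0 0] by auto
    qed (auto simp: dual_add[OF assms(1)] dual_add[OF assms(2)] dual_scaleR[OF assms(1)]
        dual_scaleR[OF assms(2)] subspace_add[OF subspace_Omega] subspace_scale[OF subspace_Omega])
    have "Omega \<subseteq> {\<omega> \<in> Omega. \<phi> \<omega> = \<psi> \<omega>}"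
      unfolding Omega_def
      by (rule span_minimal[OF _ sub[unfolded Omega_def]]) (use assms(3) span_base in auto)
    with True show ?thesis by auto
  qed (simp add: dual_outside[OF assms(1)] dual_outside[OF assms(2)])
qed

lemma cycle_integral_in_dual: "cycle_integral a \<in> dual"
  using subspace_add[OF subspace_Omega] subspace_scale[OF subspace_Omega]
  by (auto simp: dual_def cycle_integral_def algebra_simps sum.distrib sum_distrib_left)

lemma additive_cycle_integral: "additive cycle_integral"
  by standard (auto simp: cycle_integral_def fun_eq_iff algebra_simps sum.distrib)

lemma periods_subset_dual: "periods \<subseteq> dual"
  by (auto simp: periods_def cycle_integral_in_dual)

lemma add_subgroup_periods: "add_subgroup periods"
  unfolding periods_def by (rule add_subgroup_image[OF additive_cycle_integral add_subgroup_H1Z])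

lemma path_integral_in_dual: "path_integral \<gamma> \<in> dual"
proof -
  have "(\<Sum>(e, s, t)\<leftarrow>\<gamma>. (t - s) * (\<omega> e + \<eta> e))
      = (\<Sum>(e, s, t)\<leftarrow>\<gamma>. (t - s) * \<omega> e) + (\<Sum>(e, s, t)\<leftarrow>\<gamma>. (t - s) * \<eta> e)" for \<omega> \<eta> :: "'b form"
    by (induction \<gamma>) (auto simp: algebra_simps)
  moreover have "(\<Sum>(e, s, t)\<leftarrow>\<gamma>. (t - s) * (c * \<omega> e)) = c * (\<Sum>(e, s, t)\<leftarrow>\<gamma>. (t - s) * \<omega> e)"
    for c and \<omega> :: "'b form"
    by (induction \<gamma>) (auto simp: algebra_simps)
  ultimately show ?thesis
    using subspace_add[OF subspace_Omega] subspace_scale[OF subspace_Omega]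
    by (auto simp: dual_def path_integral_def)
qed

lemma simplex_translate:
  assumes "h \<in> periods"
  shows "simplex (map (\<lambda>x. x + h) xs) = simplex xs"
proof
  show "simplex (map (\<lambda>x. x + h) xs) \<subseteq> simplex xs"
    using add_subgroup_add[OF add_subgroup_periods assms] by (auto simp: simplex_def comp_def add.assoc)
  show "simplex xs \<subseteq> simplex (map (\<lambda>x. x + h) xs)"
  proof
    fix ys assume "ys \<in> simplex xs"
    then obtain k where k: "k \<in> periods" "ys = map (\<lambda>x. x + k) xs"
      by (auto simp: simplex_def)
    then have "ys = map (\<lambda>x. x + (k - h)) (map (\<lambda>x. x + h) xs)"
      by simp
    then show "ys \<in> simplex (map (\<lambda>x. x + h) xs)"
      unfolding simplex_def using add_subgroup_diff[OF add_subgroup_periods k(1) assms] by blast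
  qed
qed

lemma rep_simplex:
  obtains h where "h \<in> periods" "rep (simplex xs) = map (\<lambda>x. x + h) xs"
proof -
  have "xs \<in> simplex xs"
    using add_subgroup_zero[OF add_subgroup_periods] by (force simp: simplex_def)
  then have "rep (simplex xs) \<in> simplex xs"
    unfolding rep_def by (rule someI)
  then show ?thesis
    using that by (auto simp: simplex_def)
qed

lemma translate_in_dual: "h \<in> periods \<Longrightarrow> set xs \<subseteq> dual \<Longrightarrow> set (map (\<lambda>x. x + h) xs) \<subseteq> dual"
  using subspace_add[OF subspace_dual] periods_subset_dual by auto

lemma cells_rep:
  assumes "P \<in> cells q"
  shows "length (rep P) = Suc q" "set (rep P) \<subseteq> dual" "simplex (rep P) = P"
proof -
  obtain xs where xs: "P = simplex xs" "length xs = Suc q" "set xs \<subseteq> dual"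
    using assms by (auto simp: cells_def)
  obtain h where "h \<in> periods" "rep P = map (\<lambda>x. x + h) xs"
    using rep_simplex[of xs] xs(1) by metis
  with xs show "length (rep P) = Suc q" "set (rep P) \<subseteq> dual" "simplex (rep P) = P"
    using translate_in_dual simplex_translate by simp_all
qed

lemma simplex_in_cells: "length xs = Suc q \<Longrightarrow> set xs \<subseteq> dual \<Longrightarrow> simplex xs \<in> cells q"
  by (auto simp: cells_def)


section \<open>Chains and operators that pass to facets\<close>

text \<open>Coefficients in an arbitrary set \<open>A\<close> cover the real chains, the integral chains and, in the
  homology computations below, both at once.\<close>

definition coeff_chains :: "'b multivector set \<Rightarrow> nat \<Rightarrow> 'b chain set" where
  "coeff_chains A q =
     {c. Poly_Mapping.keys c \<subseteq> cells q \<and> (\<forall>P. Poly_Mapping.lookup c P \<in> A)}"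

lemma chains_eq: "chains p q = coeff_chains (Ext p) q"
  by (simp add: chains_def coeff_chains_def)

lemma chainsZ_eq: "chainsZ p q = coeff_chains (ExtZ p) q"
  by (simp add: chainsZ_def coeff_chains_def)

lemma subspace_Ext: "subspace (Ext p)"
  by (simp add: Ext_def subspace_span)

lemma add_subgroup_Ext: "add_subgroup (Ext p)"
  by (rule add_subgroup_subspace[OF subspace_Ext])

lemma add_subgroup_ExtZ: "add_subgroup (ExtZ p)"
  by (simp add: ExtZ_def add_subgroup_group_closure)

lemma dualZ_subset_dual: "dualZ \<subseteq> dual"
  by (auto simp: dualZ_def)

lemma wedges_in_Ext: "length vs = p \<Longrightarrow> set vs \<subseteq> dual \<Longrightarrow> wedges vs \<in> Ext p"
  unfolding Ext_def by (rule span_base) auto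

lemma wedges_in_ExtZ: "length vs = p \<Longrightarrow> set vs \<subseteq> dualZ \<Longrightarrow> wedges vs \<in> ExtZ p"
  unfolding ExtZ_def by (rule group_closure.base) auto

lemma ExtZ_subset_Ext: "ExtZ p \<subseteq> Ext p"
  unfolding ExtZ_def
  by (rule add_subgroup_subset_group_closure[OF add_subgroup_Ext])
    (use wedges_in_Ext dualZ_subset_dual in blast)

lemma chainsZ_subset_chains: "chainsZ p q \<subseteq> chains p q"
  using ExtZ_subset_Ext by (auto simp: chains_def chainsZ_def)

lemma wedge_in_Ext:
  assumes "v \<in> dual" "\<eta> \<in> Ext p"
  shows "wedge v \<eta> \<in> Ext (Suc p)"
proof -
  have "Ext p \<subseteq> wedge v -` Ext (Suc p)"
    unfolding Ext_def[of p]
  proof (rule span_minimal)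
    show "subspace (wedge v -` Ext (Suc p))"
      by (rule linear_subspace_vimage[OF linear_wedge subspace_Ext])
    show "{wedges vs | vs. length vs = p \<and> set vs \<subseteq> dual} \<subseteq> wedge v -` Ext (Suc p)"
      using assms(1) by (auto simp: wedges_Cons[symmetric] subset_iff intro!: wedges_in_Ext)
  qed
  with assms(2) show ?thesis by auto
qed

lemma add_subgroup_coeff_chains:
  assumes "add_subgroup A"
  shows "add_subgroup (coeff_chains A q)"
proof -
  have "Poly_Mapping.keys (c - d) \<subseteq> cells q"
    if "Poly_Mapping.keys c \<subseteq> cells q" "Poly_Mapping.keys d \<subseteq> cells q" for c d :: "'b chain"
    using that by (intro order_trans[OF keys_diff Un_least])
  then show ?thesis
    using add_subgroup_zero[OF assms] add_subgroup_diff[OF assms]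
    by (simp add: add_subgroup_def coeff_chains_def lookup_minus)
qed

lemma single_in_coeff_chains:
  "add_subgroup A \<Longrightarrow> length xs = Suc q \<Longrightarrow> set xs \<subseteq> dual \<Longrightarrow> \<eta> \<in> A \<Longrightarrow>
     Poly_Mapping.single (simplex xs) \<eta> \<in> coeff_chains A q"
  by (auto simp: coeff_chains_def lookup_single when_def simplex_in_cells
      intro: add_subgroup_zero split: if_splits)

text \<open>An identity or a membership that is additive in the chain is checked on a single simplex.\<close>

lemma coeff_chains_eqI:
  assumes "additive f" "additive f'" "c \<in> coeff_chains A q"
    and "\<And>xs \<eta>. length xs = Suc q \<Longrightarrow> set xs \<subseteq> dual \<Longrightarrow> \<eta> \<in> A \<Longrightarrow>
      f (Poly_Mapping.single (simplex xs) \<eta>) = f' (Poly_Mapping.single (simplex xs) \<eta>)"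
  shows "f c = f' c"
proof (rule additive_eq_on_singles[OF assms(1,2)])
  fix P assume "P \<in> Poly_Mapping.keys c"
  then have P: "P \<in> cells q" "Poly_Mapping.lookup c P \<in> A"
    using assms(3) by (auto simp: coeff_chains_def)
  show "f (Poly_Mapping.single P (Poly_Mapping.lookup c P))
      = f' (Poly_Mapping.single P (Poly_Mapping.lookup c P))"
    using assms(4)[OF cells_rep(1,2)[OF P(1)] P(2)] unfolding cells_rep(3)[OF P(1)] .
qed

lemma coeff_chains_memI:
  assumes "additive f" "add_subgroup B" "c \<in> coeff_chains A q"
    and "\<And>xs \<eta>. length xs = Suc q \<Longrightarrow> set xs \<subseteq> dual \<Longrightarrow> \<eta> \<in> A \<Longrightarrow>
      f (Poly_Mapping.single (simplex xs) \<eta>) \<in> B"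
  shows "f c \<in> B"
proof (rule additive_mem_on_singles[OF assms(1,2)])
  fix P assume "P \<in> Poly_Mapping.keys c"
  then have P: "P \<in> cells q" "Poly_Mapping.lookup c P \<in> A"
    using assms(3) by (auto simp: coeff_chains_def)
  show "f (Poly_Mapping.single P (Poly_Mapping.lookup c P)) \<in> B"
    using assms(4)[OF cells_rep(1,2)[OF P(1)] P(2)] unfolding cells_rep(3)[OF P(1)] .
qed

text \<open>The boundary and the monodromy operator have the same shape: a simplex is sent to the
  alternating sum of its facets, and the coefficient of the facet \<open>ys\<close> of \<open>xs\<close> is transformed by a
  linear map \<open>\<phi> xs ys\<close>.\<close>

definition facet_sum ::
    "('b covector list \<Rightarrow> 'b covector list \<Rightarrow> 'b multivector \<Rightarrow> 'b multivector) \<Rightarrow>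
      'b covector list \<Rightarrow> 'b multivector \<Rightarrow> 'b chain" where
  "facet_sum \<phi> xs \<eta> = (if length xs \<le> 1 then 0 else
     (\<Sum>i<length xs. Poly_Mapping.single (simplex (drop_at i xs))
       ((-1) ^ i *\<^sub>R \<phi> xs (drop_at i xs) \<eta>)))"

definition facet_op ::
    "('b covector list \<Rightarrow> 'b covector list \<Rightarrow> 'b multivector \<Rightarrow> 'b multivector) \<Rightarrow>
      'b chain \<Rightarrow> 'b chain" where
  "facet_op \<phi> = linear_ext (\<lambda>P. facet_sum \<phi> (rep P))"

text \<open>Invariance under periods makes the operator independent of the lifts picked by \<^const>\<open>rep\<close>. It is
  demanded only for the vertex lists on which \<^const>\<open>cell_points\<close> says anything.\<close>

definition equivariant ::
    "('b covector list \<Rightarrow> 'b covector list \<Rightarrow> 'b multivector \<Rightarrow> 'b multivector) \<Rightarrow> bool" where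
  "equivariant \<phi> \<longleftrightarrow> (\<forall>xs ys. linear (\<phi> xs ys)) \<and>
     (\<forall>xs ys. \<forall>h\<in>periods. xs \<noteq> [] \<longrightarrow> ys \<noteq> [] \<longrightarrow> set xs \<subseteq> dual \<longrightarrow> set ys \<subseteq> dual \<longrightarrow>
       \<phi> (map (\<lambda>x. x + h) xs) (map (\<lambda>x. x + h) ys) = \<phi> xs ys)"

lemma bdry_eq_facet_op: "bdry = facet_op (\<lambda>_ _ \<eta>. \<eta>)"
  by (rule ext) (simp add: bdry_def facet_op_def linear_ext_def facet_sum_def Let_def)

lemma monodromy_eq_facet_op: "monodromy pt = facet_op (\<lambda>xs ys. wedge (pt xs - pt ys))"
  by (rule ext) (simp add: monodromy_def facet_op_def linear_ext_def facet_sum_def Let_def)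

lemma equivariant_id: "equivariant (\<lambda>_ _ \<eta>. \<eta>)"
  by (simp add: equivariant_def linear_iff)

lemma equivariant_monodromy: "cell_points pt \<Longrightarrow> equivariant (\<lambda>xs ys. wedge (pt xs - pt ys))"
  by (simp add: equivariant_def cell_points_def linear_wedge)

lemma additive_facet_sum: "equivariant \<phi> \<Longrightarrow> additive (facet_sum \<phi> xs)"
  by standard
    (simp add: facet_sum_def equivariant_def linear_add scaleR_add_right single_add sum.distrib)

lemma additive_facet_op: "equivariant \<phi> \<Longrightarrow> additive (facet_op \<phi>)"
  unfolding facet_op_def by (intro additive_linear_ext additive_facet_sum)

lemma facet_sum_translate:
  assumes "equivariant \<phi>" "h \<in> periods" "set xs \<subseteq> dual"
  shows "facet_sum \<phi> (map (\<lambda>x. x + h) xs) = facet_sum \<phi> xs"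
proof (rule ext)
  fix \<eta>
  show "facet_sum \<phi> (map (\<lambda>x. x + h) xs) \<eta> = facet_sum \<phi> xs \<eta>"
  proof (cases "length xs \<le> 1")
    case False
    have "Poly_Mapping.single (simplex (drop_at i (map (\<lambda>x. x + h) xs)))
           ((-1) ^ i *\<^sub>R \<phi> (map (\<lambda>x. x + h) xs) (drop_at i (map (\<lambda>x. x + h) xs)) \<eta>)
        = Poly_Mapping.single (simplex (drop_at i xs)) ((-1) ^ i *\<^sub>R \<phi> xs (drop_at i xs) \<eta>)"
      if "i < length xs" for i
    proof -
      have "xs \<noteq> []" "drop_at i xs \<noteq> []"
        using False length_drop_at[OF that] by auto
      moreover have "set (drop_at i xs) \<subseteq> dual"
        by (rule order_trans[OF set_drop_at assms(3)])
      ultimately have "\<phi> (map (\<lambda>x. x + h) xs) (map (\<lambda>x. x + h) (drop_at i xs)) = \<phi> xs (drop_at i xs)"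
        using assms by (simp add: equivariant_def)
      then show ?thesis
        by (simp only: map_drop_at[symmetric] simplex_translate[OF assms(2)])
    qed
    then show ?thesis
      using False by (simp add: facet_sum_def)
  qed (simp add: facet_sum_def)
qed

lemma facet_op_single:
  assumes "equivariant \<phi>" "set xs \<subseteq> dual"
  shows "facet_op \<phi> (Poly_Mapping.single (simplex xs) \<eta>) = facet_sum \<phi> xs \<eta>"
proof -
  obtain h where h: "h \<in> periods" "rep (simplex xs) = map (\<lambda>x. x + h) xs"
    by (rule rep_simplex)
  show ?thesis
    unfolding facet_op_def
      linear_ext_single[where g = "\<lambda>P. facet_sum \<phi> (rep P)", OF additive_facet_sum[OF assms(1)]] h(2)
      facet_sum_translate[OF assms(1) h(1) assms(2)] ..
qed

lemma facet_op_facet_op_single: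
  assumes "equivariant \<phi>" "equivariant \<psi>" "set xs \<subseteq> dual"
  shows "facet_op \<phi> (facet_op \<psi> (Poly_Mapping.single (simplex xs) \<eta>)) =
    (if length xs \<le> 2 then 0 else
      (\<Sum>i<length xs. \<Sum>j<length xs - 1. Poly_Mapping.single (simplex (drop_at j (drop_at i xs)))
        ((-1) ^ (i + j) *\<^sub>R \<phi> (drop_at i xs) (drop_at j (drop_at i xs)) (\<psi> xs (drop_at i xs) \<eta>))))"
proof (cases "length xs \<le> 1")
  case False
  have "set (drop_at i xs) \<subseteq> dual" for i
    by (rule order_trans[OF set_drop_at assms(3)])
  then have "facet_op \<phi> (facet_op \<psi> (Poly_Mapping.single (simplex xs) \<eta>)) =
      (\<Sum>i<length xs. facet_sum \<phi> (drop_at i xs) ((-1) ^ i *\<^sub>R \<psi> xs (drop_at i xs) \<eta>))"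
    using False unfolding facet_op_single[OF assms(2,3)] facet_sum_def[of \<psi>]
    by (simp add: additive.sum[OF additive_facet_op[OF assms(1)]] facet_op_single[OF assms(1)])
  also have "\<dots> = (if length xs \<le> 2 then 0 else
      (\<Sum>i<length xs. \<Sum>j<length xs - 1. Poly_Mapping.single (simplex (drop_at j (drop_at i xs)))
        ((-1) ^ (i + j) *\<^sub>R \<phi> (drop_at i xs) (drop_at j (drop_at i xs)) (\<psi> xs (drop_at i xs) \<eta>))))"
  proof -
    have lin: "linear (\<phi> ys zs)" for ys zs
      using assms(1) by (simp add: equivariant_def)
    show ?thesis
      using False
      by (auto simp: facet_sum_def linear_scale[OF lin] power_add mult.commute intro!: sum.cong sum.neutral)
  qed
  finally show ?thesis .
qed (auto simp: facet_op_single[OF assms(2,3)] facet_sum_def additive.zero[OF additive_facet_op[OF assms(1)]])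

lemma facet_op_in_coeff_chains:
  assumes \<phi>: "equivariant \<phi>" and B: "add_subgroup B" and c: "c \<in> coeff_chains A (Suc q)"
    and AB: "\<And>xs ys \<eta>. xs \<noteq> [] \<Longrightarrow> ys \<noteq> [] \<Longrightarrow> set xs \<subseteq> dual \<Longrightarrow> set ys \<subseteq> dual \<Longrightarrow> \<eta> \<in> A \<Longrightarrow> \<phi> xs ys \<eta> \<in> B"
  shows "facet_op \<phi> c \<in> coeff_chains B q"
proof (rule coeff_chains_memI[OF additive_facet_op[OF \<phi>] add_subgroup_coeff_chains[OF B] c])
  fix xs \<eta> assume xs: "length xs = Suc (Suc q)" "set xs \<subseteq> dual" and \<eta>: "\<eta> \<in> A"
  have "(-1) ^ i *\<^sub>R \<phi> xs (drop_at i xs) \<eta> \<in> B" "length (drop_at i xs) = Suc q" "set (drop_at i xs) \<subseteq> dual"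
    if "i < length xs" for i
  proof -
    show len: "length (drop_at i xs) = Suc q" and sub: "set (drop_at i xs) \<subseteq> dual"
      using that xs set_drop_at[of i xs] by auto
    have "drop_at i xs \<noteq> []" using len by auto
    then have "\<phi> xs (drop_at i xs) \<eta> \<in> B"
      using xs \<eta> sub by (intro AB) auto
    then show "(-1) ^ i *\<^sub>R \<phi> xs (drop_at i xs) \<eta> \<in> B"
      using add_subgroup_of_int[OF B, of _ "(-1) ^ i"] by simp
  qed
  then have "facet_sum \<phi> xs \<eta> \<in> coeff_chains B q"
    unfolding facet_sum_def using xs(1)
    by (auto simp del: sum.lessThan_Suc intro!: add_subgroup_sum[OF add_subgroup_coeff_chains[OF B]] single_in_coeff_chains[OF B]
        add_subgroup_zero[OF add_subgroup_coeff_chains[OF B]])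
  then show "facet_op \<phi> (Poly_Mapping.single (simplex xs) \<eta>) \<in> coeff_chains B q"
    by (simp add: facet_op_single[OF \<phi> xs(2)])
qed

lemma additive_bdry: "additive bdry"
  unfolding bdry_eq_facet_op by (rule additive_facet_op[OF equivariant_id])

lemma additive_monodromy: "cell_points pt \<Longrightarrow> additive (monodromy pt)"
  unfolding monodromy_eq_facet_op by (intro additive_facet_op equivariant_monodromy)

lemma bdry_in_coeff_chains: "add_subgroup A \<Longrightarrow> c \<in> coeff_chains A (Suc q) \<Longrightarrow> bdry c \<in> coeff_chains A q"
  unfolding bdry_eq_facet_op by (rule facet_op_in_coeff_chains[OF equivariant_id])

lemma pt_in_dual: "cell_points pt \<Longrightarrow> xs \<noteq> [] \<Longrightarrow> set xs \<subseteq> dual \<Longrightarrow> pt xs \<in> dual"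
  using hull_minimal[of "set xs" dual convex] subspace_imp_convex[OF subspace_dual]
  by (auto simp: cell_points_def)

lemma monodromy_in_chains:
  assumes "cell_points pt" "c \<in> chains p (Suc q)"
  shows "monodromy pt c \<in> chains (Suc p) q"
  unfolding monodromy_eq_facet_op chains_eq
  by (rule facet_op_in_coeff_chains[OF equivariant_monodromy[OF assms(1)] add_subgroup_Ext
        assms(2)[unfolded chains_eq]])
    (intro wedge_in_Ext subspace_diff[OF subspace_dual] pt_in_dual[OF assms(1)])

lemma bdry_bdry:
  assumes "c \<in> coeff_chains A q"
  shows "bdry (bdry c) = 0"
proof (rule coeff_chains_eqI[where f = "\<lambda>c. bdry (bdry c)" and f' = "\<lambda>_. 0", OF _ _ assms])
  show "additive (\<lambda>c. bdry (bdry c))"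
    by standard (simp add: additive.add[OF additive_bdry])
  show "additive (\<lambda>_ :: 'b chain. 0 :: 'b chain)"
    by standard simp
next
  fix xs and \<eta> :: "'b multivector" assume xs: "set xs \<subseteq> (dual :: 'b covector set)"
  have "(\<Sum>i<length xs. \<Sum>j<length xs - 1.
      Poly_Mapping.single (simplex (drop_at j (drop_at i xs))) ((-1) ^ (i + j) *\<^sub>R \<eta>)) = 0"
    by (rule alternating_double_sum[where S = "\<lambda>k ys. Poly_Mapping.single (simplex ys) ((-1) ^ k *\<^sub>R \<eta>)"])
      (simp add: single_uminus)
  then show "bdry (bdry (Poly_Mapping.single (simplex xs) \<eta>)) = 0"
    unfolding bdry_eq_facet_op facet_op_facet_op_single[OF equivariant_id equivariant_id xs] by simp
qed

text \<open>Summing the two composites, the points chosen on the facets cancel, and the remaining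
  coefficients depend only on the faces of codimension two.\<close>

lemma bdry_monodromy:
  assumes pt: "cell_points pt" and c: "c \<in> coeff_chains A q"
  shows "bdry (monodromy pt c) = - monodromy pt (bdry c)"
proof (rule coeff_chains_eqI[where f = "\<lambda>c. bdry (monodromy pt c)"
      and f' = "\<lambda>c. - monodromy pt (bdry c)", OF _ _ c])
  note add = additive.add[OF additive_bdry] additive.add[OF additive_monodromy[OF pt]]
  show "additive (\<lambda>c. bdry (monodromy pt c))" "additive (\<lambda>c. - monodromy pt (bdry c))"
    by (standard; simp add: add)+
next
  fix xs \<eta> assume xs: "set xs \<subseteq> (dual :: 'b covector set)"
  note eqs = facet_op_facet_op_single[OF equivariant_id equivariant_monodromy[OF pt] xs]
    facet_op_facet_op_single[OF equivariant_monodromy[OF pt] equivariant_id xs]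
  have "(\<Sum>i<length xs. \<Sum>j<length xs - 1. Poly_Mapping.single (simplex (drop_at j (drop_at i xs)))
      ((-1) ^ (i + j) *\<^sub>R wedge (pt xs - pt (drop_at j (drop_at i xs))) \<eta>)) = 0"
    by (rule alternating_double_sum[where
          S = "\<lambda>k ys. Poly_Mapping.single (simplex ys) ((-1) ^ k *\<^sub>R wedge (pt xs - pt ys) \<eta>)"])
      (simp add: single_uminus)
  moreover have "wedge (pt xs - pt (drop_at j (drop_at i xs))) \<eta> =
      wedge (pt xs - pt (drop_at i xs)) \<eta> + wedge (pt (drop_at i xs) - pt (drop_at j (drop_at i xs))) \<eta>"
    for i j
    by (simp add: wedge_add_left[symmetric])
  ultimately show "bdry (monodromy pt (Poly_Mapping.single (simplex xs) \<eta>))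
      = - monodromy pt (bdry (Poly_Mapping.single (simplex xs) \<eta>))"
    unfolding bdry_eq_facet_op monodromy_eq_facet_op eqs
    by (simp add: scaleR_add_right single_add sum.distrib eq_neg_iff_add_eq_0)
qed

end


section \<open>Intermediate Jacobians as quotient groups\<close>

definition additive_group :: "'m::ab_group_add set \<Rightarrow> 'm monoid" where
  "additive_group Z = \<lparr>carrier = Z, monoid.mult = (+), one = 0\<rparr>"

lemma carrier_additive_group [simp]: "carrier (additive_group Z) = Z"
  and mult_additive_group [simp]: "x \<otimes>\<^bsub>additive_group Z\<^esub> y = x + y"
  and one_additive_group [simp]: "\<one>\<^bsub>additive_group Z\<^esub> = 0"
  by (simp_all add: additive_group_def)

lemma comm_group_additive_group:
  assumes "add_subgroup Z"
  shows "comm_group (additive_group Z)"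
proof (rule comm_groupI)
  fix x assume "x \<in> carrier (additive_group Z)"
  then show "\<exists>y\<in>carrier (additive_group Z). y \<otimes>\<^bsub>additive_group Z\<^esub> x = \<one>\<^bsub>additive_group Z\<^esub>"
    using add_subgroup_uminus[OF assms, of x] by (intro bexI[of _ "- x"]) auto
qed (auto simp: add_subgroup_zero[OF assms] add_subgroup_add[OF assms] add.assoc add.commute)

lemma inv_additive_group:
  assumes "add_subgroup Z" "x \<in> Z"
  shows "inv\<^bsub>additive_group Z\<^esub> x = - x"
  using comm_group.axioms(2)[OF comm_group_additive_group[OF assms(1)]] assms(2)
    add_subgroup_uminus[OF assms]
  by (intro group.inv_equality) auto

lemma subgroup_additive_group:
  assumes "add_subgroup Z" "add_subgroup B" "B \<subseteq> Z"
  shows "subgroup B (additive_group Z)"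
proof (rule group.subgroupI)
  show "Group.group (additive_group Z)"
    using comm_group_additive_group[OF assms(1)] by (rule comm_group.axioms(2))
  show "B \<noteq> {}" using add_subgroup_zero[OF assms(2)] by auto
  fix x assume x: "x \<in> B"
  then have "x \<in> Z" using assms(3) by auto
  then show "inv\<^bsub>additive_group Z\<^esub> x \<in> B"
    using add_subgroup_uminus[OF assms(2) x] by (simp add: inv_additive_group[OF assms(1)])
qed (use assms(3) add_subgroup_add[OF assms(2)] in auto)

context tropical_curve
begin

lemma cycle_group_eq: "cycle_group p q = additive_group (cycles p q)"
  by (simp add: cycle_group_def additive_group_def)

lemma add_subgroup_kernel:
  assumes "additive f" "add_subgroup A"
  shows "add_subgroup {c \<in> A. f c = 0}"
  using assms(2) by (auto simp: add_subgroup_def additive.zero[OF assms(1)] additive.diff[OF assms(1)])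

lemma add_subgroup_cycles: "add_subgroup (cycles p q)"
  unfolding cycles_def chains_eq
  by (intro add_subgroup_kernel additive_bdry add_subgroup_coeff_chains add_subgroup_Ext)

lemma add_subgroup_cyclesZ: "add_subgroup (cyclesZ p q)"
  unfolding cyclesZ_def chainsZ_eq
  by (intro add_subgroup_kernel additive_bdry add_subgroup_coeff_chains add_subgroup_ExtZ)

lemma add_subgroup_boundaries: "add_subgroup (boundaries p q)"
  unfolding boundaries_def chains_eq
  by (intro add_subgroup_image additive_bdry add_subgroup_coeff_chains add_subgroup_Ext)

lemma boundaries_subset_cycles: "boundaries p q \<subseteq> cycles p q"
  unfolding boundaries_def cycles_def chains_eq
  by (auto simp: bdry_bdry intro: bdry_in_coeff_chains add_subgroup_Ext)

lemma comm_group_cycle_group: "comm_group (cycle_group p q)"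
  unfolding cycle_group_eq by (intro comm_group_additive_group add_subgroup_cycles)

lemma subgroup_boundaries: "subgroup (boundaries p q) (cycle_group p q)"
  unfolding cycle_group_eq
  by (intro subgroup_additive_group add_subgroup_cycles add_subgroup_boundaries boundaries_subset_cycles)

lemma normal_boundaries: "boundaries p q \<lhd> cycle_group p q"
  by (intro comm_group.subgroup_imp_normal comm_group_cycle_group subgroup_boundaries)

lemma comm_group_HR: "comm_group (HR p q)"
  unfolding HR_def by (intro comm_group.abelian_FactGroup comm_group_cycle_group subgroup_boundaries)

lemma HR_class_hom: "HR_class p q \<in> hom (cycle_group p q) (HR p q)"
  using normal.r_coset_hom_Mod[OF normal_boundaries] by (simp add: HR_class_def[abs_def] HR_def)

lemma HR_class_eq_iff:
  assumes "c \<in> cycles p q" "c' \<in> cycles p q"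
  shows "HR_class p q c = HR_class p q c' \<longleftrightarrow> c - c' \<in> boundaries p q"
proof -
  interpret comm_group "cycle_group p q" by (rule comm_group_cycle_group)
  have coset: "x \<in> boundaries p q #>\<^bsub>cycle_group p q\<^esub> y \<longleftrightarrow> x - y \<in> boundaries p q" for x y
    by (auto simp: r_coset_def cycle_group_eq intro: bexI[of _ "x - y"])
  show ?thesis
  proof
    assume "HR_class p q c = HR_class p q c'"
    then have "c \<in> boundaries p q #>\<^bsub>cycle_group p q\<^esub> c'"
      using rcos_self[OF _ subgroup_boundaries, of c] assms by (simp add: HR_class_def cycle_group_eq)
    then show "c - c' \<in> boundaries p q" by (simp add: coset)
  next
    assume "c - c' \<in> boundaries p q"
    then have "c \<in> boundaries p q #>\<^bsub>cycle_group p q\<^esub> c'" by (simp add: coset)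
    from repr_independence[OF this _ subgroup_boundaries] assms
    show "HR_class p q c = HR_class p q c'" by (simp add: HR_class_def cycle_group_eq)
  qed
qed

lemma monodromy_in_cycles:
  assumes "cell_points pt" "\<zeta> \<in> chains p (Suc q)" "monodromy pt (bdry \<zeta>) = 0"
  shows "monodromy pt \<zeta> \<in> cycles (Suc p) q"
  using monodromy_in_chains[OF assms(1,2)] bdry_monodromy[OF assms(1), of \<zeta> "Ext p" "Suc q"] assms(2,3)
  by (simp add: cycles_def chains_eq)

lemma monodromy_cyclesZ:
  assumes "cell_points pt" "\<zeta> \<in> cyclesZ p (Suc q)"
  shows "monodromy pt \<zeta> \<in> cycles (Suc p) q"
  using assms chainsZ_subset_chains
  by (intro monodromy_in_cycles) (auto simp: cyclesZ_def additive.zero[OF additive_monodromy[OF assms(1)]])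

lemma subgroup_Lat:
  assumes "cell_points pt"
  shows "subgroup (Lat pt p) (HR (Suc p) p)"
proof -
  interpret HR: comm_group "HR (Suc p) p" by (rule comm_group_HR)
  interpret Z: comm_group "additive_group (cyclesZ p (Suc p))"
    by (intro comm_group_additive_group add_subgroup_cyclesZ)
  have "(\<lambda>\<zeta>. HR_class (Suc p) p (monodromy pt \<zeta>)) \<in> hom (additive_group (cyclesZ p (Suc p))) (HR (Suc p) p)"
  proof (rule homI)
    fix \<zeta> \<zeta>' assume "\<zeta> \<in> carrier (additive_group (cyclesZ p (Suc p)))"
      "\<zeta>' \<in> carrier (additive_group (cyclesZ p (Suc p)))"
    then show "HR_class (Suc p) p (monodromy pt \<zeta>) \<in> carrier (HR (Suc p) p)"
      "HR_class (Suc p) p (monodromy pt (\<zeta> \<otimes>\<^bsub>additive_group (cyclesZ p (Suc p))\<^esub> \<zeta>')) =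
        HR_class (Suc p) p (monodromy pt \<zeta>) \<otimes>\<^bsub>HR (Suc p) p\<^esub> HR_class (Suc p) p (monodromy pt \<zeta>')"
      using monodromy_cyclesZ[OF assms] hom_in_carrier[OF HR_class_hom] hom_mult[OF HR_class_hom]
      by (auto simp: cycle_group_eq additive.add[OF additive_monodromy[OF assms]])
  qed
  then interpret group_hom "additive_group (cyclesZ p (Suc p))" "HR (Suc p) p"
    "\<lambda>\<zeta>. HR_class (Suc p) p (monodromy pt \<zeta>)"
    by unfold_locales
  have "Lat pt p = (\<lambda>\<zeta>. HR_class (Suc p) p (monodromy pt \<zeta>)) ` carrier (additive_group (cyclesZ p (Suc p)))"
    by (auto simp: Lat_def)
  then show ?thesis using img_is_subgroup by simp
qed

lemma normal_Lat: "cell_points pt \<Longrightarrow> Lat pt p \<lhd> HR (Suc p) p"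
  by (intro comm_group.subgroup_imp_normal comm_group_HR subgroup_Lat)

lemma comm_group_JH: "cell_points pt \<Longrightarrow> comm_group (JH pt p)"
  unfolding JH_def by (intro comm_group.abelian_FactGroup comm_group_HR subgroup_Lat)

lemma JH_class_hom:
  assumes "cell_points pt"
  shows "JH_class pt p \<in> hom (cycle_group (Suc p) p) (JH pt p)"
proof -
  have "(\<lambda>X. Lat pt p #>\<^bsub>HR (Suc p) p\<^esub> X) \<circ> HR_class (Suc p) p \<in> hom (cycle_group (Suc p) p) (JH pt p)"
    unfolding JH_def
    by (rule hom_compose[OF HR_class_hom normal.r_coset_hom_Mod[OF normal_Lat[OF assms]]])
  then show ?thesis by (simp add: JH_class_def[abs_def] comp_def)
qed

text \<open>Both quotients unfolded: two classes agree if and only if the cycles differ by a boundary and the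
  monodromy of an integral cycle.\<close>

lemma JH_class_eq_iff:
  assumes pt: "cell_points pt" and c: "c \<in> cycles (Suc p) p" "c' \<in> cycles (Suc p) p"
  shows "JH_class pt p c = JH_class pt p c' \<longleftrightarrow>
    (\<exists>\<zeta>\<in>cyclesZ p (Suc p). c - c' - monodromy pt \<zeta> \<in> boundaries (Suc p) p)"
proof -
  interpret HR: comm_group "HR (Suc p) p" by (rule comm_group_HR)
  have in_HR: "HR_class (Suc p) p x \<in> carrier (HR (Suc p) p)" if "x \<in> cycles (Suc p) p" for x
    using hom_in_carrier[OF HR_class_hom] that by (simp add: cycle_group_eq)
  have coset: "HR_class (Suc p) p c \<in> Lat pt p #>\<^bsub>HR (Suc p) p\<^esub> HR_class (Suc p) p c' \<longleftrightarrow>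
    (\<exists>\<zeta>\<in>cyclesZ p (Suc p). c - c' - monodromy pt \<zeta> \<in> boundaries (Suc p) p)"
  proof -
    have sum: "HR_class (Suc p) p (monodromy pt \<zeta>) \<otimes>\<^bsub>HR (Suc p) p\<^esub> HR_class (Suc p) p c' =
      HR_class (Suc p) p (monodromy pt \<zeta> + c')" if "\<zeta> \<in> cyclesZ p (Suc p)" for \<zeta>
      using hom_mult[OF HR_class_hom, of "monodromy pt \<zeta>" "Suc p" p c'] monodromy_cyclesZ[OF pt that] c
      by (simp add: cycle_group_eq)
    have eq: "HR_class (Suc p) p c = HR_class (Suc p) p (monodromy pt \<zeta> + c') \<longleftrightarrow>
      c - c' - monodromy pt \<zeta> \<in> boundaries (Suc p) p" if "\<zeta> \<in> cyclesZ p (Suc p)" for \<zeta>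
      using HR_class_eq_iff[OF c(1) add_subgroup_add[OF add_subgroup_cycles monodromy_cyclesZ[OF pt that] c(2)]]
      by (simp add: algebra_simps)
    have "HR_class (Suc p) p c \<in> Lat pt p #>\<^bsub>HR (Suc p) p\<^esub> HR_class (Suc p) p c' \<longleftrightarrow>
      (\<exists>\<zeta>\<in>cyclesZ p (Suc p). HR_class (Suc p) p c =
        HR_class (Suc p) p (monodromy pt \<zeta>) \<otimes>\<^bsub>HR (Suc p) p\<^esub> HR_class (Suc p) p c')"
      by (auto simp: r_coset_def Lat_def)
    also have "\<dots> \<longleftrightarrow> (\<exists>\<zeta>\<in>cyclesZ p (Suc p). c - c' - monodromy pt \<zeta> \<in> boundaries (Suc p) p)"
      by (intro bex_cong refl) (simp only: sum eq)
    finally show ?thesis .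
  qed
  show ?thesis
    unfolding coset[symmetric] JH_class_def
    using HR.repr_independence[OF _ in_HR[OF c(2)] subgroup_Lat[OF pt], of "HR_class (Suc p) p c"]
      HR.rcos_self[OF in_HR[OF c(1)] subgroup_Lat[OF pt]]
    by auto
qed


section \<open>Independence of the chosen points\<close>

text \<open>Moving the chosen point of a cell from its first vertex to \<open>pt\<close> changes the monodromy operator by a
  chain homotopy, which multiplies the coefficient by the displacement of the point.\<close>

definition point_shift ::
    "('b covector list \<Rightarrow> 'b covector) \<Rightarrow> 'b chain \<Rightarrow> 'b chain" where
  "point_shift pt = linear_ext (\<lambda>P \<eta>. Poly_Mapping.single P (wedge (pt (rep P) - hd (rep P)) \<eta>))"

lemma cell_points_hd: "cell_points hd"
  by (auto simp: cell_points_def hd_map intro: hull_inc)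

lemma additive_point_shift: "additive (point_shift pt)"
  unfolding point_shift_def
  by (intro additive_linear_ext, standard) (simp add: additive.add[OF additive_wedge] single_add)

lemma point_shift_single:
  assumes "cell_points pt" "xs \<noteq> []" "set xs \<subseteq> dual"
  shows "point_shift pt (Poly_Mapping.single (simplex xs) \<eta>)
    = Poly_Mapping.single (simplex xs) (wedge (pt xs - hd xs) \<eta>)"
proof -
  obtain h where h: "h \<in> periods" "rep (simplex xs) = map (\<lambda>x. x + h) xs"
    by (rule rep_simplex)
  have "additive (\<lambda>\<eta>. Poly_Mapping.single P (wedge v \<eta>))" for P :: "'b cell" and v
    by standard (simp add: additive.add[OF additive_wedge] single_add)
  then have "point_shift pt (Poly_Mapping.single (simplex xs) \<eta>)
      = Poly_Mapping.single (simplex xs) (wedge (pt (rep (simplex xs)) - hd (rep (simplex xs))) \<eta>)"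
    unfolding point_shift_def by (rule linear_ext_single)
  then show ?thesis
    using assms h by (simp add: cell_points_def hd_map)
qed

text \<open>On the facet \<open>Q\<close> of \<open>P\<close>, both sides multiply the coefficient by the displacement of the point of
  \<open>P\<close> minus that of the point of \<open>Q\<close>.\<close>

lemma monodromy_change_points:
  assumes pt: "cell_points pt" and c: "c \<in> coeff_chains A q"
  shows "monodromy pt c - monodromy hd c = bdry (point_shift pt c) - point_shift pt (bdry c)"
proof (rule coeff_chains_eqI[where f = "\<lambda>c. monodromy pt c - monodromy hd c"
      and f' = "\<lambda>c. bdry (point_shift pt c) - point_shift pt (bdry c)", OF _ _ c])
  note add = additive.add[OF additive_bdry] additive.add[OF additive_monodromy[OF pt]]
    additive.add[OF additive_monodromy[OF cell_points_hd]] additive.add[OF additive_point_shift]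
  show "additive (\<lambda>c. monodromy pt c - monodromy hd c)"
    "additive (\<lambda>c. bdry (point_shift pt c) - point_shift pt (bdry c))"
    by (standard; simp add: add)+
next
  fix xs and \<eta> :: "'b multivector" assume len: "length xs = Suc q" and xs: "set xs \<subseteq> (dual :: 'b covector set)"
  then have ne: "xs \<noteq> []" by auto
  show "monodromy pt (Poly_Mapping.single (simplex xs) \<eta>) - monodromy hd (Poly_Mapping.single (simplex xs) \<eta>)
     = bdry (point_shift pt (Poly_Mapping.single (simplex xs) \<eta>))
       - point_shift pt (bdry (Poly_Mapping.single (simplex xs) \<eta>))"
  proof (cases "length xs \<le> 1")
    case True
    then show ?thesis
      unfolding point_shift_single[OF pt ne xs] bdry_eq_facet_op monodromy_eq_facet_op
        facet_op_single[OF equivariant_id xs] facet_op_single[OF equivariant_monodromy[OF pt] xs]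
        facet_op_single[OF equivariant_monodromy[OF cell_points_hd] xs]
      by (simp add: facet_sum_def additive.zero[OF additive_point_shift])
  next
    case False
    have facet: "point_shift pt (Poly_Mapping.single (simplex (drop_at i xs)) \<theta>)
        = Poly_Mapping.single (simplex (drop_at i xs)) (wedge (pt (drop_at i xs) - hd (drop_at i xs)) \<theta>)"
      if "i < length xs" for i \<theta>
    proof (rule point_shift_single[OF pt])
      show "drop_at i xs \<noteq> []" using False length_drop_at[OF that] by auto
      show "set (drop_at i xs) \<subseteq> dual" by (rule order_trans[OF set_drop_at xs])
    qed
    show ?thesis
      unfolding point_shift_single[OF pt ne xs] bdry_eq_facet_op monodromy_eq_facet_op
        facet_op_single[OF equivariant_id xs] facet_op_single[OF equivariant_monodromy[OF pt] xs]
        facet_op_single[OF equivariant_monodromy[OF cell_points_hd] xs]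
      using False
      by (simp add: facet_sum_def additive.sum[OF additive_point_shift] facet linear_scale[OF linear_wedge]
          sum_subtractf[symmetric] single_diff[symmetric] scaleR_diff_right[symmetric]
          wedge_diff_left[symmetric] algebra_simps)
  qed
qed

lemma point_shift_in_chains:
  assumes pt: "cell_points pt" and c: "c \<in> chains p q"
  shows "point_shift pt c \<in> chains (Suc p) q"
  unfolding chains_eq
proof (rule coeff_chains_memI[OF additive_point_shift _ c[unfolded chains_eq]])
  fix xs \<eta> assume xs: "length xs = Suc q" "set xs \<subseteq> dual" "\<eta> \<in> Ext p"
  then have "xs \<noteq> []" by auto
  with xs show "point_shift pt (Poly_Mapping.single (simplex xs) \<eta>) \<in> coeff_chains (Ext (Suc p)) q"
    by (auto simp: point_shift_single[OF pt] intro!: single_in_coeff_chains add_subgroup_Ext wedge_in_Ext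
        subspace_diff[OF subspace_dual] pt_in_dual[OF pt])
qed (intro add_subgroup_coeff_chains add_subgroup_Ext)

lemma Lat_hd:
  assumes pt: "cell_points pt"
  shows "Lat pt p = Lat hd p"
proof -
  have "HR_class (Suc p) p (monodromy pt \<zeta>) = HR_class (Suc p) p (monodromy hd \<zeta>)"
    if \<zeta>: "\<zeta> \<in> cyclesZ p (Suc p)" for \<zeta>
  proof -
    have c: "\<zeta> \<in> chains p (Suc p)" "bdry \<zeta> = 0"
      using \<zeta> chainsZ_subset_chains by (auto simp: cyclesZ_def)
    have "monodromy pt \<zeta> - monodromy hd \<zeta> = bdry (point_shift pt \<zeta>)"
      using monodromy_change_points[OF pt c(1)[unfolded chains_eq]] c(2)
      by (simp add: additive.zero[OF additive_point_shift])
    then have "monodromy pt \<zeta> - monodromy hd \<zeta> \<in> boundaries (Suc p) p"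
      using point_shift_in_chains[OF pt c(1)] by (simp add: boundaries_def)
    then show ?thesis
      using HR_class_eq_iff[OF monodromy_cyclesZ[OF pt \<zeta>] monodromy_cyclesZ[OF cell_points_hd \<zeta>]] by simp
  qed
  then show ?thesis by (force simp: Lat_def)
qed

lemma JH_hd: "cell_points pt \<Longrightarrow> JH pt p = JH hd p"
  by (simp add: JH_def Lat_hd)

lemma JH_class_hd: "cell_points pt \<Longrightarrow> JH_class pt p c = JH_class hd p c"
  by (simp add: JH_class_def Lat_hd)

text \<open>For \<open>\<xi>'\<close> with the same boundary, the homotopy vanishes on that boundary, so passing from \<open>pt\<close> to
  first vertices changes the monodromy of \<open>\<xi>'\<close> by a boundary; and \<open>\<xi>' - \<xi>\<close> is an integral cycle, so
  replacing \<open>\<xi>'\<close> by \<open>\<xi>\<close> changes it by an element of the lattice.\<close>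

lemma AJ_eqI:
  assumes pt: "cell_points pt" and \<xi>: "\<xi> \<in> chainsZ p (Suc p)" "bdry \<xi> = fundamental_chain \<alpha>"
    and shift: "point_shift pt (fundamental_chain \<alpha>) = 0"
    and mono: "monodromy hd (fundamental_chain \<alpha>) = 0"
  shows "AJ pt p \<alpha> = JH_class hd p (monodromy hd \<xi>)"
proof -
  have *: "JH_class pt p (monodromy pt \<xi>') = JH_class hd p (monodromy hd \<xi>)"
    if \<xi>': "\<xi>' \<in> chainsZ p (Suc p)" "bdry \<xi>' = fundamental_chain \<alpha>" for \<xi>'
  proof -
    have c: "\<xi> \<in> chains p (Suc p)" "\<xi>' \<in> chains p (Suc p)"
      using \<xi>(1) \<xi>'(1) chainsZ_subset_chains by auto
    have F: "fundamental_chain \<alpha> \<in> coeff_chains (Ext p) p"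
      using bdry_in_coeff_chains[OF add_subgroup_Ext c(1)[unfolded chains_eq]] \<xi>(2) by simp
    have "bdry (fundamental_chain \<alpha>) = 0"
      using bdry_bdry[OF c(1)[unfolded chains_eq]] \<xi>(2) by simp
    with monodromy_change_points[OF pt F] shift mono have "monodromy pt (fundamental_chain \<alpha>) = 0"
      by (simp add: additive.zero[OF additive_bdry] additive.zero[OF additive_point_shift])
    then have cyc: "monodromy pt \<xi>' \<in> cycles (Suc p) p" "monodromy hd \<xi>' \<in> cycles (Suc p) p"
      "monodromy hd \<xi> \<in> cycles (Suc p) p"
      using monodromy_in_cycles pt cell_points_hd c \<xi>(2) \<xi>'(2) mono by simp_all
    have "monodromy pt \<xi>' - monodromy hd \<xi>' = bdry (point_shift pt \<xi>')"
      using monodromy_change_points[OF pt c(2)[unfolded chains_eq]] \<xi>'(2) shift by simp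
    then have "HR_class (Suc p) p (monodromy pt \<xi>') = HR_class (Suc p) p (monodromy hd \<xi>')"
      using point_shift_in_chains[OF pt c(2)] by (simp add: HR_class_eq_iff[OF cyc(1,2)] boundaries_def)
    then have "JH_class pt p (monodromy pt \<xi>') = JH_class hd p (monodromy hd \<xi>')"
      by (simp add: JH_class_def Lat_hd[OF pt])
    also have "\<dots> = JH_class hd p (monodromy hd \<xi>)"
    proof -
      have "\<xi>' - \<xi> \<in> cyclesZ p (Suc p)"
        using \<xi> \<xi>' add_subgroup_diff[OF add_subgroup_coeff_chains[OF add_subgroup_ExtZ]]
        by (simp add: cyclesZ_def chainsZ_eq additive.diff[OF additive_bdry])
      moreover have "monodromy hd \<xi>' - monodromy hd \<xi> - monodromy hd (\<xi>' - \<xi>) \<in> boundaries (Suc p) p"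
        by (simp add: additive.diff[OF additive_monodromy[OF cell_points_hd]]
            add_subgroup_zero[OF add_subgroup_boundaries])
      ultimately show ?thesis
        unfolding JH_class_eq_iff[OF cell_points_hd cyc(2,3)] by blast
    qed
    finally show ?thesis .
  qed
  show ?thesis
    unfolding AJ_def by (rule the_equality) (use * \<xi> in auto)
qed


section \<open>Flows, paths and the Abel--Jacobi map\<close>

definition edge_covector :: "'b \<Rightarrow> 'b covector" where
  "edge_covector e = path_integral [(e, 0, 1)]"

lemma edge_covector_apply: "edge_covector e \<omega> = (if \<omega> \<in> Omega then \<omega> e else 0)"
  by (simp add: edge_covector_def path_integral_def)

lemma edge_covector_in_dual: "edge_covector e \<in> dual"
  by (simp add: edge_covector_def path_integral_in_dual)

lemma path_integral_Nil: "path_integral [] = 0"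
  by (auto simp: path_integral_def fun_eq_iff)

lemma path_integral_Cons:
  "path_integral ((e, s, t) # \<gamma>) = (t - s) *\<^sub>R edge_covector e + path_integral \<gamma>"
  by (auto simp: path_integral_def edge_covector_apply fun_eq_iff)

lemma path_integral_single: "path_integral [(e, s, t)] = (t - s) *\<^sub>R edge_covector e"
  by (simp add: path_integral_Cons path_integral_Nil)

definition flow_boundary :: "('b \<Rightarrow> int) \<Rightarrow> 'a \<Rightarrow> int" where
  "flow_boundary n v = (\<Sum>e\<in>in_arcs G v. n e) - (\<Sum>e\<in>out_arcs G v. n e)"

definition edge_flow :: "'b \<Rightarrow> int \<Rightarrow> 'b \<Rightarrow> int" where
  "edge_flow e c = (\<lambda>e'. if e' = e then c else 0)"

lemma H1Z_iff: "n \<in> H1Z \<longleftrightarrow> (\<forall>e. e \<notin> arcs G \<longrightarrow> n e = 0) \<and> (\<forall>v\<in>verts G. flow_boundary n v = 0)"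
  by (simp add: H1Z_def flow_boundary_def)

lemma additive_flow_boundary: "additive (\<lambda>n. flow_boundary n v)"
  by standard (simp add: flow_boundary_def sum.distrib)

lemma flow_boundary_edge_flow:
  assumes "e \<in> arcs G"
  shows "flow_boundary (edge_flow e c) v = c * (of_bool (v = head G e) - of_bool (v = tail G e))"
  using assms
  by (auto simp: flow_boundary_def edge_flow_def sum.delta finite_in_arcs finite_out_arcs)

lemma cycle_integral_edge_flow:
  assumes "e \<in> arcs G"
  shows "cycle_integral (edge_flow e c) = (of_int c * len e) *\<^sub>R edge_covector e"
proof
  fix \<omega>
  have "(\<Sum>e'\<in>arcs G. of_int (edge_flow e c e') * (len e' * \<omega> e'))
      = (\<Sum>e'\<in>arcs G. if e' = e then of_int c * (len e * \<omega> e) else 0)"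
    by (intro sum.cong) (auto simp: edge_flow_def)
  then show "cycle_integral (edge_flow e c) \<omega> = ((of_int c * len e) *\<^sub>R edge_covector e) \<omega>"
    using assms by (auto simp: cycle_integral_def edge_covector_apply)
qed

text \<open>A point in the interior of an edge is referred to the source of that edge, from which it is
  displaced by \<open>root_offset\<close>.\<close>

fun root_vertex :: "('a, 'b) curve_point \<Rightarrow> 'a" where
  "root_vertex (Vertex v) = v"
| "root_vertex (Inner e t) = tail G e"

fun root_offset :: "('a, 'b) curve_point \<Rightarrow> 'b covector" where
  "root_offset (Vertex v) = 0"
| "root_offset (Inner e t) = t *\<^sub>R edge_covector e"

lemma root_edge_point:
  assumes "e \<in> arcs G"
  shows "root_vertex (edge_point e s) = (if s = len e then head G e else tail G e)"
    and "root_offset (edge_point e s) = (if s = len e then 0 else s *\<^sub>R edge_covector e)"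
  using len_pos[OF assms] by (auto simp: edge_point_def)

text \<open>A path that stops in the interior of an edge is completed by running back to the source of that
  edge; the completed path crosses every edge an integral number of times, which gives the flow \<open>n\<close>.\<close>

lemma path_integral_flow:
  assumes "is_path x \<gamma> y"
  obtains n where "\<And>e. n e \<noteq> 0 \<Longrightarrow> e \<in> arcs G \<and> e \<in> fst ` set \<gamma>"
    and "\<And>v. flow_boundary n v = of_bool (v = root_vertex y) - of_bool (v = root_vertex x)"
    and "path_integral \<gamma> = cycle_integral n + root_offset y - root_offset x"
proof -
  have "\<exists>n. (\<forall>e. n e \<noteq> 0 \<longrightarrow> e \<in> arcs G \<and> e \<in> fst ` set \<gamma>) \<and>
      (\<forall>v. flow_boundary n v = of_bool (v = root_vertex y) - of_bool (v = root_vertex x)) \<and>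
      path_integral \<gamma> = cycle_integral n + root_offset y - root_offset x"
    using assms
  proof (induction \<gamma> arbitrary: x)
    case Nil
    then show ?case
      by (intro exI[of _ "\<lambda>_. 0"])
        (auto simp: flow_boundary_def cycle_integral_def path_integral_Nil fun_eq_iff)
  next
    case (Cons step \<gamma>)
    obtain e s t where step: "step = (e, s, t)" by (cases step)
    have e: "e \<in> arcs G" and x: "x = edge_point e s" and path: "is_path (edge_point e t) \<gamma> y"
      using Cons.prems by (auto simp: step)
    obtain n where n: "\<And>e. n e \<noteq> 0 \<Longrightarrow> e \<in> arcs G \<and> e \<in> fst ` set \<gamma>"
      "\<And>v. flow_boundary n v = of_bool (v = root_vertex y) - of_bool (v = root_vertex (edge_point e t))"
      "path_integral \<gamma> = cycle_integral n + root_offset y - root_offset (edge_point e t)"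
      using Cons.IH[OF path] by blast
    (* after completion, the step crosses e only if exactly one of its ends is the head of e *)
    define m where "m = edge_flow e (of_bool (t = len e) - of_bool (s = len e))"
    have "(m + n) e' \<noteq> 0 \<Longrightarrow> e' \<in> arcs G \<and> e' \<in> fst ` set (step # \<gamma>)" for e'
      using n(1)[of e'] e by (auto simp: m_def edge_flow_def step split: if_splits)
    moreover have "flow_boundary (m + n) v = of_bool (v = root_vertex y) - of_bool (v = root_vertex x)" for v
      unfolding additive.add[OF additive_flow_boundary] n(2) m_def flow_boundary_edge_flow[OF e]
        x root_edge_point[OF e]
      by auto
    moreover have "path_integral (step # \<gamma>) = cycle_integral (m + n) + root_offset y - root_offset x"
      unfolding additive.add[OF additive_cycle_integral] m_def cycle_integral_edge_flow[OF e]
        x root_edge_point[OF e] step path_integral_Cons n(3)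
      by (auto simp: fun_eq_iff algebra_simps)
    ultimately show ?case by blast
  qed
  then show ?thesis using that by blast
qed

lemma is_path_append: "is_path x \<gamma> y \<Longrightarrow> is_path y \<delta> z \<Longrightarrow> is_path x (\<gamma> @ \<delta>) z"
  by (induction x \<gamma> y rule: is_path.induct) auto

text \<open>\<open>H\<close> is \<open>G\<close> itself or \<open>G\<close> without one edge. Recording the edges that the path uses makes the same
  induction serve connectedness and the absence of separating edges.\<close>

lemma vertex_path:
  assumes "arcs H \<subseteq> arcs G" "tail H = tail G" "head H = head G"
    and "u \<rightarrow>\<^sup>*\<^bsub>with_proj (mk_symmetric H)\<^esub> v" "v \<in> verts G"
  shows "\<exists>\<gamma>. is_path (Vertex u) \<gamma> (Vertex v) \<and> fst ` set \<gamma> \<subseteq> arcs H"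
proof -
  have "(u, v) \<in> (parcs (mk_symmetric H))\<^sup>*"
    using reachable_rtranclI[OF assms(4)] by simp
  then show ?thesis
  proof (induction rule: converse_rtrancl_induct)
    case base
    then show ?case using assms(5) by (intro exI[of _ "[]"]) (auto simp: points_def)
  next
    case (step a c)
    then obtain \<gamma> where \<gamma>: "is_path (Vertex c) \<gamma> (Vertex v)" "fst ` set \<gamma> \<subseteq> arcs H" by auto
    obtain e where e: "e \<in> arcs H" "(a, c) \<in> {(tail G e, head G e), (head G e, tail G e)}"
      using step.hyps(1) assms(2,3) by (auto simp: parcs_mk_symmetric)
    have eG: "e \<in> arcs G" using e(1) assms(1) by auto
    note pos = len_pos[OF eG]
    from e(2) show ?case
    proof (elim insertE emptyE)
      assume "(a, c) = (tail G e, head G e)"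
      then show ?case using \<gamma> e(1) eG pos
        by (intro exI[of _ "(e, 0, len e) # \<gamma>"]) (auto simp: edge_point_def)
    next
      assume "(a, c) = (head G e, tail G e)"
      then show ?case using \<gamma> e(1) eG pos
        by (intro exI[of _ "(e, len e, 0) # \<gamma>"]) (auto simp: edge_point_def)
    qed
  qed
qed

lemma path_exists:
  assumes "x \<in> points" "y \<in> points"
  shows "\<exists>\<gamma>. is_path x \<gamma> y"
proof -
  have root: "\<exists>\<gamma>. is_path z \<gamma> (Vertex (root_vertex z))" "\<exists>\<gamma>. is_path (Vertex (root_vertex z)) \<gamma> z"
    "root_vertex z \<in> verts G" if z: "z \<in> points" for z
  proof -
    have "(\<exists>\<gamma>. is_path z \<gamma> (Vertex (root_vertex z))) \<and> (\<exists>\<gamma>. is_path (Vertex (root_vertex z)) \<gamma> z)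
      \<and> root_vertex z \<in> verts G"
    proof (cases z)
      case (Vertex v)
      with z have "v \<in> verts G" "is_path z [] (Vertex v)" "is_path (Vertex v) [] z"
        by (auto simp: points_def)
      then show ?thesis using Vertex by (auto simp del: is_path.simps)
    next
      case (Inner e t)
      with z have e: "e \<in> arcs G" "0 < t" "t < len e" by (auto simp: points_def)
      then have "is_path z [(e, t, 0)] (Vertex (tail G e))" "is_path (Vertex (tail G e)) [(e, 0, t)] z"
        using Inner z by (auto simp: edge_point_def points_def)
      then show ?thesis using Inner e by (auto simp del: is_path.simps)
    qed
    then show "\<exists>\<gamma>. is_path z \<gamma> (Vertex (root_vertex z))" "\<exists>\<gamma>. is_path (Vertex (root_vertex z)) \<gamma> z"
      "root_vertex z \<in> verts G" by auto
  qed
  have "root_vertex x \<rightarrow>\<^sup>*\<^bsub>with_proj (mk_symmetric G)\<^esub> root_vertex y"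
    using connected_G root(3)[OF assms(1)] root(3)[OF assms(2)]
    by (auto simp: connected_def strongly_connected_def)
  from vertex_path[OF _ _ _ this root(3)[OF assms(2)]]
  obtain \<gamma> where "is_path (Vertex (root_vertex x)) \<gamma> (Vertex (root_vertex y))" by auto
  with root(1)[OF assms(1)] root(2)[OF assms(2)] show ?thesis
    by (meson is_path_append)
qed

lemma AJ_lift_flow:
  assumes "b \<in> points" "x \<in> points"
  obtains n where "\<And>e. e \<notin> arcs G \<Longrightarrow> n e = 0"
    and "\<And>v. flow_boundary n v = of_bool (v = root_vertex x) - of_bool (v = root_vertex b)"
    and "AJ_lift b x = cycle_integral n + root_offset x - root_offset b"
proof -
  have "is_path b (SOME \<gamma>. is_path b \<gamma> x) x"
    by (rule someI_ex[OF path_exists[OF assms]])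
  from path_integral_flow[OF this] show ?thesis
    using that unfolding AJ_lift_def by metis
qed

lemma AJ_lift_in_dual: "AJ_lift b x \<in> dual"
  by (simp add: AJ_lift_def path_integral_in_dual)

lemma AJ_lift_self:
  assumes "b \<in> points"
  shows "AJ_lift b b \<in> periods"
proof -
  obtain n where n: "\<And>e. e \<notin> arcs G \<Longrightarrow> n e = 0"
    "\<And>v. flow_boundary n v = of_bool (v = root_vertex b) - of_bool (v = root_vertex b)"
    "AJ_lift b b = cycle_integral n + root_offset b - root_offset b"
    by (rule AJ_lift_flow[OF assms assms]) blast
  then have "n \<in> H1Z" by (simp add: H1Z_iff)
  then show ?thesis using n(3) by (simp add: periods_def)
qed

text \<open>The paths \<open>b \<rightarrow> x\<close> and \<open>b \<rightarrow> b' \<rightarrow> x\<close> differ by a closed path.\<close>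

lemma AJ_lift_change_base:
  assumes "b \<in> points" "b' \<in> points" "x \<in> points"
  shows "AJ_lift b x - (AJ_lift b' x + AJ_lift b b') \<in> periods"
proof -
  obtain n where n: "\<And>e. e \<notin> arcs G \<Longrightarrow> n e = 0"
    "\<And>v. flow_boundary n v = of_bool (v = root_vertex x) - of_bool (v = root_vertex b)"
    "AJ_lift b x = cycle_integral n + root_offset x - root_offset b"
    by (rule AJ_lift_flow[OF assms(1,3)]) blast
  obtain n' where n': "\<And>e. e \<notin> arcs G \<Longrightarrow> n' e = 0"
    "\<And>v. flow_boundary n' v = of_bool (v = root_vertex x) - of_bool (v = root_vertex b')"
    "AJ_lift b' x = cycle_integral n' + root_offset x - root_offset b'"
    by (rule AJ_lift_flow[OF assms(2,3)]) blast
  obtain m where m: "\<And>e. e \<notin> arcs G \<Longrightarrow> m e = 0"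
    "\<And>v. flow_boundary m v = of_bool (v = root_vertex b') - of_bool (v = root_vertex b)"
    "AJ_lift b b' = cycle_integral m + root_offset b' - root_offset b"
    by (rule AJ_lift_flow[OF assms(1,2)]) blast
  have "n - (n' + m) \<in> H1Z"
    unfolding H1Z_iff additive.diff[OF additive_flow_boundary] additive.add[OF additive_flow_boundary]
      n(2) n'(2) m(2)
    by (simp add: n(1) n'(1) m(1))
  moreover have "AJ_lift b x - (AJ_lift b' x + AJ_lift b b') = cycle_integral (n - (n' + m))"
    unfolding additive.diff[OF additive_cycle_integral] additive.add[OF additive_cycle_integral]
      n(3) n'(3) m(3)
    by (simp add: algebra_simps)
  ultimately show ?thesis by (simp add: periods_def)
qed

text \<open>Regrouped by vertices, both sums collect at \<open>v\<close> the value of \<open>F v\<close> at the flow through \<open>v\<close>. This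
  is the form in which harmonicity makes contributions of the vertices cancel.\<close>

lemma sum_head_eq_sum_tail:
  assumes F: "\<And>v. additive (F v)"
    and balanced: "\<And>v. v \<in> verts G \<Longrightarrow> (\<Sum>e\<in>in_arcs G v. \<eta> e) = (\<Sum>e\<in>out_arcs G v. \<eta> e)"
  shows "(\<Sum>e\<in>arcs G. F (head G e) (\<eta> e)) = (\<Sum>e\<in>arcs G. F (tail G e) (\<eta> e))"
proof -
  have "(\<Sum>e\<in>arcs G. F (head G e) (\<eta> e)) = (\<Sum>v\<in>verts G. \<Sum>e\<in>{e \<in> arcs G. head G e = v}. F (head G e) (\<eta> e))"
    by (rule sum.group[symmetric]) auto
  also have "\<dots> = (\<Sum>v\<in>verts G. F v (\<Sum>e\<in>in_arcs G v. \<eta> e))"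
    unfolding additive.sum[OF F] by (intro sum.cong) (auto simp: in_arcs_def)
  also have "\<dots> = (\<Sum>v\<in>verts G. F v (\<Sum>e\<in>out_arcs G v. \<eta> e))"
    by (intro sum.cong refl) (simp add: balanced)
  also have "\<dots> = (\<Sum>v\<in>verts G. \<Sum>e\<in>{e \<in> arcs G. tail G e = v}. F (tail G e) (\<eta> e))"
    unfolding additive.sum[OF F] by (intro sum.cong) (auto simp: out_arcs_def)
  also have "\<dots> = (\<Sum>e\<in>arcs G. F (tail G e) (\<eta> e))"
    by (rule sum.group) auto
  finally show ?thesis .
qed

lemma H1Z_balanced:
  "a \<in> H1Z \<Longrightarrow> v \<in> verts G \<Longrightarrow> (\<Sum>e\<in>in_arcs G v. a e) = (\<Sum>e\<in>out_arcs G v. a e)"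
  by (simp add: H1Z_def)

lemma OmegaZ_eq: "OmegaZ = cycle_form ` H1Z"
proof
  show "cycle_form ` H1Z \<subseteq> OmegaZ"
    by (auto simp: OmegaZ_def cycle_form_def H1Z_def of_int_sum[symmetric] simp del: of_int_sum)
  show "OmegaZ \<subseteq> cycle_form ` H1Z"
  proof
    fix \<omega> assume \<omega>: "\<omega> \<in> OmegaZ"
    define a where "a e = \<lfloor>\<omega> e\<rfloor>" for e
    have a: "of_int (a e) = \<omega> e" for e
      using \<omega> by (simp add: OmegaZ_def a_def)
    then have form: "\<omega> = cycle_form a"
      by (simp add: cycle_form_def)
    have "(\<Sum>e\<in>in_arcs G v. a e) - (\<Sum>e\<in>out_arcs G v. a e) = 0" if "v \<in> verts G" for v
    proof -
      have "(of_int ((\<Sum>e\<in>in_arcs G v. a e) - (\<Sum>e\<in>out_arcs G v. a e)) :: real) = 0"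
        using \<omega> that by (simp add: a OmegaZ_def)
      then show ?thesis by (simp only: of_int_eq_0_iff)
    qed
    moreover have "a e = 0" if "e \<notin> arcs G" for e
      using \<omega> that by (simp add: OmegaZ_def a_def)
    ultimately have "a \<in> H1Z" by (simp add: H1Z_def)
    with form show "\<omega> \<in> cycle_form ` H1Z" by auto
  qed
qed

lemma OmegaZ_subset_Omega: "OmegaZ \<subseteq> Omega"
  by (auto simp: Omega_def span_base)

lemma edge_covector_balanced:
  assumes "v \<in> verts G"
  shows "(\<Sum>e\<in>in_arcs G v. edge_covector e) = (\<Sum>e\<in>out_arcs G v. edge_covector e)"
proof (rule dual_eqI)
  show "(\<Sum>e\<in>in_arcs G v. edge_covector e) \<in> dual" "(\<Sum>e\<in>out_arcs G v. edge_covector e) \<in> dual"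
    by (intro subspace_sum[OF subspace_dual] edge_covector_in_dual)+
  fix \<omega> assume \<omega>: "\<omega> \<in> OmegaZ"
  have app: "(\<Sum>e\<in>I. edge_covector e) \<omega> = (\<Sum>e\<in>I. \<omega> e)" for I
    using \<omega> OmegaZ_subset_Omega
    by (induction I rule: infinite_finite_induct) (auto simp: edge_covector_apply)
  show "(\<Sum>e\<in>in_arcs G v. edge_covector e) \<omega> = (\<Sum>e\<in>out_arcs G v. edge_covector e) \<omega>"
    unfolding app using \<omega> assms by (simp add: OmegaZ_def)
qed

text \<open>Since \<open>e\<close> is not separating, a path that avoids \<open>e\<close> leads from its head back to its tail.\<close>

lemma edge_in_cycle:
  assumes e: "e \<in> arcs G"
  obtains a where "a \<in> H1Z" "a e = 1"
proof -
  have "head G e \<rightarrow>\<^sup>*\<^bsub>with_proj (mk_symmetric (del_arc e))\<^esub> tail G e"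
    using no_separating_edge[OF e] e by (auto simp: connected_def strongly_connected_def)
  from vertex_path[OF _ _ _ this] e
  obtain \<gamma> where \<gamma>: "is_path (Vertex (head G e)) \<gamma> (Vertex (tail G e))" "fst ` set \<gamma> \<subseteq> arcs G - {e}"
    by auto
  obtain n where n: "\<And>e. n e \<noteq> 0 \<Longrightarrow> e \<in> arcs G \<and> e \<in> fst ` set \<gamma>"
    "\<And>v. flow_boundary n v = of_bool (v = tail G e) - of_bool (v = head G e)"
    using path_integral_flow[OF \<gamma>(1)] by (metis root_vertex.simps(1))
  show ?thesis
  proof
    show "n + edge_flow e 1 \<in> H1Z"
      unfolding H1Z_iff additive.add[OF additive_flow_boundary] n(2) flow_boundary_edge_flow[OF e]
      using n(1) e by (auto simp: edge_flow_def)
    show "(n + edge_flow e 1) e = 1"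
      using n(1)[of e] \<gamma>(2) by (auto simp: edge_flow_def)
  qed
qed

lemma edge_covector_in_dualZ: "edge_covector e \<in> dualZ"
  using OmegaZ_subset_Omega by (auto simp: dualZ_def edge_covector_in_dual edge_covector_apply OmegaZ_def)

lemma uminus_in_dualZ: "\<phi> \<in> dualZ \<Longrightarrow> - \<phi> \<in> dualZ"
  using subspace_neg[OF subspace_dual] by (auto simp: dualZ_def)

text \<open>A covector that takes the value \<open>1\<close> on an integral form is primitive, and no other primitive
  covector lies on its ray.\<close>

lemma primitive_direction_scaleR:
  assumes v: "v \<in> dualZ" and \<omega>: "\<omega> \<in> OmegaZ" "v \<omega> = 1" and c: "c > 0"
  shows "primitive_direction (c *\<^sub>R v) = v"
  unfolding primitive_direction_def
proof (rule the_equality)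
  have "\<bar>k\<bar> = 1" if w: "w \<in> dualZ" "v = of_int k *\<^sub>R w" for w k
  proof -
    have "w \<omega> \<in> \<int>" using w(1) \<omega>(1) by (simp add: dualZ_def)
    then obtain m where "w \<omega> = of_int m" by (rule Ints_cases)
    then have "(of_int (k * m) :: real) = of_int 1"
      using \<omega>(2) w(2) by (simp add: fun_eq_iff)
    then have "k * m = 1" by (simp only: of_int_eq_iff)
    then show ?thesis using zmult_eq_1_iff by auto
  qed
  then have "primitive v"
    using v \<omega>(2) by (auto simp: primitive_def)
  then show "primitive v \<and> (\<exists>c'>0. c *\<^sub>R v = c' *\<^sub>R v)" using c by auto
  fix w assume "primitive w \<and> (\<exists>c'>0. c *\<^sub>R v = c' *\<^sub>R w)"
  then obtain c' where w: "primitive w" and c': "c' > 0" "c *\<^sub>R v = c' *\<^sub>R w" by auto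
  have "c = c' * w \<omega>" using fun_cong[OF c'(2), of \<omega>] \<omega>(2) by simp
  moreover have "w \<omega> \<in> \<int>"
    using w \<omega>(1) by (auto simp: primitive_def dualZ_def)
  then obtain m where m: "w \<omega> = of_int m" by (rule Ints_cases)
  ultimately have cm: "c = c' * of_int m" using m by simp
  have "w = (1 / c') *\<^sub>R (c' *\<^sub>R w)" using c'(1) by simp
  also have "\<dots> = of_int m *\<^sub>R v" unfolding c'(2)[symmetric] using cm c'(1) by simp
  finally have wm: "w = of_int m *\<^sub>R v" .
  then have "\<bar>m\<bar> = 1" using w v by (simp add: primitive_def)
  moreover have "m > 0" using c c'(1) cm by (simp add: zero_less_mult_iff)
  ultimately show "w = v" using wm by simp
qed

lemma primitive_direction_edge:
  assumes "e \<in> arcs G" "c > 0"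
  shows "primitive_direction (c *\<^sub>R edge_covector e) = edge_covector e"
    and "primitive_direction (c *\<^sub>R (- edge_covector e)) = - edge_covector e"
proof -
  obtain a where a: "a \<in> H1Z" "a e = 1" by (rule edge_in_cycle[OF assms(1)])
  moreover have "- cycle_form a = cycle_form (- a)"
    by (simp add: cycle_form_def fun_eq_iff)
  ultimately have "cycle_form a \<in> OmegaZ" "- cycle_form a \<in> OmegaZ"
    using add_subgroup_uminus[OF add_subgroup_H1Z a(1)] by (auto simp: OmegaZ_eq)
  moreover have "cycle_form a e = 1" using a(2) by (simp add: cycle_form_def)
  ultimately have val: "edge_covector e (cycle_form a) = 1" "(- edge_covector e) (- cycle_form a) = 1"
    and form: "cycle_form a \<in> OmegaZ" "- cycle_form a \<in> OmegaZ"
    using OmegaZ_subset_Omega by (auto simp: edge_covector_apply)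
  show "primitive_direction (c *\<^sub>R edge_covector e) = edge_covector e"
    by (rule primitive_direction_scaleR[OF edge_covector_in_dualZ form(1) val(1) assms(2)])
  show "primitive_direction (c *\<^sub>R (- edge_covector e)) = - edge_covector e"
    by (rule primitive_direction_scaleR[OF uminus_in_dualZ[OF edge_covector_in_dualZ] form(2) val(2) assms(2)])
qed

text \<open>The edge \<open>e\<close>, closed up by the chosen paths from the base point to its ends, is a cycle \<open>k e\<close>;
  along a cycle \<open>a\<close> the contributions of the chosen paths cancel, so \<open>\<Sum>\<^sub>e a e \<cdot> k e = a\<close>.\<close>

lemma AJ_edge_cycles:
  assumes b: "b \<in> points"
  obtains k where "\<And>e. e \<in> arcs G \<Longrightarrow> k e \<in> H1Z"
    and "\<And>e. e \<in> arcs G \<Longrightarrow> AJ_lift b (Vertex (tail G e)) + len e *\<^sub>R edge_covector e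
      - AJ_lift b (Vertex (head G e)) = cycle_integral (k e)"
    and "\<And>a e'. a \<in> H1Z \<Longrightarrow> (\<Sum>e\<in>arcs G. a e * k e e') = a e'"
proof -
  have "\<exists>n. (\<forall>e. e \<notin> arcs G \<longrightarrow> n e = 0) \<and>
      (\<forall>w. flow_boundary n w = of_bool (w = v) - of_bool (w = root_vertex b)) \<and>
      AJ_lift b (Vertex v) = cycle_integral n - root_offset b" if "v \<in> verts G" for v
  proof -
    have "Vertex v \<in> points" using that by (simp add: points_def)
    from AJ_lift_flow[OF b this] show ?thesis
      by (metis root_vertex.simps(1) root_offset.simps(1) add.right_neutral)
  qed
  then obtain n where n: "\<And>v e. v \<in> verts G \<Longrightarrow> e \<notin> arcs G \<Longrightarrow> n v e = 0"
    "\<And>v w. v \<in> verts G \<Longrightarrow> flow_boundary (n v) w = of_bool (w = v) - of_bool (w = root_vertex b)"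
    "\<And>v. v \<in> verts G \<Longrightarrow> AJ_lift b (Vertex v) = cycle_integral (n v) - root_offset b"
    by metis
  define k where "k e = n (tail G e) + edge_flow e 1 - n (head G e)" for e
  show ?thesis
  proof (rule that[of k])
    fix e assume e: "e \<in> arcs G"
    then have v: "tail G e \<in> verts G" "head G e \<in> verts G" by auto
    show "k e \<in> H1Z"
      unfolding H1Z_iff k_def additive.diff[OF additive_flow_boundary] additive.add[OF additive_flow_boundary]
        flow_boundary_edge_flow[OF e] n(2)[OF v(1)] n(2)[OF v(2)]
      using e by (auto simp: n(1) v edge_flow_def)
    show "AJ_lift b (Vertex (tail G e)) + len e *\<^sub>R edge_covector e
      - AJ_lift b (Vertex (head G e)) = cycle_integral (k e)"
      unfolding k_def additive.diff[OF additive_cycle_integral] additive.add[OF additive_cycle_integral]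
        cycle_integral_edge_flow[OF e] n(3)[OF v(1)] n(3)[OF v(2)]
      by (simp add: algebra_simps)
  next
    fix a e' assume a: "a \<in> H1Z"
    have "(\<Sum>e\<in>arcs G. n (head G e) e' * a e) = (\<Sum>e\<in>arcs G. n (tail G e) e' * a e)"
    proof (rule sum_head_eq_sum_tail[where F = "\<lambda>v c. n v e' * c"])
      show "additive (\<lambda>c. n v e' * c)" for v
        by standard (simp add: algebra_simps)
    qed (rule H1Z_balanced[OF a])
    moreover have "(\<Sum>e\<in>arcs G. edge_flow e 1 e' * a e) = a e'"
    proof -
      have "(\<Sum>e\<in>arcs G. edge_flow e 1 e' * a e) = (\<Sum>e\<in>arcs G. if e = e' then a e' else 0)"
        by (intro sum.cong) (auto simp: edge_flow_def)
      then show ?thesis using a by (auto simp: H1Z_def)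
    qed
    ultimately show "(\<Sum>e\<in>arcs G. a e * k e e') = a e'"
      by (simp add: k_def algebra_simps sum.distrib sum_subtractf)
  qed
qed


section \<open>Chains of dimension at most two\<close>

abbreviation cell :: "'b covector list \<Rightarrow> 'b multivector \<Rightarrow> 'b chain" where
  "cell xs \<eta> \<equiv> Poly_Mapping.single (simplex xs) \<eta>"

lemma dual_closed:
  "0 \<in> dual" "u \<in> dual \<Longrightarrow> v \<in> dual \<Longrightarrow> u + v \<in> dual"
  "u \<in> dual \<Longrightarrow> v \<in> dual \<Longrightarrow> u - v \<in> dual" "u \<in> dual \<Longrightarrow> - u \<in> dual" "u \<in> dual \<Longrightarrow> c *\<^sub>R u \<in> dual"
  by (fact subspace_0[OF subspace_dual] subspace_add[OF subspace_dual] subspace_diff[OF subspace_dual]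
    subspace_neg[OF subspace_dual] subspace_scale[OF subspace_dual])+

lemma set_subset_dual: "set [] \<subseteq> dual" "u \<in> dual \<Longrightarrow> set us \<subseteq> dual \<Longrightarrow> set (u # us) \<subseteq> dual"
  by auto

lemma periods_in_dual: "h \<in> periods \<Longrightarrow> h \<in> dual"
  using periods_subset_dual by blast

lemma bdry_point: "u \<in> dual \<Longrightarrow> bdry (cell [u] \<eta>) = 0"
  unfolding bdry_eq_facet_op by (subst facet_op_single[OF equivariant_id]) (auto simp: facet_sum_def)

lemma bdry_segment: "u \<in> dual \<Longrightarrow> v \<in> dual \<Longrightarrow> bdry (cell [u, v] \<eta>) = cell [v] \<eta> - cell [u] \<eta>"
  unfolding bdry_eq_facet_op
  by (subst facet_op_single[OF equivariant_id]) (auto simp: facet_sum_def lessThan_Suc single_uminus)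

lemma bdry_triangle:
  "u \<in> dual \<Longrightarrow> v \<in> dual \<Longrightarrow> w \<in> dual \<Longrightarrow>
     bdry (cell [u, v, w] \<eta>) = cell [v, w] \<eta> - cell [u, w] \<eta> + cell [u, v] \<eta>"
  unfolding bdry_eq_facet_op
  by (subst facet_op_single[OF equivariant_id]) (auto simp: facet_sum_def lessThan_Suc single_uminus)

text \<open>With the first vertex as the chosen point, the only facet with a nonzero contribution is the
  one opposite to that vertex.\<close>

lemma monodromy_point: "u \<in> dual \<Longrightarrow> monodromy hd (cell [u] \<eta>) = 0"
  unfolding monodromy_eq_facet_op
  by (subst facet_op_single[OF equivariant_monodromy[OF cell_points_hd]]) (auto simp: facet_sum_def)

lemma monodromy_segment:
  "u \<in> dual \<Longrightarrow> v \<in> dual \<Longrightarrow> monodromy hd (cell [u, v] \<eta>) = cell [v] (wedge (u - v) \<eta>)"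
  unfolding monodromy_eq_facet_op
  by (subst facet_op_single[OF equivariant_monodromy[OF cell_points_hd]])
    (auto simp: facet_sum_def lessThan_Suc)

lemma monodromy_triangle:
  "u \<in> dual \<Longrightarrow> v \<in> dual \<Longrightarrow> w \<in> dual \<Longrightarrow>
     monodromy hd (cell [u, v, w] \<eta>) = cell [v, w] (wedge (u - v) \<eta>)"
  unfolding monodromy_eq_facet_op
  by (subst facet_op_single[OF equivariant_monodromy[OF cell_points_hd]])
    (auto simp: facet_sum_def lessThan_Suc)

lemma simplex_translate_point: "h \<in> periods \<Longrightarrow> simplex [u + h] = simplex [u]"
  using simplex_translate[of h "[u]"] by simp

lemma simplex_translate_segment: "h \<in> periods \<Longrightarrow> simplex [u + h, v + h] = simplex [u, v]"
  using simplex_translate[of h "[u, v]"] by simp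

lemma simplex_period: "h \<in> periods \<Longrightarrow> simplex [h] = simplex [0]"
  using simplex_translate_point[of h 0] by simp

lemma simplex_period_segment: "h \<in> periods \<Longrightarrow> simplex [h, u + h] = simplex [0, u]"
  using simplex_translate_segment[of h 0 u] by simp

definition null_homologous :: "'b multivector set \<Rightarrow> 'b chain set" where
  "null_homologous A = bdry ` coeff_chains A (Suc (Suc 0))"

lemma boundaries_eq_null_homologous: "boundaries p (Suc 0) = null_homologous (Ext p)"
  by (simp add: boundaries_def null_homologous_def chains_eq)

lemma add_subgroup_null_homologous: "add_subgroup A \<Longrightarrow> add_subgroup (null_homologous A)"
  unfolding null_homologous_def by (intro add_subgroup_image additive_bdry add_subgroup_coeff_chains)

lemma triangle_null_homologous:
  assumes "add_subgroup A" "\<eta> \<in> A" "u \<in> dual" "v \<in> dual" "w \<in> dual"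
  shows "cell [v, w] \<eta> - cell [u, w] \<eta> + cell [u, v] \<eta> \<in> null_homologous A"
  unfolding null_homologous_def bdry_triangle[OF assms(3-5), symmetric]
  using assms by (intro imageI single_in_coeff_chains set_subset_dual) auto

text \<open>The triangle \<open>[0, h, h' + h]\<close> has the edge \<open>[h, h' + h]\<close>, which is \<open>[0, h']\<close> in the Jacobian.\<close>

lemma period_segment_add:
  assumes A: "add_subgroup A" "\<eta> \<in> A" and h: "h \<in> periods" "h' \<in> periods"
  shows "cell [0, h + h'] \<eta> - cell [0, h] \<eta> - cell [0, h'] \<eta> \<in> null_homologous A"
proof -
  have "cell [h, h' + h] \<eta> - cell [0, h' + h] \<eta> + cell [0, h] \<eta> \<in> null_homologous A"
    using h by (intro triangle_null_homologous A dual_closed periods_in_dual)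
  from add_subgroup_uminus[OF add_subgroup_null_homologous[OF A(1)] this] show ?thesis
    unfolding simplex_period_segment[OF h(1)] by (simp add: algebra_simps)
qed

lemma period_segment_of_int:
  assumes A: "add_subgroup A" "\<eta> \<in> A" and h: "h \<in> periods"
  shows "cell [0, of_int n *\<^sub>R h] \<eta> - cell [0, h] (of_int n *\<^sub>R \<eta>) \<in> null_homologous A"
  by (rule biadditive_modulo_of_int[where F = "\<lambda>h. cell [0, h]",
        OF add_subgroup_null_homologous[OF A(1)] add_subgroup_periods h period_segment_add[OF A]
          additive_single])

lemma period_segment_combination:
  fixes I :: "'i set"
  assumes A: "add_subgroup A" "\<eta> \<in> A" and h: "\<And>i. i \<in> I \<Longrightarrow> h i \<in> periods"
  shows "cell [0, \<Sum>i\<in>I. of_int (n i) *\<^sub>R h i] \<eta> - (\<Sum>i\<in>I. cell [0, h i] (of_int (n i) *\<^sub>R \<eta>))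
    \<in> null_homologous A"
proof -
  note B = add_subgroup_null_homologous[OF A(1)]
  have "cell [0, \<Sum>i\<in>I. of_int (n i) *\<^sub>R h i] \<eta> - (\<Sum>i\<in>I. cell [0, of_int (n i) *\<^sub>R h i] \<eta>)
      \<in> null_homologous A"
    by (rule additive_modulo_sum[where f = "\<lambda>h. cell [0, h] \<eta>", OF B add_subgroup_periods _ period_segment_add[OF A]])
      (intro add_subgroup_of_int add_subgroup_periods h)
  moreover have "(\<Sum>i\<in>I. cell [0, of_int (n i) *\<^sub>R h i] \<eta> - cell [0, h i] (of_int (n i) *\<^sub>R \<eta>))
      \<in> null_homologous A"
    by (intro add_subgroup_sum B period_segment_of_int A h)
  ultimately show ?thesis
    using add_subgroup_add[OF B] by (fastforce simp: sum_subtractf)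
qed


section \<open>Images of the curve in its Jacobian\<close>

text \<open>The chain of a map from the curve to the Jacobian with the value \<open>r v\<close> at the vertex \<open>v\<close>,
  affine on every edge \<open>e\<close> with displacement \<open>d e\<close>, and with coefficient \<open>\<eta> e\<close> there.\<close>

definition edge_chain ::
    "('a \<Rightarrow> 'b covector) \<Rightarrow> ('b \<Rightarrow> 'b covector) \<Rightarrow> ('b \<Rightarrow> 'b multivector) \<Rightarrow> 'b chain" where
  "edge_chain r d \<eta> = (\<Sum>e\<in>arcs G. cell [r (tail G e), r (tail G e) + d e] (\<eta> e))"

lemma edge_chain_cong_periods:
  assumes "\<And>v. v \<in> verts G \<Longrightarrow> r v - r' v \<in> periods"
  shows "edge_chain r d \<eta> = edge_chain r' d \<eta>"
  unfolding edge_chain_def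
proof (intro sum.cong refl)
  fix e assume "e \<in> arcs G"
  then have "r (tail G e) - r' (tail G e) \<in> periods" using assms by auto
  from simplex_translate_segment[OF this, of "r' (tail G e)" "r' (tail G e) + d e"]
  show "cell [r (tail G e), r (tail G e) + d e] (\<eta> e) = cell [r' (tail G e), r' (tail G e) + d e] (\<eta> e)"
    by (simp add: algebra_simps)
qed

definition balanced :: "('b \<Rightarrow> 'm::comm_monoid_add) \<Rightarrow> bool" where
  "balanced \<eta> \<longleftrightarrow> (\<forall>v\<in>verts G. (\<Sum>e\<in>in_arcs G v. \<eta> e) = (\<Sum>e\<in>out_arcs G v. \<eta> e))"

text \<open>Contract the image of the curve to the origin along segments from the origin. The segments to
  the vertices cancel by balancing, and what remains of an edge is the closed geodesic whose class is
  the period by which the displacement of the edge fails to match the values at its ends.\<close>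

lemma edge_chain_homologous:
  assumes A: "add_subgroup A" "\<And>e. e \<in> arcs G \<Longrightarrow> \<eta> e \<in> A" "balanced \<eta>"
    and r: "\<And>v. r v \<in> dual" and d: "\<And>e. d e \<in> dual"
    and h: "\<And>e. e \<in> arcs G \<Longrightarrow> h e \<in> periods"
      "\<And>e. e \<in> arcs G \<Longrightarrow> r (tail G e) + d e = r (head G e) + h e"
  shows "edge_chain r d \<eta> - (\<Sum>e\<in>arcs G. cell [0, h e] (\<eta> e)) \<in> null_homologous A"
proof -
  note B = add_subgroup_null_homologous[OF A(1)]
  have "cell [r (tail G e), r (tail G e) + d e] (\<eta> e) - cell [0, h e] (\<eta> e)
      - cell [0, r (head G e)] (\<eta> e) + cell [0, r (tail G e)] (\<eta> e) \<in> null_homologous A"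
    if e: "e \<in> arcs G" for e
  proof -
    have "cell [r (tail G e), r (tail G e) + d e] (\<eta> e) - cell [0, r (tail G e) + d e] (\<eta> e)
        + cell [0, r (tail G e)] (\<eta> e) \<in> null_homologous A"
      by (intro triangle_null_homologous A e dual_closed r d)
    moreover have "cell [h e, r (head G e) + h e] (\<eta> e) - cell [0, r (head G e) + h e] (\<eta> e)
        + cell [0, h e] (\<eta> e) \<in> null_homologous A"
      by (intro triangle_null_homologous A e dual_closed r periods_in_dual h(1))
    ultimately show ?thesis
      using add_subgroup_diff[OF B] unfolding h(2)[OF e] simplex_period_segment[OF h(1)[OF e]]
      by (fastforce simp: algebra_simps)
  qed
  then have "(\<Sum>e\<in>arcs G. cell [r (tail G e), r (tail G e) + d e] (\<eta> e) - cell [0, h e] (\<eta> e)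
      - cell [0, r (head G e)] (\<eta> e) + cell [0, r (tail G e)] (\<eta> e)) \<in> null_homologous A"
    by (intro add_subgroup_sum B)
  moreover have "(\<Sum>e\<in>arcs G. cell [0, r (head G e)] (\<eta> e)) = (\<Sum>e\<in>arcs G. cell [0, r (tail G e)] (\<eta> e))"
    using A(3) by (intro sum_head_eq_sum_tail[where F = "\<lambda>v. cell [0, r v]"] additive_single)
      (simp add: balanced_def)
  ultimately show ?thesis
    by (simp add: edge_chain_def sum.distrib sum_subtractf)
qed

text \<open>The parallelograms swept out by the edges of \<open>edge_chain\<close> under translation by \<open>w\<close>, each cut into two
  triangles.\<close>

definition prism ::
    "('a \<Rightarrow> 'b covector) \<Rightarrow> ('b \<Rightarrow> 'b covector) \<Rightarrow> ('b \<Rightarrow> 'b multivector) \<Rightarrow> 'b covector \<Rightarrow> 'b chain" where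
  "prism r d \<eta> w = (\<Sum>e\<in>arcs G.
     cell [r (tail G e), r (tail G e) + w, r (tail G e) + w + d e] (\<eta> e) -
     cell [r (tail G e), r (tail G e) + d e, r (tail G e) + w + d e] (\<eta> e))"

lemma prism_in_coeff_chains:
  assumes "add_subgroup A" "\<And>e. e \<in> arcs G \<Longrightarrow> \<eta> e \<in> A"
    and "\<And>v. r v \<in> dual" "\<And>e. d e \<in> dual" "w \<in> dual"
  shows "prism r d \<eta> w \<in> coeff_chains A (Suc (Suc 0))"
  unfolding prism_def
proof (intro add_subgroup_sum[OF add_subgroup_coeff_chains[OF assms(1)]]
    add_subgroup_diff[OF add_subgroup_coeff_chains[OF assms(1)]] single_in_coeff_chains[OF assms(1)] assms(2))
  show "set [r (tail G e), r (tail G e) + w, r (tail G e) + w + d e] \<subseteq> dual"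
    "set [r (tail G e), r (tail G e) + d e, r (tail G e) + w + d e] \<subseteq> dual" for e
    by (intro set_subset_dual dual_closed(2) assms)+
qed auto

text \<open>The side walls over the vertices cancel by balancing.\<close>

lemma bdry_prism:
  assumes bal: "balanced \<eta>"
    and r: "\<And>v. r v \<in> dual" and d: "\<And>e. d e \<in> dual" and w: "w \<in> dual"
    and h: "\<And>e. e \<in> arcs G \<Longrightarrow> h e \<in> periods"
      "\<And>e. e \<in> arcs G \<Longrightarrow> r (tail G e) + d e = r (head G e) + h e"
  shows "bdry (prism r d \<eta> w) = edge_chain (\<lambda>v. r v + w) d \<eta> - edge_chain r d \<eta>"
proof -
  have "bdry (prism r d \<eta> w) = (\<Sum>e\<in>arcs G.
      cell [r (tail G e) + w, r (tail G e) + w + d e] (\<eta> e)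
      - cell [r (tail G e), r (tail G e) + d e] (\<eta> e)
      + cell [r (tail G e), r (tail G e) + w] (\<eta> e) - cell [r (head G e), r (head G e) + w] (\<eta> e))"
    unfolding prism_def additive.sum[OF additive_bdry] additive.diff[OF additive_bdry]
  proof (intro sum.cong refl)
    fix e assume e: "e \<in> arcs G"
    have "simplex [r (tail G e) + d e, r (tail G e) + w + d e] = simplex [r (head G e), r (head G e) + w]"
    proof -
      have "r (tail G e) + w + d e = r (head G e) + w + h e"
        using arg_cong[OF h(2)[OF e], of "\<lambda>x. x + w"] by (simp only: ac_simps)
      then show ?thesis
        by (simp only: h(2)[OF e] simplex_translate_segment[OF h(1)[OF e]])
    qed
    then show "bdry (cell [r (tail G e), r (tail G e) + w, r (tail G e) + w + d e] (\<eta> e))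
        - bdry (cell [r (tail G e), r (tail G e) + d e, r (tail G e) + w + d e] (\<eta> e)) =
      cell [r (tail G e) + w, r (tail G e) + w + d e] (\<eta> e)
      - cell [r (tail G e), r (tail G e) + d e] (\<eta> e)
      + cell [r (tail G e), r (tail G e) + w] (\<eta> e) - cell [r (head G e), r (head G e) + w] (\<eta> e)"
      by (simp only: bdry_triangle dual_closed r d w) simp
  qed
  moreover have "(\<Sum>e\<in>arcs G. cell [r (head G e), r (head G e) + w] (\<eta> e))
      = (\<Sum>e\<in>arcs G. cell [r (tail G e), r (tail G e) + w] (\<eta> e))"
    using bal by (intro sum_head_eq_sum_tail[where F = "\<lambda>v. cell [r v, r v + w]"] additive_single)
      (simp add: balanced_def)
  ultimately show ?thesis
    by (simp add: edge_chain_def sum.distrib sum_subtractf)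
qed

text \<open>The first edge of the second triangle is parallel to the edge of the curve and hence to the
  coefficient; the first edge of the first triangle is the translation \<open>w\<close>.\<close>

lemma monodromy_prism:
  assumes r: "\<And>v. r v \<in> dual" and d: "\<And>e. d e \<in> dual" and w: "w \<in> dual"
    and tangent: "\<And>e. e \<in> arcs G \<Longrightarrow> wedge (d e) (\<eta> e) = 0"
  shows "monodromy hd (prism r d \<eta> w) = - edge_chain (\<lambda>v. r v + w) d (\<lambda>e. wedge w (\<eta> e))"
  unfolding prism_def edge_chain_def additive.sum[OF additive_monodromy[OF cell_points_hd]]
    additive.diff[OF additive_monodromy[OF cell_points_hd]] sum_negf[symmetric]
proof (intro sum.cong refl)
  fix e assume e: "e \<in> arcs G"
  have "x - (x + u) = - u" for x u :: "'b covector" by simp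
  then show "monodromy hd (cell [r (tail G e), r (tail G e) + w, r (tail G e) + w + d e] (\<eta> e)) -
      monodromy hd (cell [r (tail G e), r (tail G e) + d e, r (tail G e) + w + d e] (\<eta> e)) =
      - cell [r (tail G e) + w, r (tail G e) + w + d e] (wedge w (\<eta> e))"
    by (simp only: monodromy_triangle dual_closed r d w wedge_minus_left tangent[OF e])
      (simp add: single_uminus)
qed

text \<open>The difference of any two points of an edge is parallel to the edge. If the coefficient of the edge
  is also parallel to it, their exterior product vanishes.\<close>

lemma point_shift_edge_chain:
  assumes pt: "cell_points pt" and r: "\<And>v. r v \<in> dual" and d: "\<And>e. d e \<in> dual"
    and tangent: "\<And>e. e \<in> arcs G \<Longrightarrow> wedge (d e) (\<eta> e) = 0"
  shows "point_shift pt (edge_chain r d \<eta>) = 0"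
  unfolding edge_chain_def additive.sum[OF additive_point_shift]
proof (intro sum.neutral ballI)
  fix e assume e: "e \<in> arcs G"
  let ?x = "r (tail G e)"
  have dual: "set [?x, ?x + d e] \<subseteq> dual" using dual_closed r d by simp
  then have "pt [?x, ?x + d e] \<in> convex hull (set [?x, ?x + d e])"
    using pt unfolding cell_points_def by blast
  then have "pt [?x, ?x + d e] \<in> convex hull {?x, ?x + d e}" by simp
  then obtain s t where st: "s + t = 1" "pt [?x, ?x + d e] = s *\<^sub>R ?x + t *\<^sub>R (?x + d e)"
    by (auto simp: convex_hull_2)
  have "pt [?x, ?x + d e] = (s + t) *\<^sub>R ?x + t *\<^sub>R d e"
    unfolding st(2) by (simp only: scaleR_add_left scaleR_add_right add.assoc)
  then have "pt [?x, ?x + d e] - hd [?x, ?x + d e] = t *\<^sub>R d e"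
    by (simp add: st(1))
  then show "point_shift pt (cell [?x, ?x + d e] (\<eta> e)) = 0"
    using point_shift_single[OF pt _ dual, of "\<eta> e"] by (simp add: wedge_scaleR_left tangent[OF e])
qed

lemma monodromy_edge_chain:
  assumes r: "\<And>v. r v \<in> dual" and d: "\<And>e. d e \<in> dual"
    and tangent: "\<And>e. e \<in> arcs G \<Longrightarrow> wedge (d e) (\<eta> e) = 0"
  shows "monodromy hd (edge_chain r d \<eta>) = 0"
  unfolding edge_chain_def additive.sum[OF additive_monodromy[OF cell_points_hd]]
proof (intro sum.neutral ballI)
  fix e assume e: "e \<in> arcs G"
  have "x - (x + u) = - u" for x u :: "'b covector" by simp
  then show "monodromy hd (cell [r (tail G e), r (tail G e) + d e] (\<eta> e)) = 0"
    by (simp only: monodromy_segment dual_closed r d wedge_minus_left tangent[OF e]) simp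
qed

text \<open>The torus spanned by the periods \<open>a\<close> and \<open>h\<close>, as a parallelogram cut along its diagonal.\<close>

definition torus :: "'b covector \<Rightarrow> 'b covector \<Rightarrow> 'b multivector \<Rightarrow> 'b chain" where
  "torus a h \<eta> = cell [0, a, h + a] \<eta> - cell [0, h, a + h] \<eta>"

lemma torus_in_coeff_chains:
  assumes "add_subgroup A" "\<eta> \<in> A" "a \<in> dual" "h \<in> dual"
  shows "torus a h \<eta> \<in> coeff_chains A (Suc (Suc 0))"
  unfolding torus_def
proof (intro add_subgroup_diff[OF add_subgroup_coeff_chains[OF assms(1)]]
    single_in_coeff_chains[OF assms(1)] assms(2))
  show "set [0, a, h + a] \<subseteq> dual" "set [0, h, a + h] \<subseteq> dual"
    by (intro set_subset_dual dual_closed(1,2) assms)+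
qed auto

lemma bdry_torus: "a \<in> periods \<Longrightarrow> h \<in> periods \<Longrightarrow> bdry (torus a h \<eta>) = 0"
  unfolding torus_def additive.diff[OF additive_bdry]
  by (simp only: bdry_triangle periods_in_dual dual_closed simplex_period_segment) (simp add: add.commute)

lemma monodromy_torus:
  "a \<in> periods \<Longrightarrow> h \<in> periods \<Longrightarrow>
     monodromy hd (torus a h \<eta>) = cell [0, a] (wedge h \<eta>) - cell [0, h] (wedge a \<eta>)"
  unfolding torus_def additive.diff[OF additive_monodromy[OF cell_points_hd]]
  by (simp only: monodromy_triangle periods_in_dual dual_closed simplex_period_segment diff_0 wedge_minus_left)
    (simp add: single_uminus)


section \<open>Fundamental chains\<close>

lemma fundamental_chain_eq:
  "fundamental_chain = linear_ext (\<lambda>P n. Poly_Mapping.single P (of_int n *\<^sub>R tangent P))"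
  by (rule ext) (simp add: fundamental_chain_def linear_ext_def)

lemma additive_multiple_single: "additive (\<lambda>n. Poly_Mapping.single P (of_int n *\<^sub>R \<eta>))"
  for \<eta> :: "'b multivector"
  by standard (simp add: scaleR_left_distrib single_add)

lemma additive_fundamental_chain: "additive fundamental_chain"
  unfolding fundamental_chain_eq by (rule additive_linear_ext[OF additive_multiple_single])

lemma fundamental_chain_single:
  "fundamental_chain (Poly_Mapping.single P n) = Poly_Mapping.single P (of_int n *\<^sub>R tangent P)"
  unfolding fundamental_chain_eq by (rule linear_ext_single[OF additive_multiple_single])

lemma tangent_point: "tangent (simplex [u]) = wedges []"
proof -
  obtain h where "rep (simplex [u]) = map (\<lambda>x. x + h) [u]" by (rule rep_simplex)
  then show ?thesis by (simp add: tangent_def)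
qed

lemma tangent_segment: "tangent (simplex [u, u + d]) = wedges [primitive_direction d]"
proof -
  obtain h where "rep (simplex [u, u + d]) = map (\<lambda>x. x + h) [u, u + d]" by (rule rep_simplex)
  moreover have "(u + d + h) - (u + h) = d" by simp
  ultimately show ?thesis by (simp add: tangent_def)
qed

definition edge_vector :: "'b \<Rightarrow> 'b covector" where
  "edge_vector e = len e *\<^sub>R edge_covector e"

lemma edge_vector_in_dual: "edge_vector e \<in> dual"
  by (simp add: edge_vector_def dual_closed edge_covector_in_dual)

lemma edge_vector_tangent:
  "wedge (edge_vector e) (wedges [edge_covector e]) = 0"
  "wedge (- edge_vector e) (wedges [- edge_covector e]) = 0"
  using wedge_self[of "len e" "edge_covector e"] wedge_self[of "len e" "- edge_covector e"]
  by (simp_all add: edge_vector_def)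

lemma fundamental_chain_curve:
  "fundamental_chain (curve_cycle b) =
     edge_chain (\<lambda>v. AJ_lift b (Vertex v)) edge_vector (\<lambda>e. wedges [edge_covector e])"
  unfolding curve_cycle_def edge_chain_def additive.sum[OF additive_fundamental_chain]
proof (intro sum.cong refl)
  fix e assume e: "e \<in> arcs G"
  show "fundamental_chain (Poly_Mapping.single (simplex (AJ_edge b e)) 1) =
    cell [AJ_lift b (Vertex (tail G e)), AJ_lift b (Vertex (tail G e)) + edge_vector e] (wedges [edge_covector e])"
    using primitive_direction_edge(1)[OF e len_pos[OF e]]
    by (simp add: fundamental_chain_single AJ_edge_def Let_def path_integral_single tangent_segment
        edge_vector_def)
qed

lemma fundamental_chain_curve_neg:
  "fundamental_chain (curve_cycle_neg b) =
     edge_chain (\<lambda>v. - AJ_lift b (Vertex v)) (\<lambda>e. - edge_vector e) (\<lambda>e. wedges [- edge_covector e])"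
  unfolding curve_cycle_neg_def edge_chain_def additive.sum[OF additive_fundamental_chain]
proof (intro sum.cong refl)
  fix e assume e: "e \<in> arcs G"
  let ?u = "AJ_lift b (Vertex (tail G e))"
  have "map uminus (AJ_edge b e) = [- ?u, - ?u + - edge_vector e]"
    by (simp add: AJ_edge_def Let_def path_integral_single edge_vector_def)
  then show "fundamental_chain (Poly_Mapping.single (simplex (map uminus (AJ_edge b e))) 1) =
    cell [- ?u, - ?u + - edge_vector e] (wedges [- edge_covector e])"
    using primitive_direction_edge(2)[OF e len_pos[OF e]]
    by (simp only: fundamental_chain_single tangent_segment) (simp add: edge_vector_def)
qed

lemma fundamental_chain_ceresa:
  "fundamental_chain (ceresa_cycle b) =
     edge_chain (\<lambda>v. AJ_lift b (Vertex v)) edge_vector (\<lambda>e. wedges [edge_covector e]) -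
     edge_chain (\<lambda>v. - AJ_lift b (Vertex v)) (\<lambda>e. - edge_vector e) (\<lambda>e. wedges [- edge_covector e])"
  unfolding ceresa_cycle_def additive.diff[OF additive_fundamental_chain]
    fundamental_chain_curve fundamental_chain_curve_neg ..

lemma balanced_additive: "additive f \<Longrightarrow> balanced \<eta> \<Longrightarrow> balanced (\<lambda>e. f (\<eta> e))"
  by (simp add: balanced_def additive.sum[symmetric])

lemma balanced_edge_covector: "balanced edge_covector"
  by (simp add: balanced_def edge_covector_balanced)

lemma balanced_edge_tangent: "balanced (\<lambda>e. wedges [edge_covector e])"
  by (rule balanced_additive[OF additive_wedges_single balanced_edge_covector])

lemma wedges_uminus: "wedges [- v] = - wedges [v]"
  by (rule additive.minus[OF additive_wedges_single])

lemma balanced_edge_tangent_neg: "balanced (\<lambda>e. wedges [- edge_covector e])"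
  unfolding wedges_uminus
  by (rule balanced_additive[OF _ balanced_edge_tangent]) (standard, rule minus_add_distrib)

lemma edge_tangent_in_ExtZ:
  "wedges [edge_covector e] \<in> ExtZ (Suc 0)" "wedges [- edge_covector e] \<in> ExtZ (Suc 0)"
  using edge_covector_in_dualZ uminus_in_dualZ by (auto intro!: wedges_in_ExtZ)

lemma ceresa_chain_trivial:
  assumes "cell_points pt"
  shows "point_shift pt (fundamental_chain (ceresa_cycle b)) = 0"
    and "monodromy hd (fundamental_chain (ceresa_cycle b)) = 0"
  unfolding fundamental_chain_ceresa additive.diff[OF additive_point_shift]
    additive.diff[OF additive_monodromy[OF cell_points_hd]]
  by (simp_all only: point_shift_edge_chain[OF assms] monodromy_edge_chain AJ_lift_in_dual
      edge_vector_in_dual dual_closed(4) edge_vector_tangent diff_self)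

lemma flipped_period_segment:
  assumes A: "add_subgroup A" "\<eta> \<in> A" and h: "h \<in> periods"
  shows "cell [0, - h] (- \<eta>) - cell [0, h] \<eta> \<in> null_homologous A"
  using period_segment_of_int[OF A(1) add_subgroup_uminus[OF A] h, of "-1"] by simp

text \<open>How far the values of the Abel--Jacobi map at the ends of an edge fail to match the displacement along
  it, for the curve and for its negative.\<close>

lemma edge_cycle_periods:
  assumes b: "b \<in> points"
  obtains k where "\<And>e. e \<in> arcs G \<Longrightarrow> k e \<in> H1Z"
    and "\<And>e. e \<in> arcs G \<Longrightarrow> cycle_integral (k e) \<in> periods"
    and "\<And>e. e \<in> arcs G \<Longrightarrow> - cycle_integral (k e) \<in> periods"
    and "\<And>e. e \<in> arcs G \<Longrightarrow> AJ_lift b (Vertex (tail G e)) + edge_vector e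
      = AJ_lift b (Vertex (head G e)) + cycle_integral (k e)"
    and "\<And>e. e \<in> arcs G \<Longrightarrow> - AJ_lift b (Vertex (tail G e)) + - edge_vector e
      = - AJ_lift b (Vertex (head G e)) + - cycle_integral (k e)"
    and "\<And>a e'. a \<in> H1Z \<Longrightarrow> (\<Sum>e\<in>arcs G. a e * k e e') = a e'"
proof -
  obtain k where k: "\<And>e. e \<in> arcs G \<Longrightarrow> k e \<in> H1Z"
    "\<And>e. e \<in> arcs G \<Longrightarrow> AJ_lift b (Vertex (tail G e)) + len e *\<^sub>R edge_covector e
      - AJ_lift b (Vertex (head G e)) = cycle_integral (k e)"
    "\<And>a e'. a \<in> H1Z \<Longrightarrow> (\<Sum>e\<in>arcs G. a e * k e e') = a e'"
    by (rule AJ_edge_cycles[OF b]) blast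
  show ?thesis
  proof (rule that[of k])
    fix e assume e: "e \<in> arcs G"
    show "cycle_integral (k e) \<in> periods" using k(1)[OF e] by (simp add: periods_def)
    then show "- cycle_integral (k e) \<in> periods" by (rule add_subgroup_uminus[OF add_subgroup_periods])
    show eq: "AJ_lift b (Vertex (tail G e)) + edge_vector e
        = AJ_lift b (Vertex (head G e)) + cycle_integral (k e)"
      unfolding k(2)[OF e, symmetric] edge_vector_def by (simp add: algebra_simps)
    show "- AJ_lift b (Vertex (tail G e)) + - edge_vector e
        = - AJ_lift b (Vertex (head G e)) + - cycle_integral (k e)"
      using arg_cong[OF eq, of uminus] by (simp only: minus_add_distrib)
  qed (use k in auto)
qed

text \<open>Multiplication by \<open>-1\<close> on the Jacobian reverses both the period of a closed geodesic and its
  tangent vector, so that \<open>\<Gamma>\<close> and \<open>\<Gamma>\<^sup>-\<close> are homologous over the integers.\<close>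

lemma ceresa_null_homologous:
  assumes b: "b \<in> points"
  obtains \<xi> where "\<xi> \<in> chainsZ (Suc 0) (Suc (Suc 0))" "bdry \<xi> = fundamental_chain (ceresa_cycle b)"
proof -
  obtain k where "\<And>e. e \<in> arcs G \<Longrightarrow> k e \<in> H1Z"
    and k: "\<And>e. e \<in> arcs G \<Longrightarrow> cycle_integral (k e) \<in> periods"
      "\<And>e. e \<in> arcs G \<Longrightarrow> - cycle_integral (k e) \<in> periods"
      "\<And>e. e \<in> arcs G \<Longrightarrow> AJ_lift b (Vertex (tail G e)) + edge_vector e
        = AJ_lift b (Vertex (head G e)) + cycle_integral (k e)"
      "\<And>e. e \<in> arcs G \<Longrightarrow> - AJ_lift b (Vertex (tail G e)) + - edge_vector e
        = - AJ_lift b (Vertex (head G e)) + - cycle_integral (k e)"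
    by (rule edge_cycle_periods[OF b]) blast
  let ?A = "ExtZ (Suc 0)"
  note A = add_subgroup_ExtZ[of "Suc 0"]
  note B = add_subgroup_null_homologous[OF A]
  let ?E = "edge_chain (\<lambda>v. AJ_lift b (Vertex v)) edge_vector (\<lambda>e. wedges [edge_covector e])"
  let ?E' = "edge_chain (\<lambda>v. - AJ_lift b (Vertex v)) (\<lambda>e. - edge_vector e) (\<lambda>e. wedges [- edge_covector e])"
  let ?S = "\<Sum>e\<in>arcs G. cell [0, cycle_integral (k e)] (wedges [edge_covector e])"
  let ?S' = "\<Sum>e\<in>arcs G. cell [0, - cycle_integral (k e)] (wedges [- edge_covector e])"
  have "?E - ?S \<in> null_homologous ?A"
    by (intro edge_chain_homologous A edge_tangent_in_ExtZ balanced_edge_tangent AJ_lift_in_dual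
        edge_vector_in_dual k)
  moreover have "?E' - ?S' \<in> null_homologous ?A"
    by (intro edge_chain_homologous A edge_tangent_in_ExtZ balanced_edge_tangent_neg AJ_lift_in_dual
        edge_vector_in_dual dual_closed(4) k)
  moreover have "?S' - ?S \<in> null_homologous ?A"
    unfolding wedges_uminus sum_subtractf[symmetric]
    by (intro add_subgroup_sum B flipped_period_segment A edge_tangent_in_ExtZ k)
  ultimately have "(?E - ?S) - (?E' - ?S') - (?S' - ?S) \<in> null_homologous ?A"
    by (rule add_subgroup_diff[OF B add_subgroup_diff[OF B]])
  then have "fundamental_chain (ceresa_cycle b) \<in> null_homologous ?A"
    by (simp add: fundamental_chain_ceresa)
  then show ?thesis
    using that by (auto simp: null_homologous_def chainsZ_eq)
qed


section \<open>The polarisation class\<close>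

lemma cycle_integral_combination:
  "cycle_integral (\<lambda>e. \<Sum>i\<in>I. c i * a i e) = (\<Sum>i\<in>I. of_int (c i) *\<^sub>R cycle_integral (a i))"
proof
  fix \<omega>
  have "(\<Sum>e\<in>arcs G. (\<Sum>i\<in>I. of_int (c i) * of_int (a i e)) * (len e * \<omega> e))
      = (\<Sum>i\<in>I. of_int (c i) * (\<Sum>e\<in>arcs G. of_int (a i e) * (len e * \<omega> e)))"
    unfolding sum_distrib_left sum_distrib_right by (subst sum.swap) (simp add: mult.assoc)
  then show "cycle_integral (\<lambda>e. \<Sum>i\<in>I. c i * a i e) \<omega>
      = (\<Sum>i\<in>I. of_int (c i) *\<^sub>R cycle_integral (a i)) \<omega>"
    by (simp add: sum_apply cycle_integral_def)
qed

text \<open>Writing the cycles \<open>k e\<close> in the basis, the coefficients are those of the dual basis with respect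
  to the edge covectors: both compute the coordinates of a cycle \<open>a\<close>, because \<open>\<Sum>\<^sub>e a e \<cdot> k e = a\<close>.\<close>

lemma dual_basis_coefficients:
  assumes basis: "is_basis as" and dual_basis: "is_dual_basis as bs"
    and k: "\<And>e. e \<in> arcs G \<Longrightarrow> k e \<in> H1Z"
      "\<And>a e'. a \<in> H1Z \<Longrightarrow> (\<Sum>e\<in>arcs G. a e * k e e') = a e'"
  obtains c where
    "\<And>e. e \<in> arcs G \<Longrightarrow> cycle_integral (k e) = (\<Sum>i<genus. of_int (c e i) *\<^sub>R cycle_integral (as i))"
    "\<And>i. i < genus \<Longrightarrow> bs i = (\<Sum>e\<in>arcs G. of_int (c e i) *\<^sub>R edge_covector e)"
proof -
  have coords: "\<exists>!c :: nat \<Rightarrow> int. (\<forall>i\<ge>genus. c i = 0) \<and> a = (\<lambda>e. \<Sum>i<genus. c i * as i e)"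
    if "a \<in> H1Z" for a
    using basis that by (simp add: is_basis_def)
  have "\<exists>c :: nat \<Rightarrow> int. (\<forall>i\<ge>genus. c i = 0) \<and> k e = (\<lambda>e'. \<Sum>i<genus. c i * as i e')"
    if "e \<in> arcs G" for e
    using coords[OF k(1)[OF that]] by (rule ex1_implies_ex)
  then obtain c :: "'b \<Rightarrow> nat \<Rightarrow> int" where
    c: "\<And>e i. e \<in> arcs G \<Longrightarrow> i \<ge> genus \<Longrightarrow> c e i = 0"
      "\<And>e. e \<in> arcs G \<Longrightarrow> k e = (\<lambda>e'. \<Sum>i<genus. c e i * as i e')"
    by metis
  show ?thesis
  proof
    fix e assume "e \<in> arcs G"
    then show "cycle_integral (k e) = (\<Sum>i<genus. of_int (c e i) *\<^sub>R cycle_integral (as i))"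
      by (simp only: c(2) cycle_integral_combination)
  next
    fix i assume i: "i < genus"
    have bs: "bs i \<in> dual"
      using dual_basis i dualZ_subset_dual by (auto simp: is_dual_basis_def)
    show "bs i = (\<Sum>e\<in>arcs G. of_int (c e i) *\<^sub>R edge_covector e)"
    proof (rule dual_eqI[OF bs])
      show "(\<Sum>e\<in>arcs G. of_int (c e i) *\<^sub>R edge_covector e) \<in> dual"
        by (intro subspace_sum[OF subspace_dual] dual_closed edge_covector_in_dual)
      fix \<omega> assume "\<omega> \<in> OmegaZ"
      then obtain a where a: "a \<in> H1Z" "\<omega> = cycle_form a" by (auto simp: OmegaZ_eq)
      define is_coord where "is_coord d \<longleftrightarrow> (\<forall>i\<ge>genus. d i = 0) \<and> a = (\<lambda>e. \<Sum>i<genus. d i * as i e)"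
        for d :: "nat \<Rightarrow> int"
      have unique: "\<exists>!d. is_coord d"
        unfolding is_coord_def by (rule coords[OF a(1)])
      then obtain d where coord: "is_coord d" by blast
      then have d: "a = (\<lambda>e. \<Sum>i<genus. d i * as i e)" by (simp add: is_coord_def)
      have as: "cycle_form (as j) \<in> Omega" if "j < genus" for j
        using basis that OmegaZ_subset_Omega by (auto simp: is_basis_def OmegaZ_eq)
      have form: "cycle_form a = (\<Sum>j<genus. of_int (d j) *\<^sub>R cycle_form (as j))"
        by (subst d) (simp add: cycle_form_def fun_eq_iff sum_apply)
      have "bs i (cycle_form a) = (\<Sum>j<genus. bs i (of_int (d j) *\<^sub>R cycle_form (as j)))"
        unfolding form by (intro dual_sum[OF bs] subspace_scale[OF subspace_Omega] as) simp
      also have "\<dots> = (\<Sum>j<genus. if j = i then of_int (d i) else 0)"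
        using dual_basis i by (intro sum.cong) (auto simp: dual_scaleR[OF bs as] is_dual_basis_def)
      finally have lhs: "bs i (cycle_form a) = of_int (d i)"
        using i by simp
      have "a e' = (\<Sum>j<genus. (\<Sum>e\<in>arcs G. a e * c e j) * as j e')" for e'
      proof -
        have "a e' = (\<Sum>e\<in>arcs G. a e * (\<Sum>j<genus. c e j * as j e'))"
          unfolding k(2)[OF a(1), symmetric, of e'] by (intro sum.cong refl) (simp add: c(2))
        also have "\<dots> = (\<Sum>j<genus. (\<Sum>e\<in>arcs G. a e * c e j) * as j e')"
          unfolding sum_distrib_left sum_distrib_right by (subst sum.swap) (simp add: mult.assoc)
        finally show ?thesis .
      qed
      moreover have "\<forall>j\<ge>genus. (\<Sum>e\<in>arcs G. a e * c e j) = 0"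
        by (simp add: c(1))
      ultimately have "is_coord (\<lambda>j. \<Sum>e\<in>arcs G. a e * c e j)"
        unfolding is_coord_def by blast
      with unique coord have "(\<lambda>j. \<Sum>e\<in>arcs G. a e * c e j) = d" by blast
      then have "d i = (\<Sum>e\<in>arcs G. a e * c e i)" by auto
      moreover have "cycle_form a \<in> Omega"
        using a OmegaZ_subset_Omega by (auto simp: OmegaZ_eq)
      ultimately show "bs i \<omega> = (\<Sum>e\<in>arcs G. of_int (c e i) *\<^sub>R edge_covector e) \<omega>"
        unfolding a(2) lhs by (simp add: sum_apply edge_covector_apply cycle_form_def mult.commute)
    qed
  qed
qed

lemma additive_wedge_omega_chain: "additive (wedge_omega_chain as bs)"
  by standard
    (simp add: wedge_omega_chain_def tensor_def wedges_Cons wedge_add_left single_add sum.distrib)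

lemma wedge_omega_chain_in_cycles:
  assumes "is_basis as" "is_dual_basis as bs" "v \<in> dual"
  shows "wedge_omega_chain as bs v \<in> cycles (Suc (Suc 0)) (Suc 0)"
proof -
  have "tensor (as i) (wedges [v, bs i]) \<in> cycles (Suc (Suc 0)) (Suc 0)" if i: "i < genus" for i
  proof -
    have I: "cycle_integral (as i) \<in> periods" and bs: "bs i \<in> dual"
      using assms i dualZ_subset_dual by (auto simp: is_basis_def is_dual_basis_def periods_def)
    have "bdry (cell [0, cycle_integral (as i)] (wedges [v, bs i])) = 0"
      by (simp only: bdry_segment dual_closed periods_in_dual I simplex_period) simp
    moreover have "cell [0, cycle_integral (as i)] (wedges [v, bs i]) \<in> chains (Suc (Suc 0)) (Suc 0)"
      unfolding chains_eq
      by (intro single_in_coeff_chains add_subgroup_Ext set_subset_dual dual_closed periods_in_dual I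
          wedges_in_Ext bs assms) simp_all
    ultimately show ?thesis by (simp add: cycles_def tensor_def)
  qed
  then show ?thesis
    unfolding wedge_omega_chain_def by (intro add_subgroup_sum add_subgroup_cycles) simp
qed

text \<open>Symmetry of the polarisation: \<open>\<Sum>\<^sub>i a\<^sub>i \<and> b\<^sub>i\<close> vanishes. Rewritten as a sum over the edges, it
  consists of the products of each edge vector with the edge covector parallel to it, and of vertex
  terms that cancel by balancing.\<close>

lemma sum_basis_wedge_dual_basis:
  assumes b: "b \<in> points" and basis: "is_basis as" "is_dual_basis as bs"
  shows "(\<Sum>i<genus. wedge (cycle_integral (as i)) (wedges [bs i])) = 0"
proof -
  obtain k where k: "\<And>e. e \<in> arcs G \<Longrightarrow> k e \<in> H1Z"
    "\<And>e. e \<in> arcs G \<Longrightarrow> AJ_lift b (Vertex (tail G e)) + edge_vector e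
      = AJ_lift b (Vertex (head G e)) + cycle_integral (k e)"
    "\<And>a e'. a \<in> H1Z \<Longrightarrow> (\<Sum>e\<in>arcs G. a e * k e e') = a e'"
    by (rule edge_cycle_periods[OF b]) blast
  obtain c where c:
    "\<And>e. e \<in> arcs G \<Longrightarrow> cycle_integral (k e) = (\<Sum>i<genus. of_int (c e i) *\<^sub>R cycle_integral (as i))"
    "\<And>i. i < genus \<Longrightarrow> bs i = (\<Sum>e\<in>arcs G. of_int (c e i) *\<^sub>R edge_covector e)"
    by (rule dual_basis_coefficients[OF basis k(1,3)]) blast+
  let ?\<tau> = "\<lambda>e. wedges [edge_covector e]"
  have "(\<Sum>i<genus. wedge (cycle_integral (as i)) (wedges [bs i]))
      = (\<Sum>i<genus. \<Sum>e\<in>arcs G. of_int (c e i) *\<^sub>R wedge (cycle_integral (as i)) (?\<tau> e))"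
    by (intro sum.cong refl)
      (simp only: lessThan_iff c(2) additive.sum[OF additive_wedges_single] wedges_single_scaleR
        additive.sum[OF additive_wedge] linear_scale[OF linear_wedge])
  also have "\<dots> = (\<Sum>e\<in>arcs G. wedge (cycle_integral (k e)) (?\<tau> e))"
    by (subst sum.swap)
      (intro sum.cong refl, simp only: c(1) additive.sum[OF additive_wedge_left] wedge_scaleR_left)
  also have "\<dots> = (\<Sum>e\<in>arcs G. wedge (AJ_lift b (Vertex (tail G e))) (?\<tau> e))
      - (\<Sum>e\<in>arcs G. wedge (AJ_lift b (Vertex (head G e))) (?\<tau> e))"
    unfolding sum_subtractf[symmetric]
  proof (intro sum.cong refl)
    fix e assume e: "e \<in> arcs G"
    show "wedge (cycle_integral (k e)) (?\<tau> e)
        = wedge (AJ_lift b (Vertex (tail G e))) (?\<tau> e) - wedge (AJ_lift b (Vertex (head G e))) (?\<tau> e)"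
      using arg_cong[OF k(2)[OF e], of "\<lambda>v. wedge v (?\<tau> e)"]
      by (simp add: wedge_add_left edge_vector_tangent del: plus_fun_apply)
  qed
  also have "\<dots> = 0"
    using sum_head_eq_sum_tail[where F = "\<lambda>v. wedge (AJ_lift b (Vertex v))" and \<eta> = ?\<tau>,
        OF additive_wedge] balanced_edge_tangent
    by (simp add: balanced_def)
  finally show ?thesis .
qed

text \<open>For a period \<open>h\<close>, the class \<open>h \<and> \<omega>\<close> is the image under the monodromy operator of the integral
  class \<open>\<Sum>\<^sub>i (a\<^sub>i \<and> h) \<otimes> b\<^sub>i\<close>; this is what makes \<open>v \<mapsto> v \<and> \<omega>\<close> well defined modulo periods.\<close>

lemma wedge_omega_chain_period:
  assumes b: "b \<in> points" and basis: "is_basis as" "is_dual_basis as bs" and h: "h \<in> periods"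
  obtains \<zeta> where "\<zeta> \<in> cyclesZ (Suc 0) (Suc (Suc 0))" "monodromy hd \<zeta> = wedge_omega_chain as bs h"
proof
  let ?I = "\<lambda>i. cycle_integral (as i)"
  let ?\<zeta> = "\<Sum>i<genus. torus (?I i) h (wedges [bs i])"
  have I: "?I i \<in> periods" and bs: "bs i \<in> dualZ" if "i < genus" for i
    using basis that by (auto simp: is_basis_def is_dual_basis_def periods_def)
  have "bdry ?\<zeta> = 0"
    unfolding additive.sum[OF additive_bdry] by (intro sum.neutral ballI bdry_torus I h) simp
  moreover have "?\<zeta> \<in> chainsZ (Suc 0) (Suc (Suc 0))"
    unfolding chainsZ_eq
    by (intro add_subgroup_sum add_subgroup_coeff_chains add_subgroup_ExtZ torus_in_coeff_chains
        wedges_in_ExtZ periods_in_dual I h) (use bs in auto)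
  ultimately show "?\<zeta> \<in> cyclesZ (Suc 0) (Suc (Suc 0))"
    by (simp add: cyclesZ_def)
  have "monodromy hd ?\<zeta> = (\<Sum>i<genus. cell [0, ?I i] (wedge h (wedges [bs i]))
      - cell [0, h] (wedge (?I i) (wedges [bs i])))"
    unfolding additive.sum[OF additive_monodromy[OF cell_points_hd]]
    by (intro sum.cong refl monodromy_torus I h) simp
  also have "\<dots> = wedge_omega_chain as bs h - cell [0, h] (\<Sum>i<genus. wedge (?I i) (wedges [bs i]))"
    by (simp only: sum_subtractf sum_single wedge_omega_chain_def tensor_def wedges_Cons[of h])
  finally show "monodromy hd ?\<zeta> = wedge_omega_chain as bs h"
    by (simp add: sum_basis_wedge_dual_basis[OF b basis])
qed


section \<open>The Abel--Jacobi image of a difference of points\<close>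

definition augmentation :: "'b chain \<Rightarrow> 'b multivector" where
  "augmentation = linear_ext (\<lambda>_ \<eta>. \<eta>)"

text \<open>The sum of the points of a 0-chain, computed in chosen lifts.\<close>

definition point_sum :: "'b chain \<Rightarrow> 'b multivector" where
  "point_sum = linear_ext (\<lambda>P. wedge (hd (rep P)))"

lemma additive_augmentation: "additive augmentation"
  unfolding augmentation_def by (rule additive_linear_ext) (standard, rule refl)

lemma augmentation_single: "augmentation (Poly_Mapping.single P \<eta>) = \<eta>"
  unfolding augmentation_def by (rule linear_ext_single) (standard, rule refl)

lemma additive_point_sum: "additive point_sum"
  unfolding point_sum_def by (rule additive_linear_ext[OF additive_wedge])

lemma point_sum_single: "point_sum (Poly_Mapping.single P \<eta>) = wedge (hd (rep P)) \<eta>"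
  unfolding point_sum_def by (rule linear_ext_single[where g = "\<lambda>P. wedge (hd (rep P))", OF additive_wedge])

lemma augmentation_bdry:
  assumes "c \<in> coeff_chains A (Suc 0)"
  shows "augmentation (bdry c) = 0"
proof (rule coeff_chains_eqI[where f = "\<lambda>c. augmentation (bdry c)" and f' = "\<lambda>_. 0", OF _ _ assms])
  show "additive (\<lambda>c. augmentation (bdry c))"
    by standard (simp add: additive.add[OF additive_bdry] additive.add[OF additive_augmentation])
  show "additive (\<lambda>_ :: 'b chain. 0 :: 'b multivector)"
    by standard (rule add_0[symmetric])
next
  fix xs and \<eta> :: "'b multivector"
  assume xs: "length xs = Suc (Suc 0)" "set xs \<subseteq> dual"
  then obtain u v where uv: "xs = [u, v]" by (cases xs; cases "tl xs") auto
  with xs(2) show "augmentation (bdry (cell xs \<eta>)) = 0"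
    by (simp add: bdry_segment additive.diff[OF additive_augmentation] augmentation_single)
qed

lemma wedge_period_in_periods:
  assumes "\<eta> \<in> ExtZ 0" "h \<in> periods"
  shows "wedge h \<eta> \<in> (\<lambda>h. wedges [h]) ` periods"
proof -
  let ?P = "(\<lambda>h. wedges [h]) ` periods"
  have P: "add_subgroup ?P"
    by (rule add_subgroup_image[OF additive_wedges_single add_subgroup_periods])
  have "add_subgroup {\<eta>. wedge h \<eta> \<in> ?P}"
    using add_subgroup_zero[OF P] add_subgroup_diff[OF P]
    by (simp add: add_subgroup_def additive.zero[OF additive_wedge] additive.diff[OF additive_wedge]
        del: zero_fun_apply)
  moreover have "wedge h (wedges []) \<in> ?P"
    using assms(2) by (simp add: wedges_Cons)
  ultimately have "ExtZ 0 \<subseteq> {\<eta>. wedge h \<eta> \<in> ?P}"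
    unfolding ExtZ_def by (intro add_subgroup_subset_group_closure) auto
  with assms(1) show ?thesis by auto
qed

text \<open>The monodromy of an integral 1-chain adds up the displacements of its segments, up to sign.
  The displacement of a segment is the difference of the chosen lifts of its ends up to a period, and
  on a cycle the chosen lifts cancel.\<close>

lemma augmentation_monodromy:
  assumes "\<zeta> \<in> cyclesZ 0 (Suc 0)"
  shows "augmentation (monodromy hd \<zeta>) \<in> (\<lambda>h. wedges [h]) ` periods"
proof -
  let ?P = "(\<lambda>h. wedges [h]) ` periods"
  note add = additive.add[OF additive_bdry] additive.add[OF additive_augmentation]
    additive.add[OF additive_point_sum] additive.add[OF additive_monodromy[OF cell_points_hd]]
  have "augmentation (monodromy hd \<zeta>) + point_sum (bdry \<zeta>) \<in> ?P"
  proof (rule coeff_chains_memI[where f = "\<lambda>\<zeta>. augmentation (monodromy hd \<zeta>) + point_sum (bdry \<zeta>)"])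
    show "additive (\<lambda>\<zeta>. augmentation (monodromy hd \<zeta>) + point_sum (bdry \<zeta>))"
      by standard (simp only: add ac_simps)
    show "add_subgroup ?P"
      by (rule add_subgroup_image[OF additive_wedges_single add_subgroup_periods])
    show "\<zeta> \<in> coeff_chains (ExtZ 0) (Suc 0)"
      using assms by (simp add: cyclesZ_def chainsZ_eq)
  next
    fix xs and \<eta> :: "'b multivector"
    assume xs: "length xs = Suc (Suc 0)" "set xs \<subseteq> dual" and \<eta>: "\<eta> \<in> ExtZ 0"
    then obtain u v where uv: "xs = [u, v]" by (cases xs; cases "tl xs") auto
    then have dual: "u \<in> dual" "v \<in> dual" using xs(2) by auto
    obtain h where h: "h \<in> periods" "rep (simplex [u]) = map (\<lambda>x. x + h) [u]" by (rule rep_simplex)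
    obtain k where k: "k \<in> periods" "rep (simplex [v]) = map (\<lambda>x. x + k) [v]" by (rule rep_simplex)
    have "augmentation (monodromy hd (cell xs \<eta>)) + point_sum (bdry (cell xs \<eta>))
        = wedge (u - v) \<eta> + (wedge (v + k) \<eta> - wedge (u + h) \<eta>)"
      unfolding uv monodromy_segment[OF dual] bdry_segment[OF dual] augmentation_single
        additive.diff[OF additive_point_sum] point_sum_single h(2) k(2) by simp
    also have "\<dots> = wedge (k - h) \<eta>"
      by (simp only: wedge_add_left wedge_diff_left) simp
    also have "\<dots> \<in> ?P"
      by (intro wedge_period_in_periods \<eta> add_subgroup_diff[OF add_subgroup_periods] h k)
    finally show "augmentation (monodromy hd (cell xs \<eta>)) + point_sum (bdry (cell xs \<eta>)) \<in> ?P" .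
  qed
  then show ?thesis
    using assms by (simp add: cyclesZ_def additive.zero[OF additive_point_sum] del: zero_fun_apply)
qed

lemma point_chain_in_cycles: "v \<in> dual \<Longrightarrow> cell [0] (wedges [v]) \<in> cycles (Suc 0) 0"
  unfolding cycles_def chains_eq
  by (auto simp: bdry_point dual_closed(1) intro!: single_in_coeff_chains add_subgroup_Ext wedges_in_Ext)

text \<open>Boundaries have augmentation zero, so the augmentation recovers \<open>v - v'\<close> from the monodromy of an
  integral cycle, where it is a period.\<close>

lemma JH_class_point_eqD:
  assumes v: "v \<in> dual" "v' \<in> dual"
    and eq: "JH_class hd 0 (cell [0] (wedges [v])) = JH_class hd 0 (cell [0] (wedges [v']))"
  shows "v - v' \<in> periods"
proof -
  obtain \<zeta> where \<zeta>: "\<zeta> \<in> cyclesZ 0 (Suc 0)"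
    "cell [0] (wedges [v]) - cell [0] (wedges [v']) - monodromy hd \<zeta> \<in> boundaries (Suc 0) 0"
    using eq JH_class_eq_iff[OF cell_points_hd point_chain_in_cycles[OF v(1)] point_chain_in_cycles[OF v(2)]]
    by blast
  then obtain \<theta> where "\<theta> \<in> coeff_chains (Ext (Suc 0)) (Suc 0)"
    "cell [0] (wedges [v]) - cell [0] (wedges [v']) - monodromy hd \<zeta> = bdry \<theta>"
    by (auto simp: boundaries_def chains_eq)
  then have "augmentation (cell [0] (wedges [v]) - cell [0] (wedges [v']) - monodromy hd \<zeta>) = 0"
    by (simp only: augmentation_bdry)
  then have "wedges [v - v'] = augmentation (monodromy hd \<zeta>)"
    by (simp only: additive.diff[OF additive_augmentation] augmentation_single
        additive.diff[OF additive_wedges_single] right_minus_eq)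
  then show ?thesis
    using augmentation_monodromy[OF \<zeta>(1)] by (auto simp: inj_wedges_single)
qed

text \<open>Since \<open>AJ_lift b b\<close> is a period, the 0-cycle is \<open>[0] - [w]\<close> with \<open>w = AJ_lift b b'\<close>. It bounds the
  segment from \<open>w\<close> to \<open>0\<close>, whose monodromy is the point \<open>0\<close> with coefficient \<open>w\<close>.\<close>

lemma AJ_point_difference:
  assumes pt: "cell_points pt" and b: "b \<in> points" "b' \<in> points"
  shows "AJ pt 0 (point_difference b b') = JH_class hd 0 (cell [0] (wedges [AJ_lift b b']))"
proof -
  let ?w = "AJ_lift b b'"
  have F: "fundamental_chain (point_difference b b') = cell [0] (wedges []) - cell [?w] (wedges [])"
    unfolding point_difference_def additive.diff[OF additive_fundamental_chain] fundamental_chain_single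
      tangent_point simplex_period[OF AJ_lift_self[OF b(1)]] by simp
  have \<xi>: "cell [?w, 0] (wedges []) \<in> chainsZ 0 (Suc 0)"
    unfolding chainsZ_eq
    by (intro single_in_coeff_chains add_subgroup_ExtZ set_subset_dual dual_closed AJ_lift_in_dual
        wedges_in_ExtZ) simp_all
  have shift: "point_shift pt (cell [u] \<eta>) = 0" if u: "u \<in> dual" for u \<eta>
  proof -
    have "set [u] \<subseteq> dual" using u by simp
    then have "pt [u] \<in> convex hull (set [u])"
      using pt unfolding cell_points_def by blast
    then show ?thesis
      using point_shift_single[OF pt _ \<open>set [u] \<subseteq> dual\<close>, of \<eta>] by simp
  qed
  have "AJ pt 0 (point_difference b b') = JH_class hd 0 (monodromy hd (cell [?w, 0] (wedges [])))"
  proof (rule AJ_eqI[OF pt \<xi>])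
    show "bdry (cell [?w, 0] (wedges [])) = fundamental_chain (point_difference b b')"
      unfolding F by (intro bdry_segment AJ_lift_in_dual dual_closed)
    show "point_shift pt (fundamental_chain (point_difference b b')) = 0"
      unfolding F additive.diff[OF additive_point_shift]
      by (simp only: shift AJ_lift_in_dual dual_closed diff_self)
    show "monodromy hd (fundamental_chain (point_difference b b')) = 0"
      unfolding F additive.diff[OF additive_monodromy[OF cell_points_hd]]
      by (simp only: monodromy_point AJ_lift_in_dual dual_closed diff_self)
  qed
  then show ?thesis
    by (simp only: monodromy_segment AJ_lift_in_dual dual_closed diff_0_right wedges_Cons)
qed

text \<open>Two vectors with the same class differ by a period \<open>h\<close>, and \<open>h \<and> \<omega>\<close> lies in the lattice.\<close>

lemma wedge_omega_class:
  assumes pt: "cell_points pt" and b: "b \<in> points" and basis: "is_basis as" "is_dual_basis as bs"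
    and w: "w \<in> dual"
  shows "wedge_omega pt as bs (JH_class hd 0 (cell [0] (wedges [w])))
    = JH_class hd (Suc 0) (wedge_omega_chain as bs w)"
  unfolding wedge_omega_def JH_class_hd[OF pt] One_nat_def
proof (rule the_equality)
  fix Y assume "\<exists>v\<in>dual. JH_class hd 0 (cell [0] (wedges [w])) = JH_class hd 0 (cell [0] (wedges [v]))
    \<and> Y = JH_class hd (Suc 0) (wedge_omega_chain as bs v)"
  then obtain v where v: "v \<in> dual" "JH_class hd 0 (cell [0] (wedges [w])) = JH_class hd 0 (cell [0] (wedges [v]))"
    "Y = JH_class hd (Suc 0) (wedge_omega_chain as bs v)" by blast
  have "w - v \<in> periods" by (rule JH_class_point_eqD[OF w v(1,2)])
  then obtain \<zeta> where \<zeta>: "\<zeta> \<in> cyclesZ (Suc 0) (Suc (Suc 0))"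
    "monodromy hd \<zeta> = wedge_omega_chain as bs (w - v)"
    using wedge_omega_chain_period[OF b basis] by blast
  have zero: "wedge_omega_chain as bs w - wedge_omega_chain as bs v - monodromy hd \<zeta> = 0"
    unfolding \<zeta>(2) additive.diff[OF additive_wedge_omega_chain] by simp
  have "JH_class hd (Suc 0) (wedge_omega_chain as bs w) = JH_class hd (Suc 0) (wedge_omega_chain as bs v)"
    unfolding JH_class_eq_iff[OF cell_points_hd wedge_omega_chain_in_cycles[OF basis w]
        wedge_omega_chain_in_cycles[OF basis v(1)]]
    by (intro bexI[OF _ \<zeta>(1)]) (simp only: zero add_subgroup_zero[OF add_subgroup_boundaries])
  then show "Y = JH_class hd (Suc 0) (wedge_omega_chain as bs w)" using v(3) by simp
qed (use w in blast)


section \<open>Changing the base point of the Ceresa class\<close>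

lemma ceresa_class_eqI:
  assumes pt: "cell_points pt"
    and \<xi>: "\<xi> \<in> chainsZ (Suc 0) (Suc (Suc 0))" "bdry \<xi> = fundamental_chain (ceresa_cycle b)"
  shows "ceresa_class pt b = JH_class hd (Suc 0) (monodromy hd \<xi>)"
    and "monodromy hd \<xi> \<in> cycles (Suc (Suc 0)) (Suc 0)"
proof -
  show "ceresa_class pt b = JH_class hd (Suc 0) (monodromy hd \<xi>)"
    unfolding ceresa_class_def One_nat_def
    by (rule AJ_eqI[OF pt \<xi> ceresa_chain_trivial[OF pt]])
  show "monodromy hd \<xi> \<in> cycles (Suc (Suc 0)) (Suc 0)"
    using \<xi> chainsZ_subset_chains ceresa_chain_trivial(2)[OF pt]
    by (intro monodromy_in_cycles cell_points_hd) auto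
qed

text \<open>Expand the cycles \<open>k e\<close> in the basis and collect the coefficient of each basis cycle; the
  coefficients of \<open>k\<close> assemble the dual basis.\<close>

lemma closed_geodesics_homologous_wedge_omega:
  assumes basis: "is_basis as" "is_dual_basis as bs" and w: "w \<in> dual"
    and k: "\<And>e. e \<in> arcs G \<Longrightarrow> k e \<in> H1Z"
      "\<And>a e'. a \<in> H1Z \<Longrightarrow> (\<Sum>e\<in>arcs G. a e * k e e') = a e'"
  shows "(\<Sum>e\<in>arcs G. cell [0, cycle_integral (k e)] (wedge w (wedges [edge_covector e])))
    - wedge_omega_chain as bs w \<in> null_homologous (Ext (Suc (Suc 0)))"
proof -
  let ?\<eta> = "\<lambda>e. wedge w (wedges [edge_covector e])"
  let ?I = "\<lambda>i. cycle_integral (as i)"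
  obtain c where c:
    "\<And>e. e \<in> arcs G \<Longrightarrow> cycle_integral (k e) = (\<Sum>i<genus. of_int (c e i) *\<^sub>R ?I i)"
    "\<And>i. i < genus \<Longrightarrow> bs i = (\<Sum>e\<in>arcs G. of_int (c e i) *\<^sub>R edge_covector e)"
    by (rule dual_basis_coefficients[OF basis k]) blast+
  have I: "?I i \<in> periods" if "i \<in> {..<genus}" for i
    using basis that by (auto simp: is_basis_def periods_def)
  have \<eta>: "?\<eta> e \<in> Ext (Suc (Suc 0))" for e
    by (intro wedge_in_Ext w wedges_in_Ext set_subset_dual edge_covector_in_dual) simp
  have "wedge_omega_chain as bs w = (\<Sum>i<genus. cell [0, ?I i] (\<Sum>e\<in>arcs G. of_int (c e i) *\<^sub>R ?\<eta> e))"
    unfolding wedge_omega_chain_def tensor_def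
  proof (intro sum.cong refl)
    fix i assume "i \<in> {..<genus}"
    then have "wedges [w, bs i] = (\<Sum>e\<in>arcs G. of_int (c e i) *\<^sub>R ?\<eta> e)"
      by (simp only: lessThan_iff wedges_Cons[of w] c(2) additive.sum[OF additive_wedges_single]
          wedges_single_scaleR additive.sum[OF additive_wedge] linear_scale[OF linear_wedge])
    then show "cell [0, ?I i] (wedges [w, bs i]) = cell [0, ?I i] (\<Sum>e\<in>arcs G. of_int (c e i) *\<^sub>R ?\<eta> e)"
      by simp
  qed
  also have "\<dots> = (\<Sum>e\<in>arcs G. \<Sum>i<genus. cell [0, ?I i] (of_int (c e i) *\<^sub>R ?\<eta> e))"
    unfolding sum_single[symmetric] by (rule sum.swap)
  finally have W: "wedge_omega_chain as bs w
      = (\<Sum>e\<in>arcs G. \<Sum>i<genus. cell [0, ?I i] (of_int (c e i) *\<^sub>R ?\<eta> e))" .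
  have "cell [0, cycle_integral (k e)] (?\<eta> e) - (\<Sum>i<genus. cell [0, ?I i] (of_int (c e i) *\<^sub>R ?\<eta> e))
      \<in> null_homologous (Ext (Suc (Suc 0)))" if "e \<in> arcs G" for e
    unfolding c(1)[OF that] by (intro period_segment_combination add_subgroup_Ext \<eta> I)
  then show ?thesis
    unfolding W sum_subtractf[symmetric]
    by (intro add_subgroup_sum add_subgroup_null_homologous add_subgroup_Ext)
qed

text \<open>Moving the base point translates \<open>\<Gamma>\<close> by \<open>w\<close> and \<open>\<Gamma>\<^sup>-\<close> by \<open>-w\<close>. The monodromy operator maps the
  prism swept out by \<open>\<Gamma>\<close> to \<open>-w \<and> \<Gamma>\<close> and the one swept out by \<open>\<Gamma>\<^sup>-\<close> to \<open>w \<and> \<Gamma>\<^sup>-\<close>, where \<open>w\<close> multiplies the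
  tangent vectors. Since \<open>\<Gamma>\<close> and \<open>\<Gamma>\<^sup>-\<close> both represent \<open>\<omega>\<close>, the difference of the prisms is mapped to
  \<open>-2 w \<and> \<omega>\<close> up to boundaries.\<close>

lemma ceresa_difference:
  assumes b: "b \<in> points" "b' \<in> points" and basis: "is_basis as" "is_dual_basis as bs"
  obtains \<Xi> where "\<Xi> \<in> chainsZ (Suc 0) (Suc (Suc 0))"
    "bdry \<Xi> = fundamental_chain (ceresa_cycle b) - fundamental_chain (ceresa_cycle b')"
    "monodromy hd \<Xi> + wedge_omega_chain as bs (AJ_lift b b') + wedge_omega_chain as bs (AJ_lift b b')
      \<in> boundaries (Suc (Suc 0)) (Suc 0)"
proof -
  define w where "w = AJ_lift b b'"
  define r where "r v = AJ_lift b (Vertex v)" for v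
  define r' where "r' v = AJ_lift b' (Vertex v)" for v
  define \<tau> where "\<tau> e = wedges [edge_covector e]" for e
  have dual: "w \<in> dual" "- w \<in> dual" "r v \<in> dual" "- r v \<in> dual" "r' v \<in> dual" "- r' v \<in> dual"
    "edge_vector e \<in> dual" "- edge_vector e \<in> dual" for v e
    by (simp_all only: w_def r_def r'_def AJ_lift_in_dual edge_vector_in_dual dual_closed(4))
  have neg_\<tau>: "wedges [- edge_covector e] = - \<tau> e" for e
    by (simp only: wedges_uminus \<tau>_def)
  have tangent: "wedge (edge_vector e) (\<tau> e) = 0" "wedge (- edge_vector e) (- \<tau> e) = 0" for e
    using edge_vector_tangent[of e] by (simp_all only: neg_\<tau> \<tau>_def[symmetric])
  have bal: "balanced \<tau>" "balanced (\<lambda>e. - \<tau> e)" "balanced (\<lambda>e. wedge w (\<tau> e))"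
    using balanced_edge_tangent balanced_edge_tangent_neg
      balanced_additive[OF additive_wedge balanced_edge_tangent, of w]
    by (simp_all only: neg_\<tau> \<tau>_def[symmetric])
  have \<tau>: "\<tau> e \<in> ExtZ (Suc 0)" "- \<tau> e \<in> ExtZ (Suc 0)" "wedge w (\<tau> e) \<in> Ext (Suc (Suc 0))" for e
    using edge_tangent_in_ExtZ[of e] wedge_in_Ext[OF dual(1) subsetD[OF ExtZ_subset_Ext], of "\<tau> e" "Suc 0"]
    by (simp_all only: neg_\<tau> \<tau>_def[symmetric])

  have base: "r v - (r' v + w) \<in> periods" if "v \<in> verts G" for v
    using AJ_lift_change_base[OF b, of "Vertex v"] that by (simp add: w_def r_def r'_def points_def)
  have translate: "edge_chain (\<lambda>v. r' v + w) d \<eta> = edge_chain r d \<eta>" for d \<eta>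
    by (rule edge_chain_cong_periods[symmetric]) (rule base)
  have translate_neg: "edge_chain (\<lambda>v. - r' v + - w) d \<eta> = edge_chain (\<lambda>v. - r v) d \<eta>" for d \<eta>
  proof (rule edge_chain_cong_periods[symmetric])
    fix v assume "v \<in> verts G"
    from add_subgroup_uminus[OF add_subgroup_periods base[OF this]]
    show "- r v - (- r' v + - w) \<in> periods" by (simp add: algebra_simps)
  qed

  define \<Xi> where "\<Xi> = prism r' edge_vector \<tau> w
    - prism (\<lambda>v. - r' v) (\<lambda>e. - edge_vector e) (\<lambda>e. - \<tau> e) (- w)"
  have integral: "\<Xi> \<in> chainsZ (Suc 0) (Suc (Suc 0))"
    unfolding \<Xi>_def chainsZ_eq
    by (intro add_subgroup_diff[OF add_subgroup_coeff_chains] prism_in_coeff_chains add_subgroup_ExtZ \<tau> dual)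

  obtain k' where k': "\<And>e. e \<in> arcs G \<Longrightarrow> cycle_integral (k' e) \<in> periods"
    "\<And>e. e \<in> arcs G \<Longrightarrow> - cycle_integral (k' e) \<in> periods"
    "\<And>e. e \<in> arcs G \<Longrightarrow> r' (tail G e) + edge_vector e = r' (head G e) + cycle_integral (k' e)"
    "\<And>e. e \<in> arcs G \<Longrightarrow> - r' (tail G e) + - edge_vector e = - r' (head G e) + - cycle_integral (k' e)"
    unfolding r'_def by (rule edge_cycle_periods[OF b(2)]) blast
  have boundary: "bdry \<Xi> = fundamental_chain (ceresa_cycle b) - fundamental_chain (ceresa_cycle b')"
  proof -
    have "bdry (prism r' edge_vector \<tau> w) = edge_chain r edge_vector \<tau> - edge_chain r' edge_vector \<tau>"
      unfolding translate[symmetric] by (rule bdry_prism[OF bal(1) dual(5,7,1) k'(1,3)])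
    moreover have "bdry (prism (\<lambda>v. - r' v) (\<lambda>e. - edge_vector e) (\<lambda>e. - \<tau> e) (- w))
        = edge_chain (\<lambda>v. - r v) (\<lambda>e. - edge_vector e) (\<lambda>e. - \<tau> e)
        - edge_chain (\<lambda>v. - r' v) (\<lambda>e. - edge_vector e) (\<lambda>e. - \<tau> e)"
      unfolding translate_neg[symmetric] by (rule bdry_prism[OF bal(2) dual(6,8,2) k'(2,4)])
    ultimately show ?thesis
      unfolding \<Xi>_def additive.diff[OF additive_bdry] fundamental_chain_ceresa neg_\<tau>
        \<tau>_def[symmetric] r_def[symmetric] r'_def[symmetric]
      by simp
  qed

  (* the signs of the translation and of the tangent vectors of the negative cancel in ?E' *)
  let ?E = "edge_chain r edge_vector (\<lambda>e. wedge w (\<tau> e))"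
  let ?E' = "edge_chain (\<lambda>v. - r v) (\<lambda>e. - edge_vector e) (\<lambda>e. wedge w (\<tau> e))"
  have image: "monodromy hd \<Xi> = ?E' - ?E"
  proof -
    have "wedge (- w) (- \<tau> e) = wedge w (\<tau> e)" for e
      by (simp only: wedge_minus_left additive.minus[OF additive_wedge] minus_minus)
    then show ?thesis
      unfolding \<Xi>_def additive.diff[OF additive_monodromy[OF cell_points_hd]]
        monodromy_prism[OF dual(5,7,1) tangent(1)] monodromy_prism[OF dual(6,8,2) tangent(2)]
        translate translate_neg
      by simp
  qed

  obtain k where k: "\<And>e. e \<in> arcs G \<Longrightarrow> k e \<in> H1Z"
    "\<And>e. e \<in> arcs G \<Longrightarrow> cycle_integral (k e) \<in> periods"
    "\<And>e. e \<in> arcs G \<Longrightarrow> - cycle_integral (k e) \<in> periods"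
    "\<And>e. e \<in> arcs G \<Longrightarrow> r (tail G e) + edge_vector e = r (head G e) + cycle_integral (k e)"
    "\<And>e. e \<in> arcs G \<Longrightarrow> - r (tail G e) + - edge_vector e = - r (head G e) + - cycle_integral (k e)"
    "\<And>a e'. a \<in> H1Z \<Longrightarrow> (\<Sum>e\<in>arcs G. a e * k e e') = a e'"
    unfolding r_def by (rule edge_cycle_periods[OF b(1)]) blast
  let ?B = "null_homologous (Ext (Suc (Suc 0)))"
  let ?S = "\<Sum>e\<in>arcs G. cell [0, cycle_integral (k e)] (wedge w (\<tau> e))"
  let ?S' = "\<Sum>e\<in>arcs G. cell [0, - cycle_integral (k e)] (wedge w (\<tau> e))"
  let ?W = "wedge_omega_chain as bs w"
  note B = add_subgroup_null_homologous[OF add_subgroup_Ext]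
  have E: "?E - ?S \<in> ?B"
    by (rule edge_chain_homologous[OF add_subgroup_Ext \<tau>(3) bal(3) dual(3,7) k(2,4)])
  have E': "?E' - ?S' \<in> ?B"
    by (rule edge_chain_homologous[OF add_subgroup_Ext \<tau>(3) bal(3) dual(4,8) k(3,5)])
  have "cell [0, - cycle_integral (k e)] (wedge w (\<tau> e)) + cell [0, cycle_integral (k e)] (wedge w (\<tau> e)) \<in> ?B"
    if "e \<in> arcs G" for e
    using flipped_period_segment[OF add_subgroup_Ext add_subgroup_uminus[OF add_subgroup_Ext \<tau>(3)] k(2)[OF that]]
    by (simp add: single_uminus)
  then have S': "?S' + ?S \<in> ?B"
    unfolding sum.distrib[symmetric] by (intro add_subgroup_sum B)
  have W: "?S - ?W \<in> ?B"
    unfolding \<tau>_def by (rule closed_geodesics_homologous_wedge_omega[OF basis dual(1) k(1,6)])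
  have "(?E' - ?S') - (?E - ?S) + (?S' + ?S) - (?S - ?W) - (?S - ?W) \<in> ?B"
    by (rule add_subgroup_diff[OF B add_subgroup_diff[OF B add_subgroup_add[OF B add_subgroup_diff[OF B E' E] S'] W] W])
  moreover have "(?E' - ?S') - (?E - ?S) + (?S' + ?S) - (?S - ?W) - (?S - ?W) = monodromy hd \<Xi> + ?W + ?W"
    unfolding image by (simp add: algebra_simps)
  ultimately have "monodromy hd \<Xi> + ?W + ?W \<in> boundaries (Suc (Suc 0)) (Suc 0)"
    unfolding boundaries_eq_null_homologous by (simp only:)
  with integral boundary show ?thesis
    using that unfolding w_def by blast
qed

lemma JH_class_uminus:
  assumes "cell_points pt" "c \<in> cycles (Suc p) p"
  shows "JH_class pt p (- c) = inv\<^bsub>JH pt p\<^esub> JH_class pt p c"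
proof -
  interpret group_hom "cycle_group (Suc p) p" "JH pt p" "JH_class pt p"
    using comm_group_cycle_group[of "Suc p" p] comm_group_JH[OF assms(1), of p] JH_class_hom[OF assms(1), of p]
    by (simp add: group_hom_def group_hom_axioms_def comm_group_def)
  show ?thesis
    using hom_inv[of c] assms(2) by (simp add: cycle_group_eq inv_additive_group[OF add_subgroup_cycles])
qed

lemma JH_class_add:
  assumes "cell_points pt" "c \<in> cycles (Suc p) p" "c' \<in> cycles (Suc p) p"
  shows "JH_class pt p (c + c') = JH_class pt p c \<otimes>\<^bsub>JH pt p\<^esub> JH_class pt p c'"
  using hom_mult[OF JH_class_hom[OF assms(1)], of c p c'] assms(2,3) by (simp add: cycle_group_eq)

lemma JH_class_power_minus_two:
  assumes "cell_points pt" "c \<in> cycles (Suc p) p"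
  shows "JH_class pt p c [^]\<^bsub>JH pt p\<^esub> (-2 :: int) = JH_class pt p (- (c + c))"
proof -
  interpret comm_group "JH pt p" by (rule comm_group_JH[OF assms(1)])
  have carrier: "JH_class pt p c \<in> carrier (JH pt p)"
    using hom_in_carrier[OF JH_class_hom[OF assms(1)], of c p] assms(2) by (simp add: cycle_group_eq)
  have "JH_class pt p c [^]\<^bsub>JH pt p\<^esub> (1 + 1 :: int) = JH_class pt p c \<otimes>\<^bsub>JH pt p\<^esub> JH_class pt p c"
    using carrier by (simp only: int_pow_mult int_pow_1)
  then have "JH_class pt p c [^]\<^bsub>JH pt p\<^esub> (-2 :: int)
      = inv\<^bsub>JH pt p\<^esub> (JH_class pt p c \<otimes>\<^bsub>JH pt p\<^esub> JH_class pt p c)"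
    using int_pow_neg[OF carrier, of 2] by simp
  then show ?thesis
    unfolding JH_class_uminus[OF assms(1) add_subgroup_add[OF add_subgroup_cycles assms(2,2)]]
      JH_class_add[OF assms(1,2,2)] .
qed

theorem ceresa_class_change_base:
  assumes b: "b \<in> points" "b' \<in> points" and pt: "cell_points pt"
    and basis: "is_basis as" "is_dual_basis as bs"
  shows "ceresa_class pt b \<otimes>\<^bsub>JH pt 1\<^esub> inv\<^bsub>JH pt 1\<^esub> ceresa_class pt b'
    = wedge_omega pt as bs (AJ pt 0 (point_difference b b')) [^]\<^bsub>JH pt 1\<^esub> (-2 :: int)"
proof -
  let ?W = "wedge_omega_chain as bs (AJ_lift b b')"
  obtain \<xi> where \<xi>: "\<xi> \<in> chainsZ (Suc 0) (Suc (Suc 0))" "bdry \<xi> = fundamental_chain (ceresa_cycle b)"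
    by (rule ceresa_null_homologous[OF b(1)])
  obtain \<xi>' where \<xi>': "\<xi>' \<in> chainsZ (Suc 0) (Suc (Suc 0))" "bdry \<xi>' = fundamental_chain (ceresa_cycle b')"
    by (rule ceresa_null_homologous[OF b(2)])
  obtain \<Xi> where \<Xi>: "\<Xi> \<in> chainsZ (Suc 0) (Suc (Suc 0))"
    "bdry \<Xi> = fundamental_chain (ceresa_cycle b) - fundamental_chain (ceresa_cycle b')"
    "monodromy hd \<Xi> + ?W + ?W \<in> boundaries (Suc (Suc 0)) (Suc 0)"
    by (rule ceresa_difference[OF b basis])
  note N\<xi> = ceresa_class_eqI[OF pt \<xi>] and N\<xi>' = ceresa_class_eqI[OF pt \<xi>']
  have W: "?W \<in> cycles (Suc (Suc 0)) (Suc 0)"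
    by (rule wedge_omega_chain_in_cycles[OF basis AJ_lift_in_dual])
  note Z = add_subgroup_cycles[of "Suc (Suc 0)" "Suc 0"]
  have "\<xi> - \<xi>' - \<Xi> \<in> cyclesZ (Suc 0) (Suc (Suc 0))"
    using \<xi> \<xi>' \<Xi>(1,2) add_subgroup_diff[OF add_subgroup_coeff_chains[OF add_subgroup_ExtZ]]
    by (simp add: cyclesZ_def chainsZ_eq additive.diff[OF additive_bdry])
  moreover have "(monodromy hd \<xi> + - monodromy hd \<xi>') - (- (?W + ?W)) - monodromy hd (\<xi> - \<xi>' - \<Xi>)
      \<in> boundaries (Suc (Suc 0)) (Suc 0)"
    using \<Xi>(3) unfolding additive.diff[OF additive_monodromy[OF cell_points_hd]]
    by (simp add: algebra_simps)
  ultimately have "JH_class hd (Suc 0) (monodromy hd \<xi> + - monodromy hd \<xi>') = JH_class hd (Suc 0) (- (?W + ?W))"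
    unfolding JH_class_eq_iff[OF cell_points_hd
        add_subgroup_add[OF Z N\<xi>(2) add_subgroup_uminus[OF Z N\<xi>'(2)]]
        add_subgroup_uminus[OF Z add_subgroup_add[OF Z W W]]]
    by blast
  then show ?thesis
    unfolding JH_hd[OF pt] One_nat_def N\<xi>(1) N\<xi>'(1) AJ_point_difference[OF pt b]
      wedge_omega_class[OF pt b(1) basis AJ_lift_in_dual]
      JH_class_power_minus_two[OF cell_points_hd W]
      JH_class_add[OF cell_points_hd N\<xi>(2) add_subgroup_uminus[OF Z N\<xi>'(2)]]
      JH_class_uminus[OF cell_points_hd N\<xi>'(2)] .
qed

end

theorem theorem6p6:
  fixes G :: "('a, 'b) pre_digraph" and len :: "'b \<Rightarrow> real"
    and b b' :: "('a, 'b) curve_point"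
    and pt :: "'b covector list \<Rightarrow> 'b covector"
    and as :: "nat \<Rightarrow> 'b \<Rightarrow> int" and bs :: "nat \<Rightarrow> 'b covector"
  assumes "tropical_curve G len"
    and "tropical_curve.genus G \<ge> 2"
    and "b \<in> tropical_curve.points G len" and "b' \<in> tropical_curve.points G len"
    and "tropical_curve.cell_points G len pt"
    and "tropical_curve.is_basis G as"
    and "tropical_curve.is_dual_basis G as bs"
  shows "tropical_curve.ceresa_class G len pt b
           \<otimes>\<^bsub>tropical_curve.JH G len pt 1\<^esub>
         inv\<^bsub>tropical_curve.JH G len pt 1\<^esub> tropical_curve.ceresa_class G len pt b'
       = tropical_curve.wedge_omega G len pt as bs
           (tropical_curve.AJ G len pt 0 (tropical_curve.point_difference G len b b'))
           [^]\<^bsub>tropical_curve.JH G len pt 1\<^esub> (-2 :: int)"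
  by (rule tropical_curve.ceresa_class_change_base[OF assms(1,3-7)])

end
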